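(* Let $\mathcal S$ be a (possibly infinite) set of linear subspaces of $\mathbb R^n$, let $\mathbf y=\mathbf A\mathbf x+\mathbf e$, where $\mathbf x\in\mathcal U$ and $\mathbf A$ is an $m\times n$ matrix ($m<n$) with entries independently drawn from the standard normal distribution $\mathcal N(0,1)$, and where the noise $\mathbf e\in\mathbb R^m$ has bounded energy and does not depend on $\mathbf A$. Let $\mathbf x^t$ ($t\ge0$) be the iterates of the GCoSaMP algorithm (described in the context) run on $\mathbf A,\mathbf y,\mathcal S$. Let $\eta>0$, define $m_0=\bigl(w(\mathcal U^4\cap\mathbb S^{n-1})+\eta\bigr)^2$, and assume $m\ge14.5^2m_0+1$. Then, with probability at least $1-6e^{-\eta^2/2}$, $$\|\mathbf x^t-\mathbf x\|_2\le\rho^t(m)\,\|\mathbf x^0-\mathbf x\|_2+\frac{\xi(m)}{1-\rho(m)}\,\|\mathbf e\|_2$$ holds for all $t$, where $\rho^t(m)$ denotes the $t$-th power of $\rho(m)$, $$\rho(m)=\min\left\{1,\;4\,\frac{(\sqrt m+\sqrt{m_0})^2-\bigl(\frac{m}{\sqrt{m+1}}-\sqrt{m_0}\bigr)^2}{\bigl(\frac{m}{\sqrt{m+1}}-\sqrt{m_0}\bigr)(\sqrt m+\sqrt{m_0})}\right\},$$ $$\xi(m)=\frac{2\sqrt{m_0}\sqrt{\frac{m+1}{m}}}{\frac{m^2}{m+1}-m_0}\left(2+\frac{\sqrt m+\sqrt{m_0}}{\frac{m}{\sqrt{m+1}}-\sqrt{m_0}}\right).$$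
   Context: Notation. $\|\cdot\|_2$ is the Euclidean norm; $\mathbb S^{n-1}$ is the unit Euclidean sphere of $\mathbb R^n$; $\mathbf A^*$ is the transpose of $\mathbf A$; $\mathbf P_{\mathcal V}$ is the orthogonal projection onto the linear subspace $\mathcal V$. Sums of sets are Minkowski sums. If $\rho(m)=1$, the right-hand side of the bound is read as $+\infty$. For an integer $B\ge1$, $\mathcal S^B=\{\sum_{i=1}^B\mathcal V_i:\mathcal V_i\in\mathcal S\}$ (so $\mathcal S^1=\mathcal S$), and $\mathcal U^B\subset\mathbb R^n$ is the union of all subspaces belonging to $\mathcal S^B$; $\mathcal U=\mathcal U^1$. Thus $\mathbf x\in\mathcal U$ means that $\mathbf x\in\mathcal V_0$ for some (unknown) $\mathcal V_0\in\mathcal S$. The Gaussian mean width of $\mathcal K\subset\mathbb R^n$ is $w(\mathcal K)=\mathbb E_{\mathbf g}\{\sup_{\mathbf z\in\mathcal K}\langle\mathbf g,\mathbf z\rangle\}$ with $\mathbf g\sim\mathcal N(\mathbf 0,\mathbf I_n)$. GCoSaMP algorithm. Input: $\mathbf A,\mathbf y,\mathcal S$. Initialize $\mathbf r=\mathbf y$, $\mathbf x^0=\mathbf 0$, and no selected subspace ($\mathcal V^0$ is treated as $\{\mathbf 0\}$). For $t=1,2,\dots$: 1. $\tilde{\mathbf v}=\mathbf A^*\mathbf r$; 2. $\mathcal V_\Delta^t\in\operatorname{argmin}_{\mathcal V\in\mathcal S^2}\|\tilde{\mathbf v}-\mathbf P_{\mathcal V}\tilde{\mathbf v}\|_2$;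 3. $\tilde{\mathcal V}^t=\mathcal V^{t-1}+\mathcal V_\Delta^t$; 4. $\tilde{\mathbf x}^t\in\operatorname{argmin}_{\mathbf z\in\tilde{\mathcal V}^t}\|\mathbf y-\mathbf A\mathbf z\|_2$; 5. $\mathcal V^t\in\operatorname{argmin}_{\mathcal V\in\mathcal S}\|\tilde{\mathbf x}^t-\mathbf P_{\mathcal V}\tilde{\mathbf x}^t\|_2$; 6. $\mathbf x^t=\mathbf P_{\mathcal V^t}\tilde{\mathbf x}^t$; 7. $\mathbf r=\mathbf y-\mathbf A\mathbf x^t$. The minimizations are assumed to be solved exactly (minimizers exist). *)

theory Defs
  imports "HOL-Probability.Probability"
begin

section \<open>Unions of subspaces\<close>

text \<open>The sum over \<open>i\<close> is the Minkowski sum of sets, from \<^theory>\<open>HOL-Library.Set_Algebras\<close>.\<close>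

definition subspace_sums :: "('a::real_vector) set set \<Rightarrow> nat \<Rightarrow> 'a set set" where
  "subspace_sums S B = {(\<Sum>i<B. V i) | V. \<forall>i<B. V i \<in> S}"

definition subspace_union :: "('a::real_vector) set set \<Rightarrow> nat \<Rightarrow> 'a set" where
  "subspace_union S B = \<Union> (subspace_sums S B)"

text \<open>Only meaningful when \<open>V\<close> is a linear subspace, where the point exists and is unique.\<close>

definition orth_proj :: "('a::euclidean_space) set \<Rightarrow> 'a \<Rightarrow> 'a" where
  "orth_proj V v = (THE p. p \<in> V \<and> (\<forall>u\<in>V. orthogonal (v - p) u))"


section \<open>Gaussian mean width\<close>

definition std_gaussian :: "(real ^ 'n::finite) measure" where
  "std_gaussian =
     distr (\<Pi>\<^sub>M i\<in>(UNIV::'n set). density lborel (\<lambda>u. ennreal (std_normal_density u))) borel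
       (\<lambda>f. \<chi> i. f i)"

text \<open>
  Intended for bounded sets \<open>K\<close>. The supremum over the empty set, which Isabelle leaves
  unspecified for reals, is taken to be \<open>0\<close>; this only matters when every subspace is trivial.
\<close>

definition gaussian_width :: "(real ^ 'n::finite) set \<Rightarrow> real" where
  "gaussian_width K =
     (if K = {} then 0 else integral\<^sup>L std_gaussian (\<lambda>g. SUP z\<in>K. g \<bullet> z))"


section \<open>The GCoSaMP algorithm\<close>

text \<open>
  Minimizers need not be unique, so the algorithm is a relation: \<open>X\<close> is a sequence of iterates
  produced by some sequence of choices of exact minimizers. The component \<open>r t\<close> is the
  residual available at the end of iteration \<open>t\<close>.
\<close>

definition gcosamp_iterates ::
    "real ^ 'n::finite ^ 'm::finite \<Rightarrow> real ^ 'm \<Rightarrow> (real ^ 'n) set set \<Rightarrow> (nat \<Rightarrow> real ^ 'n) \<Rightarrow> bool"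
  where
  "gcosamp_iterates A y S X \<longleftrightarrow>
     (\<exists>r V V\<Delta> Vt xt.
        r 0 = y \<and> X 0 = 0 \<and> V 0 = {0} \<and>
        (\<forall>t. let v = transpose A *v r t in
          is_arg_min (\<lambda>W. norm (v - orth_proj W v)) (\<lambda>W. W \<in> subspace_sums S 2) (V\<Delta> (Suc t)) \<and>
          Vt (Suc t) = V t + V\<Delta> (Suc t) \<and>
          is_arg_min (\<lambda>z. norm (y - A *v z)) (\<lambda>z. z \<in> Vt (Suc t)) (xt (Suc t)) \<and>
          is_arg_min (\<lambda>W. norm (xt (Suc t) - orth_proj W (xt (Suc t)))) (\<lambda>W. W \<in> S) (V (Suc t)) \<and>
          X (Suc t) = orth_proj (V (Suc t)) (xt (Suc t)) \<and>
          r (Suc t) = y - A *v X (Suc t)))"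


section \<open>Constants of the error bound\<close>

definition gcosamp_rho :: "real \<Rightarrow> real \<Rightarrow> real" where
  "gcosamp_rho m m0 =
     min 1 (4 * (((sqrt m + sqrt m0)\<^sup>2 - (m / sqrt (m + 1) - sqrt m0)\<^sup>2) /
                 ((m / sqrt (m + 1) - sqrt m0) * (sqrt m + sqrt m0))))"

definition gcosamp_xi :: "real \<Rightarrow> real \<Rightarrow> real" where
  "gcosamp_xi m m0 =
     (2 * sqrt m0 * sqrt ((m + 1) / m)) / (m\<^sup>2 / (m + 1) - m0) *
     (2 + (sqrt m + sqrt m0) / (m / sqrt (m + 1) - sqrt m0))"

end

(*
  By an induction over the iterations, the theorem follows from a one-step contraction, which
  needs three facts about A on U^4: b |z| <= |A z| <= a |z| and <A z, e> <= sqrt m0 |e| |z|.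
  They hold with a = sqrt m + sqrt m0 and b = m / sqrt (m + 2) - sqrt m0, each outside an event
  of probability exp (- eta^2 / 2). If rho(m) = 1 or 6 exp (- eta^2 / 2) >= 1 there is nothing
  to prove; otherwise the contraction has enough slack to absorb both the factor m / sqrt (m + 1)
  of rho and xi and their shape, which differs from that of the one-step estimate.

  Gaussian concentration with the sharp constant comes from a one-dimensional Prekopa-Leindler
  inequality for weights 1 / (k + 1) and k / (k + 1), which tensorizes; a 1-Lipschitz f is tested
  against - (t / k) f, and k tends to infinity. The sets that contain Minkowski combinations there
  are superlevel sets of the Gaussian density, hence intervals, so Brunn-Minkowski is not needed.

  The expectations of max |A z| and min |A z| are compared with those of |g| + <h, z> (Gordon,
  Chevet) by differentiating E ln (sum_z exp (beta psi (u_z))) along a rotation of the Gaussian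
  vector that turns u_z = (A z, 0) into (g, <h, z>), for psi (v, c) = sqrt (|v|^2 + delta^2) + c.
  Since |z| = 1, Gaussian integration by parts leaves only terms
  - (1 - <n_z, n_w>) (1 - <z, w>) <= 0, where n_z is a gradient of norm at most 1. The sign does
  not depend on the sign of beta, so one inequality controls both the maximum and the minimum.
*)
theory Submission
  imports Defs "HOL-Real_Asymp.Real_Asymp"
begin

section \<open>Gaussian concentration\<close>

text \<open>The tail exp (- eta^2 / 2) leaves no room in the concentration constant, so the tested
  maps must be exactly 1-Lipschitz: |A z| and <A z, e> are, for unit z and e, in the Frobenius norm
  of A. Two obstacles shape the middle part. A soft maximum needs finitely many z, while U^4 may
  contain uncountably many directions: the bounds are proved for finite sets Z and do not depend on
  Z, pass to a countable dense set of directions by continuity of the measure, and reach all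
  directions by continuity in z. And the norm is not differentiable at 0, hence the smoothing by
  delta, which is removed only after the expectations have been compared. The denominator sqrt (m +
  2) is what the second and fourth moments of the Gaussian norm give by a Hoelder estimate. U^4
  arises because the selected subspace lies in S^2, and so does the sum of the previous subspace and
  the one that holds x. The slack comes from rho(m) < 1, which forces a <= 1.14 (m / sqrt (m + 1) -
  sqrt m0). The noise may be random; being independent of A, it can be frozen at a fixed
  vector.\<close>

text \<open>A point between two points of \<open>C\<close> is no larger in absolute value than one
  of them, so \<open>C\<close> contains the segment and the difference of two combinations is at
  most the length of \<open>C\<close>. Letting the points of \<open>A\<close> and \<open>B\<close>
  run to their infima and suprema bounds diam A + k diam B by (k + 1) times that length, and a
  diameter bounds a measure.\<close>

lemma lborel_weighted_sum_le_symmetric: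
  fixes A B C :: "real set" and k :: nat
  assumes meas: "A \<in> sets borel" "B \<in> sets borel" "C \<in> sets borel"
    and ne: "A \<noteq> {}" "B \<noteq> {}"
    and sym: "\<And>w z. z \<in> C \<Longrightarrow> \<bar>w\<bar> \<le> \<bar>z\<bar> \<Longrightarrow> w \<in> C"
    and comb: "\<And>x y. x \<in> A \<Longrightarrow> y \<in> B \<Longrightarrow> (x + real k * y) / (real k + 1) \<in> C"
    and k: "k > 0"
  shows "emeasure lborel A + of_nat k * emeasure lborel B \<le> of_nat (Suc k) * emeasure lborel C"
proof (cases "emeasure lborel C = \<infinity>")
  case True
  then show ?thesis by (simp add: ennreal_mult_top del: of_nat_Suc)
next
  case False
  define c where "c = measure lborel C"
  have c: "emeasure lborel C = ennreal c" "c \<ge> 0"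
    using False by (auto simp: c_def emeasure_eq_ennreal_measure)
  have key: "x2 - x1 + real k * (y2 - y1) \<le> (real k + 1) * c"
    if "x1 \<in> A" "x2 \<in> A" "y1 \<in> B" "y2 \<in> B" for x1 x2 y1 y2
  proof -
    let ?z1 = "(x1 + real k * y1) / (real k + 1)" and ?z2 = "(x2 + real k * y2) / (real k + 1)"
    have z: "?z1 \<in> C" "?z2 \<in> C" using comb that by auto
    have "?z2 - ?z1 \<le> c"
    proof (cases "?z1 \<le> ?z2")
      case True
      have "{?z1..?z2} \<subseteq> C"
      proof
        fix w assume w: "w \<in> {?z1..?z2}"
        then have "?z1 \<le> w" "w \<le> ?z2" by auto
        then have "\<bar>w\<bar> \<le> \<bar>?z1\<bar> \<or> \<bar>w\<bar> \<le> \<bar>?z2\<bar>" by linarith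
        then show "w \<in> C" using sym z by blast
      qed
      then have "emeasure lborel {?z1..?z2} \<le> emeasure lborel C"
        using meas by (intro emeasure_mono) auto
      then show ?thesis using c True by (auto simp: ennreal_le_iff)
    qed (use c in auto)
    moreover have "?z2 - ?z1 = (x2 - x1 + real k * (y2 - y1)) / (real k + 1)"
      unfolding diff_divide_distrib[symmetric] by (simp add: algebra_simps)
    ultimately show ?thesis by (simp add: divide_le_eq mult.commute)
  qed
  obtain x0 y0 where x0: "x0 \<in> A" and y0: "y0 \<in> B" using ne by auto
  have bddA: "bdd_above A" "bdd_below A"
    using key[OF x0 _ y0 y0] key[OF _ x0 y0 y0]
    by (auto intro!: bdd_aboveI[of _ "x0 + (real k + 1) * c"] bdd_belowI[of _ "x0 - (real k + 1) * c"])
       (smt (verit))+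
  have 1: "real k * (y2 - y1) \<le> (real k + 1) * c - (Sup A - Inf A)" if y: "y1 \<in> B" "y2 \<in> B" for y1 y2
  proof -
    have "Sup A \<le> x1 + ((real k + 1) * c - real k * (y2 - y1))" if "x1 \<in> A" for x1
      using key[OF that _ y] ne by (intro cSup_least) (auto simp: algebra_simps)
    then have "Sup A - ((real k + 1) * c - real k * (y2 - y1)) \<le> Inf A"
      using ne by (intro cInf_greatest) (auto simp: algebra_simps)
    then show ?thesis by simp
  qed
  \<comment> \<open>What the diameter of \<open>A\<close> leaves for the diameter of
    \<open>B\<close>.\<close>
  define d where "d = ((real k + 1) * c - (Sup A - Inf A)) / real k"
  have 2: "y2 - y1 \<le> d" if "y1 \<in> B" "y2 \<in> B" for y1 y2
    using 1[OF that] k by (simp add: d_def field_simps)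
  have bddB: "bdd_above B" "bdd_below B"
    using 2[OF y0] 2[OF _ y0]
    by (auto intro!: bdd_aboveI[of _ "y0 + d"] bdd_belowI[of _ "y0 - d"]) (smt (verit))+
  have 3: "Sup B - Inf B \<le> d"
  proof -
    have "Sup B \<le> y1 + d" if "y1 \<in> B" for y1
      using 2[OF that] ne by (intro cSup_least) (auto simp: algebra_simps)
    then have "Sup B - d \<le> Inf B"
      using ne by (intro cInf_greatest) (auto simp: algebra_simps)
    then show ?thesis by simp
  qed
  have ioA: "Inf A \<le> Sup A" and ioB: "Inf B \<le> Sup B"
    using bddA bddB ne by (auto intro: cInf_le_cSup)
  have "A \<subseteq> {Inf A..Sup A}" "B \<subseteq> {Inf B..Sup B}"
    using bddA bddB by (auto intro: cInf_lower cSup_upper)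
  then have "emeasure lborel A \<le> emeasure lborel {Inf A..Sup A}"
     "emeasure lborel B \<le> emeasure lborel {Inf B..Sup B}"
    by (auto intro!: emeasure_mono)
  then have "emeasure lborel A \<le> ennreal (Sup A - Inf A)"
     "emeasure lborel B \<le> ennreal (Sup B - Inf B)"
    using ioA ioB by auto
  then have "emeasure lborel A + of_nat k * emeasure lborel B
      \<le> ennreal (Sup A - Inf A) + of_nat k * ennreal (Sup B - Inf B)"
    by (intro add_mono mult_left_mono) auto
  also have "\<dots> = ennreal ((Sup A - Inf A) + real k * (Sup B - Inf B))"
    using ioA ioB by (simp add: ennreal_of_nat_eq_real_of_nat ennreal_mult ennreal_plus)
  also have "\<dots> \<le> ennreal ((real k + 1) * c)"
    using 3 k by (intro ennreal_leI) (simp add: d_def field_simps)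
  also have "\<dots> = of_nat (Suc k) * emeasure lborel C"
    using c by (simp add: ennreal_of_nat_eq_real_of_nat ennreal_mult add.commute del: of_nat_Suc)
       (simp add: add.commute)
  finally show ?thesis .
qed

lemma nn_integral_layer_cake:
  fixes u :: "real \<Rightarrow> real"
  assumes [measurable]: "u \<in> borel_measurable borel" and "\<And>x. u x \<ge> 0"
  shows "(\<integral>\<^sup>+x. ennreal (u x) \<partial>lborel) = (\<integral>\<^sup>+t. indicator {0..} t * emeasure lborel {x. t < u x} \<partial>lborel)"
proof -
  have "(\<integral>\<^sup>+x. ennreal (u x) \<partial>lborel) = (\<integral>\<^sup>+x. (\<integral>\<^sup>+t. indicator {0..<u x} t \<partial>lborel) \<partial>lborel)"
    using assms by (intro nn_integral_cong) (simp add: emeasure_lborel_Ico)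
  also have "\<dots> = (\<integral>\<^sup>+x. (\<integral>\<^sup>+t. indicator {0..} t * indicator {t. t < u x} t \<partial>lborel) \<partial>lborel)"
    by (intro nn_integral_cong) (auto split: split_indicator)
  also have "\<dots> = (\<integral>\<^sup>+t. (\<integral>\<^sup>+x. indicator {0..} t * indicator {t. t < u x} t \<partial>lborel) \<partial>lborel)"
  proof (rule lborel_pair.Fubini')
    have "(\<lambda>(t,x). indicator {0..} t * indicator {t. t < u x} t)
      = (\<lambda>(t,x). indicator {0..} t * indicator {p. fst p < u (snd p)} (t,x) :: ennreal)"
      by (auto split: split_indicator simp: fun_eq_iff)
    also have "\<dots> \<in> borel_measurable (lborel \<Otimes>\<^sub>M lborel)"
      by measurable
    finally show "(\<lambda>(t,x). indicator {0..} t * indicator {t. t < u x} t :: ennreal)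
        \<in> borel_measurable (lborel \<Otimes>\<^sub>M lborel)" .
  qed
  also have "\<dots> = (\<integral>\<^sup>+t. indicator {0..} t * (\<integral>\<^sup>+x. indicator {x. t < u x} x \<partial>lborel) \<partial>lborel)"
    by (subst nn_integral_cmult[symmetric]) (auto intro!: nn_integral_cong split: split_indicator)
  finally show ?thesis by simp
qed

text \<open>Normalizing both suprema to 1 makes the superlevel sets of \<open>u\<close> and
  \<open>v\<close> nonempty for the same levels, namely t < 1, as the inequality for sets requires.
  Integrating that inequality over t yields an arithmetic mean on the left, which is stronger than
  the geometric mean of Prekopa and Leindler.\<close>

lemma prekopa_leindler_normalized:
  fixes u v g :: "real \<Rightarrow> real" and k :: nat
  assumes [measurable]: "u \<in> borel_measurable borel" "v \<in> borel_measurable borel" "g \<in> borel_measurable borel"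
    and u: "\<And>x. 0 \<le> u x" "\<And>x. u x \<le> 1" "\<And>t. t < 1 \<Longrightarrow> \<exists>x. t < u x"
    and v: "\<And>x. 0 \<le> v x" "\<And>x. v x \<le> 1" "\<And>t. t < 1 \<Longrightarrow> \<exists>x. t < v x"
    and g: "\<And>x. 0 \<le> g x" "\<And>w z. \<bar>w\<bar> \<le> \<bar>z\<bar> \<Longrightarrow> g z \<le> g w"
    and le: "\<And>x y. u x * v y ^ k \<le> g ((x + real k * y) / (real k + 1)) ^ Suc k"
    and k: "k > 0"
  shows "(\<integral>\<^sup>+x. ennreal (u x) \<partial>lborel) + of_nat k * (\<integral>\<^sup>+x. ennreal (v x) \<partial>lborel)
    \<le> of_nat (Suc k) * (\<integral>\<^sup>+x. ennreal (g x) \<partial>lborel)"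
proof -
  let ?e = "emeasure lborel"
  have lev: "?e {x. t < u x} + of_nat k * ?e {x. t < v x} \<le> of_nat (Suc k) * ?e {x. t < g x}"
    if t: "0 \<le> t" for t
  proof (cases "t < 1")
    case True
    show ?thesis
    proof (rule lborel_weighted_sum_le_symmetric)
      show "{x. t < u x} \<noteq> {}" "{x. t < v x} \<noteq> {}" using u v True by auto
      show "w \<in> {x. t < g x}" if "z \<in> {x. t < g x}" "\<bar>w\<bar> \<le> \<bar>z\<bar>" for w z
        using g(2)[OF that(2)] that(1) by auto
      show "(x + real k * y) / (real k + 1) \<in> {x. t < g x}" if "x \<in> {x. t < u x}" "y \<in> {x. t < v x}" for x y
      proof -
        \<comment> \<open>Points above level t in \<open>u\<close> and \<open>v\<close> combine to a
          point above level t in \<open>g\<close>, by comparing (k + 1)-st powers.\<close>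
        have "t ^ Suc k = t * t ^ k" by simp
        also have "\<dots> < u x * v y ^ k"
          using that t k u(1) v(1) by (intro mult_strict_mono' power_strict_mono) auto
        also note le[of x y]
        finally show ?thesis using power_less_imp_less_base[of t "Suc k"] g(1) by blast
      qed
    qed (use k in measurable)
  next
    case False
    have "u x \<le> t" "v x \<le> t" for x using u(2)[of x] v(2)[of x] False by linarith+
    then have "{x. t < u x} = {}" "{x. t < v x} = {}" by (auto simp: not_less)
    then show ?thesis by simp
  qed
  have [measurable]: "(\<lambda>t. ?e {x. t < f x}) \<in> borel_measurable lborel"
    if [measurable]: "f \<in> borel_measurable borel" for f :: "real \<Rightarrow> real"
  proof -
    have "(\<lambda>t. \<integral>\<^sup>+x. indicator {p. fst p < f (snd p)} (t, x) \<partial>lborel) \<in> borel_measurable lborel"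
      by measurable
    also have "(\<lambda>t. \<integral>\<^sup>+x. indicator {p. fst p < f (snd p)} (t, x) \<partial>lborel) = (\<lambda>t. \<integral>\<^sup>+x. indicator {x. t < f x} x \<partial>lborel)"
      by (intro ext nn_integral_cong) (auto split: split_indicator)
    also have "\<dots> = (\<lambda>t. ?e {x. t < f x})"
      by (intro ext nn_integral_indicator) measurable
    finally show ?thesis .
  qed
  have "(\<integral>\<^sup>+x. ennreal (u x) \<partial>lborel) + of_nat k * (\<integral>\<^sup>+x. ennreal (v x) \<partial>lborel)
     = (\<integral>\<^sup>+t. indicator {0..} t * ?e {x. t < u x} + of_nat k * (indicator {0..} t * ?e {x. t < v x}) \<partial>lborel)"
    using u v by (simp add: nn_integral_layer_cake nn_integral_add nn_integral_cmult)
  also have "\<dots> \<le> (\<integral>\<^sup>+t. of_nat (Suc k) * (indicator {0..} t * ?e {x. t < g x}) \<partial>lborel)"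
    using lev by (intro nn_integral_mono) (auto split: split_indicator simp del: of_nat_Suc)
  also have "\<dots> = of_nat (Suc k) * (\<integral>\<^sup>+x. ennreal (g x) \<partial>lborel)"
    using g by (simp add: nn_integral_layer_cake nn_integral_cmult del: of_nat_Suc)
  finally show ?thesis .
qed

text \<open>Bernoulli's inequality at x = S / J - 1, where S is the weighted mean: then S = J (1 +
  x) and I = J (1 + (k + 1) x).\<close>

lemma weighted_am_gm_nat:
  fixes I J :: real
  assumes "I \<ge> 0" "J \<ge> 0"
  shows "I * J ^ k \<le> ((I + real k * J) / (real k + 1)) ^ Suc k"
proof (cases "J = 0")
  case True
  then show ?thesis using assms by (cases k) (auto simp: field_simps)
next
  case False
  then have J: "J > 0" using assms by simp
  define S where "S = (I + real k * J) / (real k + 1)"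
  define x where "x = S / J - 1"
  have S: "S \<ge> 0" using assms by (simp add: S_def)
  have Sx: "S = J * (1 + x)" using J by (simp add: x_def)
  have "x \<ge> -1" using S J by (simp add: x_def)
  then have b: "1 + real (Suc k) * x \<le> (1 + x) ^ Suc k" by (rule Bernoulli_inequality)
  have "I = J * (1 + real (Suc k) * x)"
  proof -
    have "J * x = S - J" using J by (simp add: x_def right_diff_distrib)
    moreover have "J * (1 + real (Suc k) * x) = J + (real k + 1) * (J * x)" by (simp add: algebra_simps)
    ultimately have "J * (1 + real (Suc k) * x) = J + (real k + 1) * (S - J)" by simp
    then have "J * (1 + real (Suc k) * x) = (real k + 1) * S - real k * J" by (simp add: algebra_simps)
    moreover have "(real k + 1) * S = I + real k * J" by (simp add: S_def)
    ultimately show ?thesis by simp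
  qed
  then have "I * J ^ k = J ^ Suc k * (1 + real (Suc k) * x)" by simp
  also have "\<dots> \<le> J ^ Suc k * (1 + x) ^ Suc k" using b J by (intro mult_left_mono) auto
  also have "\<dots> = S ^ Suc k" by (simp only: Sx power_mult_distrib)
  finally show ?thesis by (simp add: S_def)
qed


text \<open>With a and b the suprema of \<open>u\<close> and \<open>v\<close>, division of
  \<open>u\<close>, \<open>v\<close>, \<open>g\<close> by a, b and the (k + 1)-st root of a b^k
  preserves the hypothesis and reaches the normalized form. The AM-GM inequality turns the resulting
  sum into a product, in which a b^k cancels. In this form, raised to the power k + 1, the weights 1
  / (k + 1) and k / (k + 1) appear without real exponents.\<close>

lemma prekopa_leindler_nat:
  fixes u v :: "real \<Rightarrow> ennreal" and g :: "real \<Rightarrow> real" and k :: nat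
  assumes [measurable]: "u \<in> borel_measurable borel" "v \<in> borel_measurable borel" "g \<in> borel_measurable borel"
    and g: "\<And>x. 0 \<le> g x" "\<And>x. g x \<le> 1" "\<And>w z. \<bar>w\<bar> \<le> \<bar>z\<bar> \<Longrightarrow> g z \<le> g w"
    and g_int: "(\<integral>\<^sup>+x. ennreal (g x) \<partial>lborel) \<le> 1"
    and le: "\<And>x y. u x * v y ^ k \<le> ennreal (g ((x + real k * y) / (real k + 1))) ^ Suc k"
    and k: "k > 0"
  shows "(\<integral>\<^sup>+x. u x \<partial>lborel) * (\<integral>\<^sup>+x. v x \<partial>lborel) ^ k \<le> 1"
proof (cases "(\<forall>x. u x = 0) \<or> (\<forall>x. v x = 0)")
  case True
  then have "(\<integral>\<^sup>+x. u x \<partial>lborel) = 0 \<or> (\<integral>\<^sup>+x. v x \<partial>lborel) = 0" by auto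
  then show ?thesis using k by (auto simp: power_0_left)
next
  case False
  \<comment> \<open>Since u x * v y ^ k never exceeds 1, one nonzero value of each function bounds
    the other; this excludes the value infinity and makes the suprema finite.\<close>
  then obtain x0 y0 where x0: "u x0 \<noteq> 0" and y0: "v y0 \<noteq> 0" by auto
  have le1: "u x * v y ^ k \<le> 1" for x y
    using le[of x y] by (rule order_trans) (use g in \<open>simp add: power_le_one flip: ennreal_power del: power_Suc\<close>)
  have u_fin: "u x < \<top>" for x
  proof (rule ccontr)
    assume "\<not> u x < \<top>"
    then have "u x * v y0 ^ k = \<top>" using y0 by (simp add: less_top[symmetric] ennreal_top_mult)
    with le1[of x y0] show False by (simp add: top_unique)
  qed
  have v_fin: "v y < \<top>" for y
  proof (rule ccontr)
    assume "\<not> v y < \<top>"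
    then have "u x0 * v y ^ k = \<top>" using x0 k by (simp add: less_top[symmetric] ennreal_mult_top power_eq_top_ennreal)
    with le1[of x0 y] show False by (simp add: top_unique)
  qed
  define u' where "u' x = enn2real (u x)" for x
  define v' where "v' x = enn2real (v x)" for x
  have [measurable]: "u' \<in> borel_measurable borel" "v' \<in> borel_measurable borel"
    unfolding u'_def v'_def by measurable
  have u': "u x = ennreal (u' x)" "u' x \<ge> 0" for x using u_fin[of x] by (auto simp: u'_def)
  have v': "v x = ennreal (v' x)" "v' x \<ge> 0" for x using v_fin[of x] by (auto simp: v'_def)
  have le': "u' x * v' y ^ k \<le> g ((x + real k * y) / (real k + 1)) ^ Suc k" for x y
    using le[of x y] g(1) u'(2) v'(2)
    by (simp add: u'(1) v'(1) ennreal_power ennreal_mult[symmetric] ennreal_le_iff del: power_Suc)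
  have le1': "u' x * v' y ^ k \<le> 1" for x y
    using le'[of x y] g power_le_one[OF g(1,2)] by (meson order_trans)
  have u'0: "u' x0 > 0" using x0 u'[of x0] by (cases "u' x0 = 0") auto
  have v'0: "v' y0 > 0" using y0 v'[of y0] by (cases "v' y0 = 0") auto
  have bu: "bdd_above (range u')"
    using le1'[of _ y0] v'0 by (intro bdd_aboveI[of _ "1 / v' y0 ^ k"]) (auto simp: pos_le_divide_eq)
  \<comment> \<open>Only the k-th power of \<open>v'\<close> is bounded directly, but it dominates
    \<open>v'\<close> wherever \<open>v'\<close> exceeds 1.\<close>
  have bv: "bdd_above (range v')"
  proof (intro bdd_aboveI[of _ "max 1 (1 / u' x0)"])
    fix y assume "y \<in> range v'"
    then obtain t where y: "y = v' t" by auto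
    show "y \<le> max 1 (1 / u' x0)"
    proof (cases "v' t \<le> 1")
      case False
      then have "v' t \<le> v' t ^ k" using k by (intro self_le_power) auto
      also have "\<dots> \<le> 1 / u' x0" using le1'[of x0 t] u'0 by (simp add: pos_le_divide_eq mult.commute)
      finally show ?thesis by (simp add: y)
    qed (simp add: y)
  qed
  define a where "a = Sup (range u')"
  define b where "b = Sup (range v')"
  have a: "u' x \<le> a" "a > 0" for x
    using bu u'0 cSup_upper[of _ "range u'"] by (auto simp: a_def intro: less_le_trans)
  have b: "v' x \<le> b" "b > 0" for x
    using bv v'0 cSup_upper[of _ "range v'"] by (auto simp: b_def intro: less_le_trans)
  define \<tau> where "\<tau> = root (Suc k) (a * b ^ k)"
  have \<tau>: "\<tau> > 0" "\<tau> ^ Suc k = a * b ^ k"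
    using a(2) b(2) by (auto simp: \<tau>_def real_root_gt_zero simp del: power_Suc)
  have "(\<integral>\<^sup>+x. ennreal (u' x / a) \<partial>lborel) + of_nat k * (\<integral>\<^sup>+x. ennreal (v' x / b) \<partial>lborel)
    \<le> of_nat (Suc k) * (\<integral>\<^sup>+x. ennreal (g x / \<tau>) \<partial>lborel)"
  proof (rule prekopa_leindler_normalized)
    fix t :: real assume t: "t < 1"
    have "t * a < a" using t a(2) by simp
    then obtain y where "y \<in> range u'" "t * a < y"
      unfolding a_def using less_cSup_iff[OF _ bu] by (metis UNIV_not_empty image_is_empty)
    then show "\<exists>x. t < u' x / a" using a(2) by (auto simp: pos_less_divide_eq)
    have "t * b < b" using t b(2) by simp
    then obtain y where "y \<in> range v'" "t * b < y"
      unfolding b_def using less_cSup_iff[OF _ bv] by (metis UNIV_not_empty image_is_empty)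
    then show "\<exists>x. t < v' x / b" using b(2) by (auto simp: pos_less_divide_eq)
  next
    show "u' x / a * (v' y / b) ^ k \<le> (g ((x + real k * y) / (real k + 1)) / \<tau>) ^ Suc k" for x y
    proof -
      have "u' x / a * (v' y / b) ^ k = (u' x * v' y ^ k) / \<tau> ^ Suc k"
        by (simp only: \<tau>(2)) (simp add: power_divide)
      also have "\<dots> \<le> g ((x + real k * y) / (real k + 1)) ^ Suc k / \<tau> ^ Suc k"
        using \<tau>(1) le' by (intro divide_right_mono) auto
      finally show ?thesis by (simp only: power_divide)
    qed
  qed (use a b g \<tau> u' v' k in \<open>auto simp: divide_le_eq divide_right_mono\<close>)
  also have "(\<integral>\<^sup>+x. ennreal (g x / \<tau>) \<partial>lborel) = (\<integral>\<^sup>+x. ennreal (g x) \<partial>lborel) * ennreal (1 / \<tau>)"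
    using g \<tau>(1) by (subst nn_integral_multc[symmetric]) (auto simp: ennreal_mult'[symmetric])
  also have "of_nat (Suc k) * \<dots> \<le> of_nat (Suc k) * (1 * ennreal (1 / \<tau>))"
    using g_int by (intro mult_left_mono mult_right_mono) auto
  also have "of_nat (Suc k) * (1 * ennreal (1 / \<tau>)) = ennreal ((real k + 1) / \<tau>)"
  proof -
    have "of_nat (Suc k) * (1 * ennreal (1 / \<tau>)) = ennreal (real (Suc k)) * ennreal (1 / \<tau>)"
      by (simp only: ennreal_of_nat_eq_real_of_nat mult_1)
    also have "\<dots> = ennreal (real (Suc k) * (1 / \<tau>))" by (rule ennreal_mult''[symmetric]) (use \<tau> in simp)
    also have "real (Suc k) * (1 / \<tau>) = (real k + 1) / \<tau>" by simp
    finally show ?thesis .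
  qed
  finally have main: "(\<integral>\<^sup>+x. ennreal (u' x / a) \<partial>lborel) + of_nat k * (\<integral>\<^sup>+x. ennreal (v' x / b) \<partial>lborel)
    \<le> ennreal ((real k + 1) / \<tau>)" .
  let ?I = "\<integral>\<^sup>+x. ennreal (u' x / a) \<partial>lborel" and ?J = "\<integral>\<^sup>+x. ennreal (v' x / b) \<partial>lborel"
  have "?I + of_nat k * ?J < \<top>" using main ennreal_less_top by (rule le_less_trans)
  then have "?I < \<top>" "?J < \<top>"
    using k by (auto simp: ennreal_mult_less_top)
  then obtain I J where IJ: "?I = ennreal I" "?J = ennreal J" "I \<ge> 0" "J \<ge> 0"
    by (auto simp: less_top_ennreal)
  have "I + real k * J \<le> (real k + 1) / \<tau>"
  proof -
    have "ennreal (I + real k * J) = ennreal I + of_nat k * ennreal J"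
      using IJ by (simp add: ennreal_of_nat_eq_real_of_nat ennreal_mult ennreal_plus)
    also have "\<dots> \<le> ennreal ((real k + 1) / \<tau>)" using main IJ by simp
    finally show ?thesis using \<tau> by (simp add: ennreal_le_iff)
  qed
  then have "(I + real k * J) / (real k + 1) \<le> 1 / \<tau>" by (simp add: divide_le_eq mult.commute)
  then have "((I + real k * J) / (real k + 1)) ^ Suc k \<le> (1 / \<tau>) ^ Suc k"
    using IJ by (intro power_mono) auto
  with weighted_am_gm_nat[OF IJ(3,4), of k] have "I * J ^ k \<le> 1 / (a * b ^ k)"
    by (simp only: power_divide \<tau>(2) power_one)
  then have fin: "(a * I) * (b * J) ^ k \<le> 1"
    using a(2) b(2) by (simp add: power_mult_distrib field_simps)
  have "(\<integral>\<^sup>+x. u x \<partial>lborel) = ennreal a * ?I"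
    using a(2) u' by (subst nn_integral_cmult[symmetric]) (auto simp: ennreal_mult'[symmetric] intro!: nn_integral_cong)
  moreover have "(\<integral>\<^sup>+x. v x \<partial>lborel) = ennreal b * ?J"
    using b(2) v' by (subst nn_integral_cmult[symmetric]) (auto simp: ennreal_mult'[symmetric] intro!: nn_integral_cong)
  ultimately have "(\<integral>\<^sup>+x. u x \<partial>lborel) * (\<integral>\<^sup>+x. v x \<partial>lborel) ^ k = ennreal ((a * I) * (b * J) ^ k)"
    using a(2) b(2) IJ by (simp add: ennreal_mult ennreal_power[symmetric])
  then show ?thesis using fin by simp
qed

text \<open>The cost is the convexity defect of x^2 / 2: for z = (x + k y) / (k + 1) the Gaussian
  density satisfies phi(x) phi(y)^k exp (k (x - y)^2 / (2 (k + 1))) = phi(z)^(k + 1). So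
  Prekopa-Leindler applies to phi u, phi v and phi.\<close>

lemma std_normal_transport_nat:
  fixes u v :: "real \<Rightarrow> ennreal" and k :: nat
  assumes [measurable]: "u \<in> borel_measurable borel" "v \<in> borel_measurable borel"
    and le: "\<And>x y. u x * v y ^ k \<le> ennreal (exp (real k / (2 * (real k + 1)) * (x - y)\<^sup>2))"
    and k: "k > 0"
  shows "(\<integral>\<^sup>+x. u x \<partial>std_normal_distribution) * (\<integral>\<^sup>+x. v x \<partial>std_normal_distribution) ^ k \<le> 1"
proof -
  let ?\<phi> = std_normal_density
  have "(\<integral>\<^sup>+x. ennreal (?\<phi> x) * u x \<partial>lborel) * (\<integral>\<^sup>+x. ennreal (?\<phi> x) * v x \<partial>lborel) ^ k \<le> 1"
  proof (rule prekopa_leindler_nat)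
    show "?\<phi> x \<le> 1" for x :: real
    proof -
      have "1 \<le> sqrt (2 * pi)" using pi_ge_two by (simp add: real_le_rsqrt)
      then have "1 / sqrt (2 * pi) \<le> 1" by simp
      then have "1 / sqrt (2 * pi) * exp (- x\<^sup>2 / 2) \<le> 1 * 1" by (intro mult_mono) auto
      then show ?thesis by (simp add: std_normal_density_def)
    qed
    show "?\<phi> z \<le> ?\<phi> w" if "\<bar>w\<bar> \<le> \<bar>z\<bar>" for w z :: real
      using that by (simp add: std_normal_density_def abs_le_square_iff divide_right_mono)
    show "(\<integral>\<^sup>+ x. ennreal (?\<phi> x) \<partial>lborel) \<le> 1"
      using prob_space.emeasure_space_1[OF prob_space_normal_density[of 1 0]]
      by (simp add: emeasure_density)
    show "ennreal (?\<phi> x) * u x * (ennreal (?\<phi> y) * v y) ^ k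
        \<le> ennreal (?\<phi> ((x + real k * y) / (real k + 1))) ^ Suc k" for x y
    proof -
      let ?z = "(x + real k * y) / (real k + 1)"
      have sq: "- x\<^sup>2 / 2 + real k * (- y\<^sup>2 / 2) + real k / (2 * (real k + 1)) * (x - y)\<^sup>2 = (real k + 1) * (- ?z\<^sup>2 / 2)"
      proof -
        have "(real k + 1) * ?z\<^sup>2 = (x + real k * y)\<^sup>2 / (real k + 1)"
          by (simp add: power_divide power2_eq_square)
        then have "(real k + 1) * (- ?z\<^sup>2 / 2) = - ((x + real k * y)\<^sup>2 / (real k + 1)) / 2" by simp
        moreover have "(- x\<^sup>2 / 2 + real k * (- y\<^sup>2 / 2) + real k / (2 * (real k + 1)) * (x - y)\<^sup>2) * (2 * (real k + 1))
           = - ((x + real k * y)\<^sup>2)"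
          by (simp add: distrib_right) (simp add: power2_eq_square algebra_simps)
        moreover have "- (T / K) / 2 * (2 * K) = - T" if "K \<noteq> 0" for T K :: real
          using that by simp
        then have "- ((x + real k * y)\<^sup>2 / (real k + 1)) / 2 * (2 * (real k + 1)) = - ((x + real k * y)\<^sup>2)"
          by (metis add.commute of_nat_Suc of_nat_eq_0_iff nat.distinct(1))
        ultimately have "(- x\<^sup>2 / 2 + real k * (- y\<^sup>2 / 2) + real k / (2 * (real k + 1)) * (x - y)\<^sup>2) * (2 * (real k + 1))
           = (real k + 1) * (- ?z\<^sup>2 / 2) * (2 * (real k + 1))"
          by (simp only: \<open>(real k + 1) * (- ?z\<^sup>2 / 2) = _\<close>)
        then show ?thesis
          by (rule mult_right_cancel[THEN iffD1, rotated]) simp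
      qed
      have "ennreal (?\<phi> x) * u x * (ennreal (?\<phi> y) * v y) ^ k = ennreal (?\<phi> x * ?\<phi> y ^ k) * (u x * v y ^ k)"
        by (simp add: power_mult_distrib ennreal_mult ennreal_power mult_ac)
      also have "\<dots> \<le> ennreal (?\<phi> x * ?\<phi> y ^ k) * ennreal (exp (real k / (2 * (real k + 1)) * (x - y)\<^sup>2))"
        using le by (intro mult_left_mono) auto
      also have "\<dots> = ennreal (?\<phi> x * ?\<phi> y ^ k * exp (real k / (2 * (real k + 1)) * (x - y)\<^sup>2))"
        by (simp add: ennreal_mult)
      also have "?\<phi> x * ?\<phi> y ^ k * exp (real k / (2 * (real k + 1)) * (x - y)\<^sup>2)
         = (1 / sqrt (2 * pi)) ^ Suc k *
           exp (- x\<^sup>2 / 2 + real k * (- y\<^sup>2 / 2) + real k / (2 * (real k + 1)) * (x - y)\<^sup>2)"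
        by (simp only: std_normal_density_def exp_add exp_of_nat_mult power_mult_distrib power_Suc mult_ac)
      also have "\<dots> = (1 / sqrt (2 * pi)) ^ Suc k * exp (- ?z\<^sup>2 / 2) ^ Suc k"
        unfolding sq by (simp only: exp_of_nat_mult[symmetric] of_nat_Suc add.commute[of 1])
      also have "\<dots> = ?\<phi> ?z ^ Suc k"
        by (simp only: std_normal_density_def power_mult_distrib)
      finally show ?thesis by (simp add: ennreal_power del: power_Suc)
    qed
  qed (use k in auto)
  then show ?thesis by (simp add: nn_integral_density)
qed


section \<open>Tensorization over Gaussian product measures\<close>

abbreviation gaussian_product :: "'k set \<Rightarrow> ('k \<Rightarrow> real) measure" where
  "gaussian_product I \<equiv> Pi\<^sub>M I (\<lambda>_. std_normal_distribution)"

lemma prob_space_gaussian_product: "prob_space (gaussian_product I)"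
  by (intro prob_space_PiM prob_space_normal_density) simp

lemma product_sigma_finite_gaussian: "product_sigma_finite (\<lambda>_. std_normal_distribution)"
  by (intro product_sigma_finite.intro prob_space_imp_sigma_finite prob_space_normal_density) simp

text \<open>The cost is a sum over coordinates. For fixed values y, y' of the new coordinate, the
  induction hypothesis with the factor exp (- \<kappa> (y - y')^2) moved into \<open>u\<close> says
  exactly that the partial integrals \<open>U\<close> and \<open>V\<close> satisfy the
  one-dimensional hypothesis.\<close>

lemma gaussian_product_transport_nat:
  fixes u v :: "('k \<Rightarrow> real) \<Rightarrow> ennreal" and k :: nat
  assumes "finite I"
    and "u \<in> borel_measurable (gaussian_product I)" "v \<in> borel_measurable (gaussian_product I)"
    and "\<And>x y. x \<in> space (gaussian_product I) \<Longrightarrow> y \<in> space (gaussian_product I) \<Longrightarrow>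
           u x * v y ^ k \<le> ennreal (exp (real k / (2 * (real k + 1)) * (\<Sum>i\<in>I. (x i - y i)\<^sup>2)))"
    and k: "k > 0"
  shows "(\<integral>\<^sup>+x. u x \<partial>gaussian_product I) * (\<integral>\<^sup>+x. v x \<partial>gaussian_product I) ^ k \<le> 1"
  using assms(1-4)
proof (induction I arbitrary: u v rule: finite_induct)
  case empty
  \<comment> \<open>The empty product is a point mass at the function that is
    \<open>undefined\<close> everywhere, and the cost there is 0.\<close>
  then show ?case
    using empty(3)[of "\<lambda>_. undefined" "\<lambda>_. undefined"]
    by (simp add: PiM_empty nn_integral_count_space_finite)
next
  case (insert i I)
  interpret product_sigma_finite "\<lambda>_::'k. std_normal_distribution" by (rule product_sigma_finite_gaussian)
  define \<kappa> where "\<kappa> = real k / (2 * (real k + 1))"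
  note [measurable] = insert.prems(1,2)
  note le = insert.prems(3)[folded \<kappa>_def]
  define U where "U y = (\<integral>\<^sup>+x. u (x(i := y)) \<partial>gaussian_product I)" for y
  define V where "V y = (\<integral>\<^sup>+x. v (x(i := y)) \<partial>gaussian_product I)" for y
  have upd: "(\<lambda>x. f (x(i := y))) \<in> borel_measurable (gaussian_product I)"
    if [measurable]: "f \<in> borel_measurable (gaussian_product (insert i I))" for f :: "_ \<Rightarrow> ennreal" and y
    by measurable
  have sec: "U y * V y' ^ k \<le> ennreal (exp (\<kappa> * (y - y')\<^sup>2))" for y y'
  proof -
    have "(\<integral>\<^sup>+x. u (x(i := y)) * ennreal (exp (- (\<kappa> * (y - y')\<^sup>2))) \<partial>gaussian_product I)
       * (\<integral>\<^sup>+x. v (x(i := y')) \<partial>gaussian_product I) ^ k \<le> 1"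
    proof (rule insert.IH)
      fix x x' assume x: "x \<in> space (gaussian_product I)" "x' \<in> space (gaussian_product I)"
      have "x(i := y) \<in> space (gaussian_product (insert i I))" "x'(i := y') \<in> space (gaussian_product (insert i I))"
        using x by (auto simp: space_PiM PiE_iff extensional_def)
      then have "u (x(i := y)) * v (x'(i := y')) ^ k
          \<le> ennreal (exp (\<kappa> * (\<Sum>j\<in>insert i I. ((x(i := y)) j - (x'(i := y')) j)\<^sup>2)))"
        by (rule le)
      also have "(\<Sum>j\<in>insert i I. ((x(i := y)) j - (x'(i := y')) j)\<^sup>2) = (y - y')\<^sup>2 + (\<Sum>j\<in>I. (x j - x' j)\<^sup>2)"
        using insert.hyps by (auto intro!: sum.cong)
      finally have "u (x(i := y)) * v (x'(i := y')) ^ k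
          \<le> ennreal (exp (\<kappa> * ((y - y')\<^sup>2 + (\<Sum>j\<in>I. (x j - x' j)\<^sup>2))))" .
      then have "u (x(i := y)) * v (x'(i := y')) ^ k * ennreal (exp (- (\<kappa> * (y - y')\<^sup>2)))
          \<le> ennreal (exp (\<kappa> * ((y - y')\<^sup>2 + (\<Sum>j\<in>I. (x j - x' j)\<^sup>2)))) * ennreal (exp (- (\<kappa> * (y - y')\<^sup>2)))"
        by (rule mult_right_mono) simp
      also have "\<dots> = ennreal (exp (\<kappa> * (\<Sum>j\<in>I. (x j - x' j)\<^sup>2)))"
        by (simp add: ennreal_mult[symmetric] mult_exp_exp algebra_simps)
      finally show "u (x(i := y)) * ennreal (exp (- (\<kappa> * (y - y')\<^sup>2))) * v (x'(i := y')) ^ k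
         \<le> ennreal (exp (real k / (2 * (real k + 1)) * (\<Sum>j\<in>I. (x j - x' j)\<^sup>2)))"
        by (simp add: \<kappa>_def mult_ac)
    qed (rule borel_measurable_times_ennreal upd insert.prems(1,2) borel_measurable_const)+
    then have "U y * ennreal (exp (- (\<kappa> * (y - y')\<^sup>2))) * V y' ^ k \<le> 1"
      by (simp add: U_def V_def nn_integral_multc upd)
    then have "ennreal (exp (\<kappa> * (y - y')\<^sup>2)) * (U y * ennreal (exp (- (\<kappa> * (y - y')\<^sup>2))) * V y' ^ k)
       \<le> ennreal (exp (\<kappa> * (y - y')\<^sup>2)) * 1"
      by (intro mult_left_mono) auto
    also have "ennreal (exp (\<kappa> * (y - y')\<^sup>2)) * (U y * ennreal (exp (- (\<kappa> * (y - y')\<^sup>2))) * V y' ^ k)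
       = U y * V y' ^ k * (ennreal (exp (\<kappa> * (y - y')\<^sup>2)) * ennreal (exp (- (\<kappa> * (y - y')\<^sup>2))))"
      by (simp add: mult_ac)
    also have "ennreal (exp (\<kappa> * (y - y')\<^sup>2)) * ennreal (exp (- (\<kappa> * (y - y')\<^sup>2))) = 1"
      by (simp add: ennreal_mult[symmetric] mult_exp_exp)
    finally show ?thesis by simp
  qed
  have "(\<integral>\<^sup>+y. U y \<partial>std_normal_distribution) * (\<integral>\<^sup>+y. V y \<partial>std_normal_distribution) ^ k \<le> 1"
  proof (rule std_normal_transport_nat)
    interpret gI: prob_space "gaussian_product I" by (rule prob_space_gaussian_product)
    have "(\<lambda>y. \<integral>\<^sup>+x. f (x(i := y)) \<partial>gaussian_product I) \<in> borel_measurable std_normal_distribution"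
      if [measurable]: "f \<in> borel_measurable (gaussian_product (insert i I))" for f :: "_ \<Rightarrow> ennreal"
      by measurable
    from this[of u] this[of v] show "U \<in> borel_measurable borel" "V \<in> borel_measurable borel"
      by (auto simp: U_def[abs_def] V_def[abs_def])
  qed (use sec k in \<open>auto simp: \<kappa>_def\<close>)
  then show ?case
    using insert.hyps by (simp add: product_nn_integral_insert_rev U_def V_def)
qed


section \<open>Concentration of Lipschitz functions\<close>

text \<open>The exponential lies above its tangent at the mean. A nonnegative integral appears on
  the right because integrability of exp f is not at hand; the tangent is cut at 0 to be comparable
  with it.\<close>

lemma (in prob_space) jensen_exp_nn_integral:
  assumes "integrable M f"
  shows "ennreal (exp (expectation f)) \<le> (\<integral>\<^sup>+x. ennreal (exp (f x)) \<partial>M)"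
proof -
  define c where "c = expectation f"
  define h where "h x = exp c * (1 + (f x - c))" for x
  have h: "integrable M h" "expectation h = exp c"
    using assms unfolding h_def[abs_def] by (auto simp: c_def prob_space)
  have "exp c \<le> expectation (\<lambda>x. max 0 (h x))"
    unfolding h(2)[symmetric] using h(1) by (intro integral_mono) auto
  then have "ennreal (exp c) \<le> ennreal (expectation (\<lambda>x. max 0 (h x)))" by (rule ennreal_leI)
  also have "\<dots> = (\<integral>\<^sup>+x. ennreal (max 0 (h x)) \<partial>M)"
    using h(1) by (intro nn_integral_eq_integral[symmetric]) auto
  also have "\<dots> \<le> (\<integral>\<^sup>+x. ennreal (exp (f x)) \<partial>M)"
  proof (intro nn_integral_mono ennreal_leI)
    fix x
    have "h x \<le> exp c * exp (f x - c)"
      unfolding h_def by (intro mult_left_mono exp_ge_add_one_self) auto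
    then show "max 0 (h x) \<le> exp (f x)" by (simp add: mult_exp_exp)
  qed
  finally show ?thesis by (simp add: c_def)
qed

text \<open>A Chernoff bound with parameter t. Markov's inequality bounds the integral of u = exp (t
  f - c) below by the probability sought, Jensen's inequality bounds that of v = exp (- t f / k)
  below by the mean of f, and the transport inequality bounds the product above by 1. The exponent c
  - t^2 tends to - t^2 / 2.\<close>

lemma gaussian_concentration:
  fixes f :: "('k \<Rightarrow> real) \<Rightarrow> real"
  assumes I: "finite I" and f: "integrable (gaussian_product I) f"
    and lip: "\<And>x y. x \<in> space (gaussian_product I) \<Longrightarrow> y \<in> space (gaussian_product I) \<Longrightarrow>
                f x - f y \<le> sqrt (\<Sum>i\<in>I. (x i - y i)\<^sup>2)"
    and t: "t > 0"
  shows "measure (gaussian_product I) {x \<in> space (gaussian_product I). integral\<^sup>L (gaussian_product I) f + t \<le> f x}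
    \<le> exp (- (t\<^sup>2 / 2))" (is "measure ?G ?A \<le> _")
proof -
  interpret prob_space ?G by (rule prob_space_gaussian_product)
  have [measurable]: "f \<in> borel_measurable ?G" using f by auto
  define m where "m = expectation f"
  have bound: "prob ?A \<le> exp (t\<^sup>2 * (real k + 1) / (2 * real k) - t\<^sup>2)" if k: "k > 0" for k :: nat
  proof -
    \<comment> \<open>The maximum over d of t d - k d^2 / (2 (k + 1)), attained at d = t (k + 1) /
      k. With it the Lipschitz bound f x - f y <= d implies the transport hypothesis, by completing
      the square.\<close>
    define c where "c = t\<^sup>2 * (real k + 1) / (2 * real k)"
    define u where "u x = ennreal (exp (t * f x - c))" for x
    define v where "v x = ennreal (exp (- t * f x / real k))" for x
    have [measurable]: "u \<in> borel_measurable ?G" "v \<in> borel_measurable ?G"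
      unfolding u_def v_def by measurable
    have 1: "(\<integral>\<^sup>+x. u x \<partial>?G) * (\<integral>\<^sup>+x. v x \<partial>?G) ^ k \<le> 1"
    proof (rule gaussian_product_transport_nat[OF I _ _ _ k])
      fix x y assume xy: "x \<in> space ?G" "y \<in> space ?G"
      define d where "d = sqrt (\<Sum>i\<in>I. (x i - y i)\<^sup>2)"
      have d: "f x - f y \<le> d" "d\<^sup>2 = (\<Sum>i\<in>I. (x i - y i)\<^sup>2)"
        using lip[OF xy] by (auto simp: d_def sum_nonneg)
      have "u x * v y ^ k = ennreal (exp (t * f x - c) * exp (- t * f y / real k) ^ k)"
        by (simp add: u_def v_def ennreal_mult ennreal_power)
      also have "exp (t * f x - c) * exp (- t * f y / real k) ^ k = exp (t * (f x - f y) - c)"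
        using k by (simp add: exp_of_nat_mult[symmetric] mult_exp_exp algebra_simps)
      finally have eq: "u x * v y ^ k = ennreal (exp (t * (f x - f y) - c))" .
      have "exp (t * (f x - f y) - c) \<le> exp (real k / (2 * (real k + 1)) * d\<^sup>2)"
      proof -
        have "t * (f x - f y) \<le> t * d" using d t by (intro mult_left_mono) auto
        moreover have "0 \<le> (t * (real k + 1) - real k * d)\<^sup>2 / (2 * real k * (real k + 1))"
          by (intro divide_nonneg_nonneg) auto
        moreover have "(t * (real k + 1) - real k * d)\<^sup>2 / (2 * real k * (real k + 1))
           = c - t * d + real k / (2 * (real k + 1)) * d\<^sup>2"
        proof -
          have *: "(t * K - r * d)\<^sup>2 / (2 * r * K) = t\<^sup>2 * K / (2 * r) - t * d + r / (2 * K) * d\<^sup>2"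
            if "K \<noteq> 0" "r \<noteq> 0" for K r :: real
            using that by (simp add: power2_eq_square field_simps)
          show ?thesis unfolding c_def by (rule *) (use k in auto)
        qed
        ultimately show ?thesis by simp
      qed
      then show "u x * v y ^ k \<le> ennreal (exp (real k / (2 * (real k + 1)) * (\<Sum>i\<in>I. (x i - y i)\<^sup>2)))"
        unfolding eq d(2) by (rule ennreal_leI)
    qed auto
    \<comment> \<open>Jensen's inequality; the k-th power undoes the division by k.\<close>
    have "ennreal (exp (- t * m / real k)) \<le> (\<integral>\<^sup>+x. v x \<partial>?G)"
      using jensen_exp_nn_integral[of "\<lambda>x. - t * f x / real k"] f by (simp add: v_def m_def)
    then have "ennreal (exp (- t * m / real k)) ^ k \<le> (\<integral>\<^sup>+x. v x \<partial>?G) ^ k"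
      by (intro power_mono) auto
    also have "ennreal (exp (- t * m / real k)) ^ k = ennreal (exp (- t * m))"
      using k by (simp add: ennreal_power exp_of_nat_mult[symmetric])
    finally have 2: "ennreal (exp (- t * m)) \<le> (\<integral>\<^sup>+x. v x \<partial>?G) ^ k" .
    \<comment> \<open>Markov's inequality: on the event, \<open>u\<close> is at least exp (t (m + t)
      - c).\<close>
    have "ennreal (exp (t * (m + t) - c)) * emeasure ?G ?A = (\<integral>\<^sup>+x. ennreal (exp (t * (m + t) - c)) * indicator ?A x \<partial>?G)"
      by (simp add: nn_integral_cmult_indicator m_def)
    also have "\<dots> \<le> (\<integral>\<^sup>+x. u x \<partial>?G)"
      using t by (intro nn_integral_mono) (auto simp: u_def m_def split: split_indicator intro!: ennreal_leI)
    finally have 3: "ennreal (exp (t * (m + t) - c)) * emeasure ?G ?A \<le> (\<integral>\<^sup>+x. u x \<partial>?G)" .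
    have "ennreal (exp (t * (m + t) - c) * prob ?A * exp (- t * m))
      = ennreal (exp (t * (m + t) - c)) * emeasure ?G ?A * ennreal (exp (- t * m))"
      by (simp add: emeasure_eq_measure ennreal_mult)
    also have "\<dots> \<le> (\<integral>\<^sup>+x. u x \<partial>?G) * (\<integral>\<^sup>+x. v x \<partial>?G) ^ k"
      by (intro mult_mono 2 3) auto
    finally have "exp (t * (m + t) - c) * prob ?A * exp (- t * m) \<le> 1"
      using order_trans[OF _ 1] ennreal_le_1 by blast
    moreover have "exp (t * (m + t) - c) * prob ?A * exp (- t * m) = prob ?A * exp (t\<^sup>2 - c)"
    proof -
      have "exp (t * (m + t) - c) * exp (- t * m) = exp (t\<^sup>2 - c)"
        by (simp add: mult_exp_exp power2_eq_square algebra_simps)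
      moreover have "a * p * b = p * (a * b)" for a p b :: real by simp
      ultimately show ?thesis by metis
    qed
    ultimately have "prob ?A * exp (t\<^sup>2 - c) \<le> 1" by linarith
    then have "prob ?A \<le> 1 / exp (t\<^sup>2 - c)" by (simp add: pos_le_divide_eq)
    also have "\<dots> = exp (c - t\<^sup>2)" by (simp add: exp_diff)
    finally show ?thesis by (simp add: c_def)
  qed
  have "(\<lambda>k. exp (t\<^sup>2 * (real k + 1) / (2 * real k) - t\<^sup>2)) \<longlonglongrightarrow> exp (t\<^sup>2 * (1/2) - t\<^sup>2)"
  proof -
    have "(\<lambda>k. (real k + 1) / (2 * real k)) \<longlonglongrightarrow> 1/2" by real_asymp
    then have "(\<lambda>k. exp (t\<^sup>2 * ((real k + 1) / (2 * real k)) - t\<^sup>2)) \<longlonglongrightarrow> exp (t\<^sup>2 * (1/2) - t\<^sup>2)"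
      by (intro tendsto_exp tendsto_diff tendsto_mult tendsto_const)
    then show ?thesis by simp
  qed
  then have "prob ?A \<le> exp (t\<^sup>2 * (1/2) - t\<^sup>2)"
    by (rule LIMSEQ_le_const) (use bound in \<open>auto intro!: exI[of _ 1]\<close>)
  then show ?thesis by (simp add: algebra_simps)
qed

section \<open>Comparison of Gaussian processes\<close>

lemma integrable_gaussian_component:
  assumes "finite I" "i \<in> I"
  shows "integrable (gaussian_product I) (\<lambda>x. x i)" "integrable (gaussian_product I) (\<lambda>x. (x i)\<^sup>2)"
    "integrable (gaussian_product I) (\<lambda>x. (x i) ^ k)"
    "(\<integral>x. (x i)\<^sup>2 \<partial>gaussian_product I) = 1" "(\<integral>x. (x i) ^ 4 \<partial>gaussian_product I) = 3"
proof -
  have d: "distr (gaussian_product I) std_normal_distribution (\<lambda>x. x i) = std_normal_distribution"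
    using assms by (intro distr_PiM_component prob_space_normal_density) auto
  have int: "integrable (gaussian_product I) (\<lambda>x. f (x i)) \<longleftrightarrow> integrable std_normal_distribution f"
    if [measurable]: "f \<in> borel_measurable borel" for f :: "real \<Rightarrow> real"
    using assms by (subst d[symmetric], subst integrable_distr_eq) auto
  have eq: "(\<integral>x. f (x i) \<partial>gaussian_product I) = (\<integral>x. f x \<partial>std_normal_distribution)"
    if [measurable]: "f \<in> borel_measurable borel" for f :: "real \<Rightarrow> real"
    using assms by (subst d[symmetric], subst integral_distr) auto
  have pow: "integrable (gaussian_product I) (\<lambda>x. (x i) ^ j)" for j
    using integrable_std_normal_distribution_moment[of j] by (subst int) auto
  then show "integrable (gaussian_product I) (\<lambda>x. (x i) ^ k)" .
  show "integrable (gaussian_product I) (\<lambda>x. x i)" "integrable (gaussian_product I) (\<lambda>x. (x i)\<^sup>2)"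
    using pow[of 1] pow[of 2] by auto
  show "(\<integral>x. (x i)\<^sup>2 \<partial>gaussian_product I) = 1"
    using std_normal_distribution_even_moments(1)[of 1] by (subst eq) auto
  show "(\<integral>x. (x i) ^ 4 \<partial>gaussian_product I) = 3"
    using std_normal_distribution_even_moments(1)[of 2] by (subst eq) (auto simp: fact_numeral)
qed

text \<open>The difference of the two integrands, multiplied by the density phi, is the derivative
  of phi f, and phi f tends to 0 at both ends because f is bounded.\<close>

lemma std_normal_integration_by_parts:
  fixes f f' :: "real \<Rightarrow> real"
  assumes deriv: "\<And>x. (f has_real_derivative f' x) (at x)"
    and cont: "continuous_on UNIV f'"
    and bd: "\<And>x. \<bar>f x\<bar> \<le> B" "\<And>x. \<bar>f' x\<bar> \<le> B'"
  shows "(\<integral>x. x * f x \<partial>std_normal_distribution) = (\<integral>x. f' x \<partial>std_normal_distribution)"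
proof -
  let ?\<phi> = std_normal_density
  interpret N: prob_space std_normal_distribution by (rule prob_space_normal_density) simp
  have contf: "continuous_on UNIV f"
    using deriv by (meson DERIV_continuous continuous_at_imp_continuous_on)
  have [measurable]: "f \<in> borel_measurable borel" "f' \<in> borel_measurable borel"
    using contf cont by (auto intro: borel_measurable_continuous_onI)
  have B: "B \<ge> 0" using bd(1)[of 0] by linarith
  have int1: "integrable std_normal_distribution (\<lambda>x. x * f x)"
  proof (rule Bochner_Integration.integrable_bound)
    show "integrable std_normal_distribution (\<lambda>x. B * x)"
      using integrable_std_normal_distribution_moment[of 1] by simp
    show "AE x in std_normal_distribution. norm (x * f x) \<le> norm (B * x)"
      using bd(1) B by (auto simp: abs_mult mult.commute[of B] intro!: mult_left_mono)
  qed simp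
  have int2: "integrable std_normal_distribution f'"
    by (rule N.integrable_const_bound[of _ B']) (use bd in auto)
  have i1: "integrable lborel (\<lambda>x. ?\<phi> x * (x * f x))" and i2: "integrable lborel (\<lambda>x. ?\<phi> x * f' x)"
    using int1 int2 by (auto simp: integrable_density)
  have F: "((\<lambda>x. ?\<phi> x * f x) has_vector_derivative (?\<phi> x * f' x - ?\<phi> x * (x * f x))) (at x)" for x
  proof -
    have "(?\<phi> has_real_derivative (- x * ?\<phi> x)) (at x)"
    proof -
      have "((\<lambda>x. exp (- x\<^sup>2 / 2)) has_real_derivative (exp (- x\<^sup>2 / 2) * - x)) (at x)"
        by (auto intro!: derivative_eq_intros)
      from DERIV_cmult[OF this, of "1 / sqrt (2 * pi)"] show ?thesis
        unfolding std_normal_density_def[abs_def] by (simp add: mult_ac)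
    qed
    from DERIV_mult[OF this deriv[of x]] show ?thesis
      by (simp add: has_real_derivative_iff_has_vector_derivative[symmetric] algebra_simps)
  qed
  have lim: "((\<lambda>x. ?\<phi> x * f x) \<longlongrightarrow> 0) G" if "(?\<phi> \<longlongrightarrow> 0) G" for G
  proof (rule Lim_null_comparison)
    show "\<forall>\<^sub>F x in G. norm (?\<phi> x * f x) \<le> ?\<phi> x * B"
      using bd(1) by (auto simp: abs_mult intro!: always_eventually mult_left_mono)
    show "((\<lambda>x. ?\<phi> x * B) \<longlongrightarrow> 0) G" using tendsto_mult_left_zero[OF that] by simp
  qed
  have "(LBINT x=-\<infinity>..\<infinity>. ?\<phi> x * f' x - ?\<phi> x * (x * f x)) = 0 - 0"
  proof (rule interval_integral_FTC_integrable[OF _ F])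
    show "isCont (\<lambda>x. ?\<phi> x * f' x - ?\<phi> x * (x * f x)) x" for x
      using cont contf unfolding std_normal_density_def
      by (intro continuous_intros) (auto simp: continuous_on_eq_continuous_at)
    show "set_integrable lborel (einterval (- \<infinity>) \<infinity>) (\<lambda>x. ?\<phi> x * f' x - ?\<phi> x * (x * f x))"
      using i1 i2 by (simp add: set_integrable_def)
    have "(?\<phi> \<longlongrightarrow> 0) at_bot" "(?\<phi> \<longlongrightarrow> 0) at_top"
      unfolding std_normal_density_def by real_asymp+
    from this[THEN lim]
    show "(((\<lambda>x. ?\<phi> x * f x) \<circ> real_of_ereal) \<longlongrightarrow> 0) (at_right (- \<infinity>))"
      "(((\<lambda>x. ?\<phi> x * f x) \<circ> real_of_ereal) \<longlongrightarrow> 0) (at_left \<infinity>)"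
      by (simp_all add: ereal_tendsto_simps)
  qed simp
  then have "(\<integral>x. ?\<phi> x * f' x - ?\<phi> x * (x * f x) \<partial>lborel) = 0"
    by (simp add: interval_integral_to_infinity_eq interval_lebesgue_integral_def set_lebesgue_integral_def)
  then have "(\<integral>x. ?\<phi> x * f' x \<partial>lborel) = (\<integral>x. ?\<phi> x * (x * f x) \<partial>lborel)"
    using i1 i2 by simp
  then show ?thesis by (simp add: integral_density)
qed

lemma gaussian_product_integration_by_parts:
  fixes F F' :: "('k \<Rightarrow> real) \<Rightarrow> real"
  assumes K: "finite K" "k \<in> K"
    and deriv: "\<And>x t. ((\<lambda>s. F (x(k := s))) has_real_derivative F' (x(k := t))) (at t)"
    and cont: "\<And>x. continuous_on UNIV (\<lambda>s. F' (x(k := s)))"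
    and bd: "\<And>x. \<bar>F x\<bar> \<le> B" "\<And>x. \<bar>F' x\<bar> \<le> B'"
    and meas[measurable]: "F \<in> borel_measurable (gaussian_product K)" "F' \<in> borel_measurable (gaussian_product K)"
  shows "(\<integral>x. x k * F x \<partial>gaussian_product K) = (\<integral>x. F' x \<partial>gaussian_product K)"
proof -
  interpret product_sigma_finite "\<lambda>_::'k. std_normal_distribution" by (rule product_sigma_finite_gaussian)
  interpret G: prob_space "gaussian_product K" by (rule prob_space_gaussian_product)
  define I where "I = K - {k}"
  have I: "finite I" "k \<notin> I" "K = insert k I" using K by (auto simp: I_def)
  have B: "B \<ge> 0" using bd(1)[of undefined] by linarith
  have 1: "integrable (gaussian_product K) (\<lambda>x. x k * F x)"
  proof (rule Bochner_Integration.integrable_bound)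
    show "integrable (gaussian_product K) (\<lambda>x. B * x k)"
      using integrable_gaussian_component(1)[OF K] by simp
    show "AE x in gaussian_product K. norm (x k * F x) \<le> norm (B * x k)"
      using bd(1) B by (auto simp: abs_mult mult.commute[of B] intro!: mult_left_mono)
  qed (use K in measurable)
  have 2: "integrable (gaussian_product K) F'"
    by (rule G.integrable_const_bound[of _ B']) (use bd in auto)
  have "(\<integral>x. x k * F x \<partial>gaussian_product K)
      = (\<integral>x. \<integral>y. y * F (x(k := y)) \<partial>std_normal_distribution \<partial>gaussian_product I)"
    using product_integral_insert[OF I(1,2), of "\<lambda>x. x k * F x"] 1 by (simp add: I(3))
  also have "\<dots> = (\<integral>x. \<integral>y. F' (x(k := y)) \<partial>std_normal_distribution \<partial>gaussian_product I)"
    by (intro Bochner_Integration.integral_cong refl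
        std_normal_integration_by_parts[OF deriv cont bd(1) bd(2)])
  also have "\<dots> = (\<integral>x. F' x \<partial>gaussian_product K)"
    using product_integral_insert[OF I(1,2), of F'] 2 by (simp add: I(3))
  finally show ?thesis .
qed

text \<open>The mean value inequality bounds the difference quotients by \<open>g\<close>, so
  dominated convergence applies along every sequence of nonzero increments that tends to 0.\<close>

lemma has_real_derivative_integral:
  fixes f f' :: "real \<Rightarrow> 'a \<Rightarrow> real"
  assumes int: "\<And>t. integrable M (f t)"
    and deriv: "\<And>t x. x \<in> space M \<Longrightarrow> ((\<lambda>s. f s x) has_real_derivative f' t x) (at t)"
    and meas[measurable]: "\<And>t. f' t \<in> borel_measurable M"
    and g: "integrable M g" "\<And>t x. x \<in> space M \<Longrightarrow> \<bar>f' t x\<bar> \<le> g x"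
  shows "((\<lambda>t. \<integral>x. f t x \<partial>M) has_real_derivative (\<integral>x. f' t x \<partial>M)) (at t)"
proof -
  have [measurable]: "f t \<in> borel_measurable M" for t using int by auto
  have "(\<lambda>h. ((\<integral>x. f (t + h) x \<partial>M) - (\<integral>x. f t x \<partial>M)) / h) \<midarrow>0\<rightarrow> (\<integral>x. f' t x \<partial>M)"
  proof (rule tendsto_at_iff_sequentially[THEN iffD2], intro allI impI)
    fix X :: "nat \<Rightarrow> real" assume X: "\<forall>i. X i \<in> UNIV - {0}" "X \<longlonglongrightarrow> 0"
    then have X0: "X n \<noteq> 0" for n by auto
    have "(\<lambda>n. \<integral>x. (f (t + X n) x - f t x) / X n \<partial>M) \<longlonglongrightarrow> (\<integral>x. f' t x \<partial>M)"
    proof (rule integral_dominated_convergence[where w = g])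
      show "AE x in M. (\<lambda>n. (f (t + X n) x - f t x) / X n) \<longlonglongrightarrow> f' t x"
      proof (rule AE_I2)
        fix x assume "x \<in> space M"
        then have "(\<lambda>h. (f (t + h) x - f t x) / h) \<midarrow>0\<rightarrow> f' t x"
          using deriv[of x t] unfolding DERIV_def by simp
        from this[THEN tendsto_at_iff_sequentially[THEN iffD1]] X
        show "(\<lambda>n. (f (t + X n) x - f t x) / X n) \<longlonglongrightarrow> f' t x" by (auto simp: o_def)
      qed
      show "AE x in M. norm ((f (t + X n) x - f t x) / X n) \<le> g x" for n
      proof (rule AE_I2)
        fix x assume x: "x \<in> space M"
        have "norm (f (t + X n) x - f t x) \<le> g x * norm (t + X n - t)"
          by (rule field_differentiable_bound[of UNIV "\<lambda>s. f s x" "\<lambda>s. f' s x"])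
             (use deriv[OF x] g(2)[OF x] in auto)
        then show "norm ((f (t + X n) x - f t x) / X n) \<le> g x"
          using X0[of n] by (simp add: divide_le_eq)
      qed
    qed (use g in auto)
    then show "((\<lambda>h. ((\<integral>x. f (t + h) x \<partial>M) - (\<integral>x. f t x \<partial>M)) / h) \<circ> X) \<longlonglongrightarrow> (\<integral>x. f' t x \<partial>M)"
      using int by (simp add: o_def)
  qed
  then show ?thesis by (simp add: DERIV_def)
qed


section \<open>The logarithm of a sum of exponentials as a soft maximum\<close>

lemma ln_sum_exp_le:
  fixes a :: "'i \<Rightarrow> real"
  assumes I: "finite I" "I \<noteq> {}" and "\<And>i. i \<in> I \<Longrightarrow> a i \<le> M"
  shows "ln (\<Sum>i\<in>I. exp (a i)) \<le> ln (card I) + M"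
proof -
  have c: "card I > 0" using I by (simp add: card_gt_0_iff)
  have "(\<Sum>i\<in>I. exp (a i)) \<le> (\<Sum>i\<in>I. exp M)" using assms by (intro sum_mono) auto
  moreover have "(\<Sum>i\<in>I. exp (a i)) > 0" using I by (intro sum_pos) auto
  ultimately have "ln (\<Sum>i\<in>I. exp (a i)) \<le> ln (card I * exp M)"
    using c by (subst ln_le_cancel_iff) auto
  then show ?thesis using c by (simp add: ln_mult)
qed

lemma le_ln_sum_exp:
  fixes a :: "'i \<Rightarrow> real"
  assumes "finite I" "i \<in> I"
  shows "a i \<le> ln (\<Sum>i\<in>I. exp (a i))"
proof -
  have "exp (a i) \<le> (\<Sum>i\<in>I. exp (a i))" using assms by (intro member_le_sum) auto
  moreover have "(\<Sum>i\<in>I. exp (a i)) > 0" using assms by (intro sum_pos) auto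
  ultimately show ?thesis by (simp add: ln_ge_iff)
qed

lemma (in prob_space) integrable_ln_sum_exp:
  fixes X :: "'i \<Rightarrow> 'a \<Rightarrow> real"
  assumes I: "finite I" "I \<noteq> {}" and X: "\<And>i. i \<in> I \<Longrightarrow> integrable M (X i)"
  shows "integrable M (\<lambda>w. ln (\<Sum>i\<in>I. exp (\<beta> * X i w)))"
proof (rule Bochner_Integration.integrable_bound)
  show "integrable M (\<lambda>w. ln (card I) + (\<Sum>i\<in>I. \<bar>\<beta> * X i w\<bar>))"
    using X by (intro Bochner_Integration.integrable_add Bochner_Integration.integrable_sum integrable_abs
        integrable_mult_right integrable_const) auto
  note [measurable] = borel_measurable_integrable[OF X]
  show "(\<lambda>w. ln (\<Sum>i\<in>I. exp (\<beta> * X i w))) \<in> borel_measurable M" by measurable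
  show "AE w in M. norm (ln (\<Sum>i\<in>I. exp (\<beta> * X i w))) \<le> norm (ln (card I) + (\<Sum>i\<in>I. \<bar>\<beta> * X i w\<bar>))"
  proof (rule AE_I2)
    fix w
    define S where "S = (\<Sum>i\<in>I. \<bar>\<beta> * X i w\<bar>)"
    have S: "\<bar>\<beta> * X i w\<bar> \<le> S" if "i \<in> I" for i
      unfolding S_def using that I by (intro member_le_sum) auto
    obtain i where i: "i \<in> I" using I by auto
    have "ln (\<Sum>i\<in>I. exp (\<beta> * X i w)) \<le> ln (card I) + S"
      using S by (intro ln_sum_exp_le I) (auto simp: abs_le_iff)
    moreover have "\<beta> * X i w \<le> ln (\<Sum>i\<in>I. exp (\<beta> * X i w))"
      using le_ln_sum_exp[OF I(1) i, of "\<lambda>i. \<beta> * X i w"] .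
    moreover have "0 \<le> ln (real (card I))" using I by (simp add: Suc_le_eq card_gt_0_iff)
    ultimately show "norm (ln (\<Sum>i\<in>I. exp (\<beta> * X i w))) \<le> norm (ln (card I) + (\<Sum>i\<in>I. \<bar>\<beta> * X i w\<bar>))"
      using S[OF i] unfolding S_def[symmetric] by (simp add: abs_le_iff)
  qed
qed

section \<open>Interpolation between two Gaussian families\<close>

text \<open>\<open>D\<close> and \<open>H\<close> are the gradient and the Hessian of
  \<open>\<psi>\<close>, with global bounds. \<open>P i k\<close> and \<open>Q i k\<close> are the
  coefficients of the coordinate x_k in two families of Gaussian vectors driven by the same standard
  Gaussian x. The sign of \<beta> is left open: positive values will serve maxima, negative ones
  minima.\<close>

locale gaussian_interpolation =
  fixes I :: "'i set" and K :: "'k set"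
    and \<psi> :: "'e::euclidean_space \<Rightarrow> real" and D :: "'e \<Rightarrow> 'e" and H :: "'e \<Rightarrow> 'e \<Rightarrow> 'e"
    and \<beta> B B' :: real and P Q :: "'i \<Rightarrow> 'k \<Rightarrow> 'e"
  assumes finI: "finite I" "I \<noteq> {}" and finK: "finite K"
    and deriv_psi: "\<And>x. (\<psi> has_derivative (\<lambda>v. D x \<bullet> v)) (at x)"
    and deriv_D: "\<And>x. (D has_derivative H x) (at x)"
    and cont_H: "\<And>v. continuous_on UNIV (\<lambda>x. H x v)"
    and bound_D: "\<And>x. norm (D x) \<le> B"
    and bound_H: "\<And>x v. norm (H x v) \<le> B' * norm v"
begin

text \<open>The rotation, equal to \<open>Q\<close> at angle 0 and to \<open>P\<close> at angle pi /
  2; \<open>U'\<close> is its derivative in the angle.\<close>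

definition U :: "real \<Rightarrow> 'i \<Rightarrow> 'k \<Rightarrow> 'e" where
  "U \<theta> i k = sin \<theta> *\<^sub>R P i k + cos \<theta> *\<^sub>R Q i k"

definition U' :: "real \<Rightarrow> 'i \<Rightarrow> 'k \<Rightarrow> 'e" where
  "U' \<theta> i k = cos \<theta> *\<^sub>R P i k - sin \<theta> *\<^sub>R Q i k"

definition u :: "real \<Rightarrow> ('k \<Rightarrow> real) \<Rightarrow> 'i \<Rightarrow> 'e" where
  "u \<theta> x i = (\<Sum>k\<in>K. x k *\<^sub>R U \<theta> i k)"

text \<open>A partition function, whose logarithm is the soft maximum; the \<open>p\<close> that
  follow are its Gibbs weights.\<close>

definition Z :: "real \<Rightarrow> ('k \<Rightarrow> real) \<Rightarrow> real" where
  "Z \<theta> x = (\<Sum>i\<in>I. exp (\<beta> * \<psi> (u \<theta> x i)))"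

definition p :: "real \<Rightarrow> ('k \<Rightarrow> real) \<Rightarrow> 'i \<Rightarrow> real" where
  "p \<theta> x i = exp (\<beta> * \<psi> (u \<theta> x i)) / Z \<theta> x"

text \<open>The coefficient of x_k in the angular derivative of ln Z, up to the factor
  \<beta>.\<close>

definition \<Phi> :: "real \<Rightarrow> ('k \<Rightarrow> real) \<Rightarrow> 'k \<Rightarrow> real" where
  "\<Phi> \<theta> x k = (\<Sum>i\<in>I. p \<theta> x i * (D (u \<theta> x i) \<bullet> U' \<theta> i k))"

text \<open>The partial derivative of \<open>\<Phi> \<theta> x k\<close> in x_k. The first summand
  differentiates the gradient, the second the Gibbs weight, whose logarithmic derivative is \<beta>
  <D, U> minus its Gibbs average.\<close>

definition \<Phi>' :: "real \<Rightarrow> ('k \<Rightarrow> real) \<Rightarrow> 'k \<Rightarrow> real" where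
  "\<Phi>' \<theta> x k = (\<Sum>i\<in>I. p \<theta> x i * (H (u \<theta> x i) (U \<theta> i k) \<bullet> U' \<theta> i k)
      + p \<theta> x i * (\<beta> * (D (u \<theta> x i) \<bullet> U \<theta> i k)
          - \<beta> * (\<Sum>l\<in>I. p \<theta> x l * (D (u \<theta> x l) \<bullet> U \<theta> l k))) * (D (u \<theta> x i) \<bullet> U' \<theta> i k))"

lemma Z_pos: "Z \<theta> x > 0"
  unfolding Z_def using finI by (intro sum_pos) auto

lemma p_nonneg: "0 \<le> p \<theta> x i"
  using Z_pos[of \<theta> x] by (simp add: p_def)

lemma sum_p: "(\<Sum>i\<in>I. p \<theta> x i) = 1"
  using Z_pos[of \<theta> x] by (simp add: p_def sum_divide_distrib[symmetric]) (simp add: Z_def)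

text \<open>The chain rules are stated along arbitrary curves because two kinds of derivative are
  taken: in the angle and in a single coordinate of x.\<close>

lemma has_derivative_psi_curve:
  assumes "(c has_vector_derivative c') (at t)"
  shows "((\<lambda>t. \<psi> (c t)) has_real_derivative D (c t) \<bullet> c') (at t)"
proof -
  have "(c has_derivative (\<lambda>h. h *\<^sub>R c')) (at t)" using assms by (simp add: has_vector_derivative_def)
  from diff_chain_at[OF this deriv_psi] show ?thesis
    by (simp add: has_field_derivative_def o_def mult_commute_abs)
qed

lemma has_derivative_D_curve:
  assumes "(c has_vector_derivative c') (at t)"
  shows "((\<lambda>t. D (c t) \<bullet> w) has_real_derivative H (c t) c' \<bullet> w) (at t)"
proof -
  have "(c has_derivative (\<lambda>h. h *\<^sub>R c')) (at t)" using assms by (simp add: has_vector_derivative_def)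
  from diff_chain_at[OF this deriv_D]
  have "((\<lambda>t. D (c t)) has_derivative (\<lambda>h. H (c t) (h *\<^sub>R c'))) (at t)" by (simp add: o_def)
  moreover have "H (c t) (h *\<^sub>R c') = h *\<^sub>R H (c t) c'" for h
    using has_derivative_linear[OF deriv_D] by (rule linear_scale)
  ultimately have "((\<lambda>t. D (c t)) has_derivative (\<lambda>h. h *\<^sub>R H (c t) c')) (at t)" by simp
  from has_derivative_inner_left[OF this, of w] show ?thesis
    by (simp add: has_field_derivative_def mult_commute_abs)
qed

lemma has_derivative_ln_Z_curve:
  assumes "\<And>i. i \<in> I \<Longrightarrow> (c i has_vector_derivative c' i) (at t)"
  shows "((\<lambda>t. ln (\<Sum>i\<in>I. exp (\<beta> * \<psi> (c i t)))) has_real_derivative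
     \<beta> * (\<Sum>i\<in>I. exp (\<beta> * \<psi> (c i t)) / (\<Sum>l\<in>I. exp (\<beta> * \<psi> (c l t))) * (D (c i t) \<bullet> c' i))) (at t)"
proof -
  let ?Z = "\<lambda>t. \<Sum>l\<in>I. exp (\<beta> * \<psi> (c l t))"
  have Z: "?Z t > 0" using finI by (intro sum_pos) auto
  have "(?Z has_real_derivative (\<Sum>i\<in>I. exp (\<beta> * \<psi> (c i t)) * (\<beta> * (D (c i t) \<bullet> c' i)))) (at t)"
    by (intro DERIV_sum DERIV_fun_exp DERIV_cmult has_derivative_psi_curve assms)
  from DERIV_chain2[OF DERIV_ln this] Z
  have "((\<lambda>t. ln (?Z t)) has_real_derivative inverse (?Z t) * (\<Sum>i\<in>I. exp (\<beta> * \<psi> (c i t)) * (\<beta> * (D (c i t) \<bullet> c' i)))) (at t)"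
    by simp
  also have "inverse (?Z t) * (\<Sum>i\<in>I. exp (\<beta> * \<psi> (c i t)) * (\<beta> * (D (c i t) \<bullet> c' i)))
    = \<beta> * (\<Sum>i\<in>I. exp (\<beta> * \<psi> (c i t)) / ?Z t * (D (c i t) \<bullet> c' i))"
    unfolding sum_distrib_left by (intro sum.cong) (auto simp: divide_inverse mult_ac)
  finally show ?thesis .
qed

text \<open>Writing a weight as exp (\<beta> \<psi> - ln Z) reduces its derivative to the one
  already computed for ln Z.\<close>

lemma has_derivative_weight_curve:
  assumes c: "\<And>i. i \<in> I \<Longrightarrow> (c i has_vector_derivative c' i) (at t)" and i: "i \<in> I"
  defines "q \<equiv> \<lambda>l t. exp (\<beta> * \<psi> (c l t)) / (\<Sum>l\<in>I. exp (\<beta> * \<psi> (c l t)))"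
  shows "(q i has_real_derivative
     q i t * (\<beta> * (D (c i t) \<bullet> c' i) - \<beta> * (\<Sum>l\<in>I. q l t * (D (c l t) \<bullet> c' l)))) (at t)"
proof -
  let ?Z = "\<lambda>t. \<Sum>l\<in>I. exp (\<beta> * \<psi> (c l t))"
  have Z: "?Z t > 0" for t using finI by (intro sum_pos) auto
  have q: "q i = (\<lambda>t. exp (\<beta> * \<psi> (c i t) - ln (?Z t)))"
    using Z by (auto simp: q_def exp_diff fun_eq_iff)
  have "((\<lambda>t. exp (\<beta> * \<psi> (c i t) - ln (?Z t))) has_real_derivative
     exp (\<beta> * \<psi> (c i t) - ln (?Z t)) *
       (\<beta> * (D (c i t) \<bullet> c' i) - \<beta> * (\<Sum>l\<in>I. q l t * (D (c l t) \<bullet> c' l)))) (at t)"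
    unfolding q_def
    by (intro DERIV_fun_exp DERIV_diff DERIV_cmult has_derivative_psi_curve has_derivative_ln_Z_curve c i)
  then show ?thesis unfolding q by simp
qed

lemma u_deriv_theta: "((\<lambda>\<theta>. u \<theta> x i) has_vector_derivative (\<Sum>k\<in>K. x k *\<^sub>R U' \<theta> i k)) (at \<theta>)"
  unfolding u_def[abs_def] U_def U'_def
  by (auto intro!: derivative_eq_intros sum.cong simp: algebra_simps scaleR_diff_right)

lemma u_fun_upd:
  assumes "k \<in> K"
  shows "u \<theta> (x(k := s)) i = s *\<^sub>R U \<theta> i k + (\<Sum>j\<in>K - {k}. x j *\<^sub>R U \<theta> i j)"
  unfolding u_def using assms finK by (subst sum.remove[of K k]) (auto intro!: sum.cong)

lemma u_deriv_coord:
  assumes "k \<in> K"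
  shows "((\<lambda>s. u \<theta> (x(k := s)) i) has_vector_derivative U \<theta> i k) (at t)"
  unfolding u_fun_upd[OF assms] by (auto intro!: derivative_eq_intros)

lemma ln_Z_deriv_theta:
  "((\<lambda>\<theta>. ln (Z \<theta> x)) has_real_derivative \<beta> * (\<Sum>k\<in>K. x k * \<Phi> \<theta> x k)) (at \<theta>)"
proof -
  have "((\<lambda>\<theta>. ln (Z \<theta> x)) has_real_derivative
    \<beta> * (\<Sum>i\<in>I. p \<theta> x i * (D (u \<theta> x i) \<bullet> (\<Sum>k\<in>K. x k *\<^sub>R U' \<theta> i k)))) (at \<theta>)"
    unfolding Z_def p_def by (rule has_derivative_ln_Z_curve) (rule u_deriv_theta)
  also have "(\<Sum>i\<in>I. p \<theta> x i * (D (u \<theta> x i) \<bullet> (\<Sum>k\<in>K. x k *\<^sub>R U' \<theta> i k))) = (\<Sum>k\<in>K. x k * \<Phi> \<theta> x k)"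
    unfolding \<Phi>_def inner_sum_right sum_distrib_left
    by (subst sum.swap) (auto intro!: sum.cong)
  finally show ?thesis .
qed

lemma \<Phi>_deriv_coord:
  assumes k: "k \<in> K"
  shows "((\<lambda>s. \<Phi> \<theta> (x(k := s)) k) has_real_derivative \<Phi>' \<theta> (x(k := t)) k) (at t)"
  unfolding \<Phi>_def \<Phi>'_def
proof (rule DERIV_sum)
  fix i assume i: "i \<in> I"
  let ?c = "\<lambda>i s. u \<theta> (x(k := s)) i"
  have c: "(?c i has_vector_derivative U \<theta> i k) (at t)" for i by (rule u_deriv_coord[OF k])
  have 1: "((\<lambda>s. p \<theta> (x(k := s)) i) has_real_derivative
     p \<theta> (x(k := t)) i * (\<beta> * (D (?c i t) \<bullet> U \<theta> i k) - \<beta> * (\<Sum>l\<in>I. p \<theta> (x(k := t)) l * (D (?c l t) \<bullet> U \<theta> l k)))) (at t)"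
    using has_derivative_weight_curve[of ?c "\<lambda>i. U \<theta> i k" t i, OF c i] unfolding p_def Z_def .
  from DERIV_mult[OF 1 has_derivative_D_curve[OF c[of i], of "U' \<theta> i k"]]
  show "((\<lambda>s. p \<theta> (x(k := s)) i * (D (?c i s) \<bullet> U' \<theta> i k)) has_real_derivative
     p \<theta> (x(k := t)) i * (H (?c i t) (U \<theta> i k) \<bullet> U' \<theta> i k)
      + p \<theta> (x(k := t)) i * (\<beta> * (D (?c i t) \<bullet> U \<theta> i k)
          - \<beta> * (\<Sum>l\<in>I. p \<theta> (x(k := t)) l * (D (?c l t) \<bullet> U \<theta> l k))) * (D (?c i t) \<bullet> U' \<theta> i k)) (at t)"
    by (rule DERIV_cong) (simp add: add.commute mult.commute)
qed

text \<open>A bound for all coefficients that is uniform in the angle, as the domination under the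
  integral requires.\<close>

definition R :: real where
  "R = (\<Sum>i\<in>I. \<Sum>k\<in>K. norm (P i k) + norm (Q i k))"

lemma norm_U_le_R:
  assumes "i \<in> I" "k \<in> K"
  shows "norm (U \<theta> i k) \<le> R" "norm (U' \<theta> i k) \<le> R"
proof -
  have "norm (P i k) + norm (Q i k) \<le> (\<Sum>k\<in>K. norm (P i k) + norm (Q i k))"
    using assms finK by (intro member_le_sum) auto
  also have "\<dots> \<le> R"
    unfolding R_def using assms finI by (intro member_le_sum[of i I]) (auto intro: sum_nonneg)
  finally have PQ: "norm (P i k) + norm (Q i k) \<le> R" .
  have b: "norm (s *\<^sub>R v) \<le> norm v" if "\<bar>s\<bar> \<le> 1" for s and v :: 'e
    using that by (simp add: mult_left_le_one_le)
  have "norm (U \<theta> i k) \<le> norm (sin \<theta> *\<^sub>R P i k) + norm (cos \<theta> *\<^sub>R Q i k)"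
    unfolding U_def by (rule norm_triangle_ineq)
  also have "\<dots> \<le> norm (P i k) + norm (Q i k)" by (intro add_mono b) auto
  finally show "norm (U \<theta> i k) \<le> R" using PQ by simp
  have "norm (U' \<theta> i k) \<le> norm (cos \<theta> *\<^sub>R P i k) + norm (sin \<theta> *\<^sub>R Q i k)"
    unfolding U'_def by (rule norm_triangle_ineq4)
  also have "\<dots> \<le> norm (P i k) + norm (Q i k)" by (intro add_mono b) auto
  finally show "norm (U' \<theta> i k) \<le> R" using PQ by simp
qed

lemma R_nonneg: "R \<ge> 0"
  unfolding R_def by (intro sum_nonneg) auto

lemma B_nonneg: "B \<ge> 0"
  using bound_D[of 0] norm_ge_zero order_trans by blast

lemma abs_D_inner_le:
  assumes "norm v \<le> R"
  shows "\<bar>D y \<bullet> v\<bar> \<le> B * R"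
proof -
  have "\<bar>D y \<bullet> v\<bar> \<le> norm (D y) * norm v" by (rule Cauchy_Schwarz_ineq2)
  also have "\<dots> \<le> B * R" using assms bound_D[of y] B_nonneg by (intro mult_mono) auto
  finally show ?thesis .
qed

lemma abs_weighted_sum_le:
  assumes "\<And>i. i \<in> I \<Longrightarrow> \<bar>f i\<bar> \<le> c"
  shows "\<bar>\<Sum>i\<in>I. p \<theta> x i * f i\<bar> \<le> c"
proof -
  have "\<bar>\<Sum>i\<in>I. p \<theta> x i * f i\<bar> \<le> (\<Sum>i\<in>I. p \<theta> x i * \<bar>f i\<bar>)"
    using p_nonneg by (intro order_trans[OF sum_abs]) (simp add: abs_mult)
  also have "\<dots> \<le> (\<Sum>i\<in>I. p \<theta> x i * c)"
    using assms p_nonneg by (intro sum_mono mult_left_mono) auto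
  also have "\<dots> = c" using sum_p[of \<theta> x] by (simp add: sum_distrib_right[symmetric])
  finally show ?thesis .
qed

lemma abs_\<Phi>_le: "k \<in> K \<Longrightarrow> \<bar>\<Phi> \<theta> x k\<bar> \<le> B * R"
  unfolding \<Phi>_def by (intro abs_weighted_sum_le abs_D_inner_le norm_U_le_R)

definition C' :: real where
  "C' = \<bar>B'\<bar> * R * R + (\<bar>\<beta>\<bar> * (B * R) + \<bar>\<beta>\<bar> * (B * R)) * (B * R)"

lemma \<Phi>'_eq:
  "\<Phi>' \<theta> x k = (\<Sum>i\<in>I. p \<theta> x i * (H (u \<theta> x i) (U \<theta> i k) \<bullet> U' \<theta> i k
      + (\<beta> * (D (u \<theta> x i) \<bullet> U \<theta> i k)
          - \<beta> * (\<Sum>l\<in>I. p \<theta> x l * (D (u \<theta> x l) \<bullet> U \<theta> l k))) * (D (u \<theta> x i) \<bullet> U' \<theta> i k)))"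
  unfolding \<Phi>'_def by (simp only: distrib_left mult.assoc)

lemma abs_\<Phi>'_le:
  assumes k: "k \<in> K"
  shows "\<bar>\<Phi>' \<theta> x k\<bar> \<le> C'"
  unfolding \<Phi>'_eq
proof (rule abs_weighted_sum_le)
  fix i assume i: "i \<in> I"
  let ?S = "\<Sum>l\<in>I. p \<theta> x l * (D (u \<theta> x l) \<bullet> U \<theta> l k)"
  have 1: "\<bar>H (u \<theta> x i) (U \<theta> i k) \<bullet> U' \<theta> i k\<bar> \<le> \<bar>B'\<bar> * R * R"
  proof -
    have "\<bar>H (u \<theta> x i) (U \<theta> i k) \<bullet> U' \<theta> i k\<bar> \<le> norm (H (u \<theta> x i) (U \<theta> i k)) * norm (U' \<theta> i k)"
      by (rule Cauchy_Schwarz_ineq2)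
    also have "\<dots> \<le> (\<bar>B'\<bar> * R) * R"
    proof (intro mult_mono norm_U_le_R i k)
      have "norm (H (u \<theta> x i) (U \<theta> i k)) \<le> B' * norm (U \<theta> i k)" by (rule bound_H)
      also have "\<dots> \<le> \<bar>B'\<bar> * R" using norm_U_le_R(1)[OF i k] by (intro mult_mono) auto
      finally show "norm (H (u \<theta> x i) (U \<theta> i k)) \<le> \<bar>B'\<bar> * R" .
    qed (use R_nonneg in auto)
    finally show ?thesis .
  qed
  have "\<bar>?S\<bar> \<le> B * R"
    by (intro abs_weighted_sum_le abs_D_inner_le norm_U_le_R k)
  then have S: "\<bar>\<beta> * ?S\<bar> \<le> \<bar>\<beta>\<bar> * (B * R)" by (simp add: abs_mult mult_left_mono)
  have "\<bar>D (u \<theta> x i) \<bullet> U \<theta> i k\<bar> \<le> B * R" by (intro abs_D_inner_le norm_U_le_R i k)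
  then have T: "\<bar>\<beta> * (D (u \<theta> x i) \<bullet> U \<theta> i k)\<bar> \<le> \<bar>\<beta>\<bar> * (B * R)"
    unfolding abs_mult[of \<beta>] by (intro mult_left_mono) auto
  have "\<bar>(\<beta> * (D (u \<theta> x i) \<bullet> U \<theta> i k) - \<beta> * ?S) * (D (u \<theta> x i) \<bullet> U' \<theta> i k)\<bar>
      \<le> (\<bar>\<beta>\<bar> * (B * R) + \<bar>\<beta>\<bar> * (B * R)) * (B * R)"
    unfolding abs_mult[of "_ - _"]
  proof (intro mult_mono abs_D_inner_le norm_U_le_R i k)
    show "\<bar>\<beta> * (D (u \<theta> x i) \<bullet> U \<theta> i k) - \<beta> * ?S\<bar> \<le> \<bar>\<beta>\<bar> * (B * R) + \<bar>\<beta>\<bar> * (B * R)"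
      using S T by linarith
  qed (use B_nonneg R_nonneg in auto)
  with 1 show "\<bar>H (u \<theta> x i) (U \<theta> i k) \<bullet> U' \<theta> i k + (\<beta> * (D (u \<theta> x i) \<bullet> U \<theta> i k) - \<beta> * ?S) * (D (u \<theta> x i) \<bullet> U' \<theta> i k)\<bar> \<le> C'"
    unfolding C'_def by linarith
qed

lemma continuous_psi: "continuous_on UNIV \<psi>" and continuous_D: "continuous_on UNIV D"
  by (auto simp: continuous_on_eq_continuous_at
      intro: has_derivative_continuous[OF deriv_psi] has_derivative_continuous[OF deriv_D])

lemma measurable_u [measurable]: "(\<lambda>x. u \<theta> x i) \<in> borel_measurable (gaussian_product K)"
  unfolding u_def by measurable

lemma measurable_compose_u:
  assumes "continuous_on UNIV f"
  shows "(\<lambda>x. f (u \<theta> x i)) \<in> borel_measurable (gaussian_product K)"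
  using measurable_compose[OF measurable_u borel_measurable_continuous_onI[OF assms]] .

lemma measurable_Z [measurable]: "Z \<theta> \<in> borel_measurable (gaussian_product K)"
proof -
  note [measurable] = measurable_compose_u[OF continuous_psi]
  show ?thesis unfolding Z_def[abs_def] by measurable
qed

lemma measurable_p [measurable]: "(\<lambda>x. p \<theta> x i) \<in> borel_measurable (gaussian_product K)"
proof -
  note [measurable] = measurable_compose_u[OF continuous_psi]
  show ?thesis unfolding p_def[abs_def] by measurable
qed

lemma measurable_\<Phi> [measurable]: "(\<lambda>x. \<Phi> \<theta> x k) \<in> borel_measurable (gaussian_product K)"
proof -
  note [measurable] = measurable_compose_u[OF continuous_D]
  show ?thesis unfolding \<Phi>_def[abs_def] by measurable
qed

lemma measurable_\<Phi>' [measurable]: "(\<lambda>x. \<Phi>' \<theta> x k) \<in> borel_measurable (gaussian_product K)"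
proof -
  note [measurable] = measurable_compose_u[OF continuous_D] measurable_compose_u[OF cont_H]
  show ?thesis unfolding \<Phi>'_def[abs_def] by measurable
qed

lemma continuous_\<Phi>'_coord:
  assumes k: "k \<in> K"
  shows "continuous_on UNIV (\<lambda>s. \<Phi>' \<theta> (x(k := s)) k)"
proof -
  have u: "continuous_on UNIV (\<lambda>s. u \<theta> (x(k := s)) i)" for i
    unfolding u_fun_upd[OF k] by (intro continuous_intros)
  have comp: "continuous_on UNIV (\<lambda>s. f (u \<theta> (x(k := s)) i))" if "continuous_on UNIV f" for f :: "'e \<Rightarrow> 'z::topological_space" and i
    using continuous_on_compose2[OF that u] by simp
  have Z: "continuous_on UNIV (\<lambda>s. Z \<theta> (x(k := s)))"
    unfolding Z_def by (intro continuous_intros comp continuous_psi)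
  have p: "continuous_on UNIV (\<lambda>s. p \<theta> (x(k := s)) i)" for i
    unfolding p_def using Z_pos by (intro continuous_intros comp continuous_psi Z) (auto simp: less_imp_neq[symmetric])
  show ?thesis
    unfolding \<Phi>'_def by (intro continuous_intros p comp continuous_D cont_H)
qed

text \<open>The gradient bound makes \<psi> Lipschitz, so it grows at most linearly and is
  integrable along Gaussian vectors.\<close>

lemma abs_psi_le: "\<bar>\<psi> y\<bar> \<le> \<bar>\<psi> 0\<bar> + B * norm y"
proof -
  have "norm (\<psi> y - \<psi> 0) \<le> B * norm (y - 0)"
  proof (rule differentiable_bound[OF convex_UNIV deriv_psi])
    show "onorm (\<lambda>v. D x \<bullet> v) \<le> B" for x
      by (intro onorm_le order_trans[OF _ mult_right_mono[OF bound_D[of x] norm_ge_zero]])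
         (simp add: Cauchy_Schwarz_ineq2)
  qed auto
  then show ?thesis by simp
qed

lemma integrable_psi_u: "integrable (gaussian_product K) (\<lambda>x. \<psi> (u \<theta> x i))"
proof (rule Bochner_Integration.integrable_bound)
  interpret prob_space "gaussian_product K" by (rule prob_space_gaussian_product)
  let ?g = "\<lambda>x. \<bar>\<psi> 0\<bar> + B * (\<Sum>k\<in>K. \<bar>x k\<bar> * norm (U \<theta> i k))"
  show "integrable (gaussian_product K) ?g"
    using finK by (intro Bochner_Integration.integrable_add Bochner_Integration.integrable_sum integrable_mult_right
        integrable_mult_left integrable_abs integrable_gaussian_component integrable_const) auto
  show "AE x in gaussian_product K. norm (\<psi> (u \<theta> x i)) \<le> norm (?g x)"
  proof (rule AE_I2)
    fix x
    have "norm (u \<theta> x i) \<le> (\<Sum>k\<in>K. \<bar>x k\<bar> * norm (U \<theta> i k))"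
      unfolding u_def by (intro order_trans[OF norm_sum]) simp
    then have "B * norm (u \<theta> x i) \<le> B * (\<Sum>k\<in>K. \<bar>x k\<bar> * norm (U \<theta> i k))"
      using B_nonneg by (rule mult_left_mono)
    then show "norm (\<psi> (u \<theta> x i)) \<le> norm (?g x)"
      using abs_psi_le[of "u \<theta> x i"] by simp
  qed
qed (rule measurable_compose_u[OF continuous_psi])

lemma integrable_ln_Z: "integrable (gaussian_product K) (\<lambda>x. ln (Z \<theta> x))"
  unfolding Z_def
  by (intro prob_space.integrable_ln_sum_exp prob_space_gaussian_product finI integrable_psi_u)

text \<open>Integration by parts in each coordinate trades the factor x_k of \<Phi> for the
  derivative \<Phi>'. The integrand then contains no bare Gaussian coordinate, and its sign can be
  decided pointwise.\<close>

lemma expectation_ln_Z_deriv: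
  "((\<lambda>\<theta>. \<integral>x. ln (Z \<theta> x) \<partial>gaussian_product K) has_real_derivative
     (\<integral>x. \<beta> * (\<Sum>k\<in>K. \<Phi>' \<theta> x k) \<partial>gaussian_product K)) (at \<theta>)"
proof -
  interpret prob_space "gaussian_product K" by (rule prob_space_gaussian_product)
  have "((\<lambda>\<theta>. \<integral>x. ln (Z \<theta> x) \<partial>gaussian_product K) has_real_derivative
     (\<integral>x. \<beta> * (\<Sum>k\<in>K. x k * \<Phi> \<theta> x k) \<partial>gaussian_product K)) (at \<theta>)"
  proof (rule has_real_derivative_integral[OF integrable_ln_Z ln_Z_deriv_theta])
    show "integrable (gaussian_product K) (\<lambda>x. \<bar>\<beta>\<bar> * (\<Sum>k\<in>K. \<bar>x k\<bar> * (B * R)))"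
      using finK by (intro Bochner_Integration.integrable_sum integrable_mult_right
          integrable_mult_left integrable_abs integrable_gaussian_component) auto
    show "\<bar>\<beta> * (\<Sum>k\<in>K. x k * \<Phi> t x k)\<bar> \<le> \<bar>\<beta>\<bar> * (\<Sum>k\<in>K. \<bar>x k\<bar> * (B * R))" for t x
      unfolding abs_mult
    proof (intro mult_left_mono order_trans[OF sum_abs] sum_mono)
      fix k assume "k \<in> K"
      then show "\<bar>x k * \<Phi> t x k\<bar> \<le> \<bar>x k\<bar> * (B * R)"
        unfolding abs_mult by (intro mult_left_mono abs_\<Phi>_le) auto
    qed auto
  qed measurable
  also have "(\<integral>x. \<beta> * (\<Sum>k\<in>K. x k * \<Phi> \<theta> x k) \<partial>gaussian_product K) = \<beta> * (\<Sum>k\<in>K. \<integral>x. x k * \<Phi> \<theta> x k \<partial>gaussian_product K)"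
  proof -
    have "integrable (gaussian_product K) (\<lambda>x. x k * \<Phi> \<theta> x k)" if k: "k \<in> K" for k
    proof (rule Bochner_Integration.integrable_bound)
      show "integrable (gaussian_product K) (\<lambda>x. (B * R) * x k)"
        using finK k by (intro integrable_mult_right integrable_gaussian_component) auto
      show "AE x in gaussian_product K. norm (x k * \<Phi> \<theta> x k) \<le> norm ((B * R) * x k)"
      proof (rule AE_I2)
        fix x
        have "\<bar>x k\<bar> * \<bar>\<Phi> \<theta> x k\<bar> \<le> \<bar>x k\<bar> * (B * R)" by (intro mult_left_mono abs_\<Phi>_le k) auto
        then show "norm (x k * \<Phi> \<theta> x k) \<le> norm ((B * R) * x k)"
          using B_nonneg R_nonneg by (simp add: abs_mult mult.commute)
      qed
    qed (use k in measurable)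
    then show ?thesis by simp
  qed
  also have "(\<Sum>k\<in>K. \<integral>x. x k * \<Phi> \<theta> x k \<partial>gaussian_product K) = (\<Sum>k\<in>K. \<integral>x. \<Phi>' \<theta> x k \<partial>gaussian_product K)"
    by (intro sum.cong refl gaussian_product_integration_by_parts[OF finK _ \<Phi>_deriv_coord continuous_\<Phi>'_coord abs_\<Phi>_le abs_\<Phi>'_le])
       measurable
  also have "\<beta> * \<dots> = (\<integral>x. \<beta> * (\<Sum>k\<in>K. \<Phi>' \<theta> x k) \<partial>gaussian_product K)"
  proof -
    have "integrable (gaussian_product K) (\<lambda>x. \<Phi>' \<theta> x k)" if k: "k \<in> K" for k
      by (rule integrable_const_bound[of _ C']) (use abs_\<Phi>'_le[OF k] in auto)
    then show ?thesis by simp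
  qed
  finally show ?thesis .
qed

text \<open>\<open>disj\<close> makes the two families depend on different coordinates and removes
  all mixed terms, \<open>H0\<close> cancels the Hessian terms, and what remains of the derivative
  is \<beta>^2 times the sum over i and l of p_i p_l (T i i - T i l), which \<open>cov\<close> makes
  nonpositive. In \<open>cov\<close> the points x and y are arbitrary, as they stand for the
  positions of the vectors i and l at any angle.\<close>

theorem comparison:
  assumes disj: "\<And>i l k. k \<in> K \<Longrightarrow> P i k = 0 \<or> Q l k = 0"
    and H0: "\<And>i x. i \<in> I \<Longrightarrow> (\<Sum>k\<in>K. H x (P i k) \<bullet> P i k) = (\<Sum>k\<in>K. H x (Q i k) \<bullet> Q i k)"
    and cov: "\<And>i l x y. i \<in> I \<Longrightarrow> l \<in> I \<Longrightarrow>
       (\<Sum>k\<in>K. (D x \<bullet> P i k) * (D x \<bullet> P i k)) - (\<Sum>k\<in>K. (D x \<bullet> Q i k) * (D x \<bullet> Q i k))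
     \<le> (\<Sum>k\<in>K. (D y \<bullet> P l k) * (D x \<bullet> P i k)) - (\<Sum>k\<in>K. (D y \<bullet> Q l k) * (D x \<bullet> Q i k))"
  shows "(\<integral>x. ln (\<Sum>i\<in>I. exp (\<beta> * \<psi> (\<Sum>k\<in>K. x k *\<^sub>R P i k))) \<partial>gaussian_product K)
       \<le> (\<integral>x. ln (\<Sum>i\<in>I. exp (\<beta> * \<psi> (\<Sum>k\<in>K. x k *\<^sub>R Q i k))) \<partial>gaussian_product K)"
proof -
  let ?G = "gaussian_product K"
  interpret prob_space ?G by (rule prob_space_gaussian_product)
  \<comment> \<open>The angle runs from the \<open>Q\<close> side at 0 to the \<open>P\<close> side
    at pi / 2; on this range sin and cos are nonnegative.\<close>
  have "(\<integral>x. ln (Z (pi/2) x) \<partial>?G) \<le> (\<integral>x. ln (Z 0 x) \<partial>?G)"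
  proof (rule DERIV_nonpos_imp_nonincreasing[where f = "\<lambda>\<theta>. \<integral>x. ln (Z \<theta> x) \<partial>?G"])
    fix \<theta> :: real assume "0 \<le> \<theta>" "\<theta> \<le> pi / 2"
    note \<theta> = this
    have sc: "sin \<theta> * cos \<theta> \<ge> 0" using \<theta> by (intro mult_nonneg_nonneg sin_ge_zero cos_ge_zero) auto
    \<comment> \<open>\<open>T\<close> pairs the coefficients for l with the angular derivative of
      those for i. By \<open>disj\<close> only the pure \<open>P\<close> and pure \<open>Q\<close>
      products survive, both with the factor sin cos.\<close>
    define T where "T i l x y = (\<Sum>k\<in>K. (D y \<bullet> U \<theta> l k) * (D x \<bullet> U' \<theta> i k))" for i l x y
    have T: "T i l x y = sin \<theta> * cos \<theta> *
      ((\<Sum>k\<in>K. (D y \<bullet> P l k) * (D x \<bullet> P i k)) - (\<Sum>k\<in>K. (D y \<bullet> Q l k) * (D x \<bullet> Q i k)))" for i l x y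
      unfolding T_def sum_subtractf[symmetric] sum_distrib_left
    proof (rule sum.cong[OF refl])
      fix k assume k: "k \<in> K"
      then have "P l k = 0 \<or> Q i k = 0" "P i k = 0 \<or> Q l k = 0" using disj by auto
      then show "(D y \<bullet> U \<theta> l k) * (D x \<bullet> U' \<theta> i k) =
         sin \<theta> * cos \<theta> * ((D y \<bullet> P l k) * (D x \<bullet> P i k) - (D y \<bullet> Q l k) * (D x \<bullet> Q i k))"
        by (auto simp: U_def U'_def inner_right_distrib inner_diff_right algebra_simps)
    qed
    have Hzero: "(\<Sum>k\<in>K. H x (U \<theta> i k) \<bullet> U' \<theta> i k) = 0" if "i \<in> I" for i x
    proof -
      interpret Hx: linear "H x" using deriv_D by (rule has_derivative_linear)
      have "(\<Sum>k\<in>K. H x (U \<theta> i k) \<bullet> U' \<theta> i k)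
        = (\<Sum>k\<in>K. sin \<theta> * cos \<theta> * (H x (P i k) \<bullet> P i k - H x (Q i k) \<bullet> Q i k))"
      proof (rule sum.cong[OF refl])
        fix k assume k: "k \<in> K"
        then have "P i k = 0 \<or> Q i k = 0" using disj by auto
        then show "H x (U \<theta> i k) \<bullet> U' \<theta> i k = sin \<theta> * cos \<theta> * (H x (P i k) \<bullet> P i k - H x (Q i k) \<bullet> Q i k)"
          by (auto simp: U_def U'_def Hx.add Hx.scale Hx.zero inner_add_left inner_diff_right algebra_simps)
      qed
      also have "\<dots> = 0" using H0[OF that, of x] by (simp add: sum_distrib_left[symmetric] sum_subtractf)
      finally show ?thesis .
    qed
    have nonpos: "\<beta> * (\<Sum>k\<in>K. \<Phi>' \<theta> x k) \<le> 0" for x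
    proof -
      let ?u = "u \<theta> x" and ?p = "p \<theta> x"
      have "(\<Sum>k\<in>K. \<Phi>' \<theta> x k) = (\<Sum>i\<in>I. ?p i * (\<Sum>k\<in>K. H (?u i) (U \<theta> i k) \<bullet> U' \<theta> i k)
          + ?p i * \<beta> * (\<Sum>k\<in>K. (D (?u i) \<bullet> U \<theta> i k) * (D (?u i) \<bullet> U' \<theta> i k)
               - (\<Sum>l\<in>I. ?p l * ((D (?u l) \<bullet> U \<theta> l k) * (D (?u i) \<bullet> U' \<theta> i k)))))"
        unfolding \<Phi>'_def sum_distrib_left sum.distrib[symmetric]
        by (subst sum.swap) (intro sum.cong refl, simp add: sum_distrib_left sum_distrib_right algebra_simps)
      also have "\<dots> = (\<Sum>i\<in>I. ?p i * \<beta> * (T i i (?u i) (?u i) - (\<Sum>l\<in>I. ?p l * T i l (?u i) (?u l))))"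
      proof (rule sum.cong[OF refl])
        fix i assume i: "i \<in> I"
        have "(\<Sum>k\<in>K. \<Sum>l\<in>I. ?p l * ((D (?u l) \<bullet> U \<theta> l k) * (D (?u i) \<bullet> U' \<theta> i k))) = (\<Sum>l\<in>I. ?p l * T i l (?u i) (?u l))"
          unfolding T_def sum_distrib_left by (rule sum.swap)
        then show "?p i * (\<Sum>k\<in>K. H (?u i) (U \<theta> i k) \<bullet> U' \<theta> i k)
          + ?p i * \<beta> * (\<Sum>k\<in>K. (D (?u i) \<bullet> U \<theta> i k) * (D (?u i) \<bullet> U' \<theta> i k)
               - (\<Sum>l\<in>I. ?p l * ((D (?u l) \<bullet> U \<theta> l k) * (D (?u i) \<bullet> U' \<theta> i k))))
          = ?p i * \<beta> * (T i i (?u i) (?u i) - (\<Sum>l\<in>I. ?p l * T i l (?u i) (?u l)))"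
          using Hzero[OF i, of "?u i"] by (simp add: sum_subtractf T_def[of i i])
      qed
      also have "\<dots> = \<beta> * (\<Sum>i\<in>I. \<Sum>l\<in>I. ?p i * ?p l * (T i i (?u i) (?u i) - T i l (?u i) (?u l)))"
        unfolding sum_distrib_left
      proof (rule sum.cong[OF refl])
        fix i assume i: "i \<in> I"
        \<comment> \<open>The Gibbs weights sum to 1, which brings the diagonal term under the sum
          over l.\<close>
        have "(\<Sum>l\<in>I. ?p l * T i i (?u i) (?u i)) = T i i (?u i) (?u i)"
          by (simp add: sum_distrib_right[symmetric] sum_p)
        then have "T i i (?u i) (?u i) - (\<Sum>l\<in>I. ?p l * T i l (?u i) (?u l)) = (\<Sum>l\<in>I. ?p l * (T i i (?u i) (?u i) - T i l (?u i) (?u l)))"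
          by (simp add: right_diff_distrib sum_subtractf)
        then show "?p i * \<beta> * (T i i (?u i) (?u i) - (\<Sum>l\<in>I. ?p l * T i l (?u i) (?u l)))
          = (\<Sum>l\<in>I. \<beta> * (?p i * ?p l * (T i i (?u i) (?u i) - T i l (?u i) (?u l))))"
          by (simp only: sum_distrib_left) (simp only: mult_ac)
      qed
      finally have "\<beta> * (\<Sum>k\<in>K. \<Phi>' \<theta> x k) = \<beta> * \<beta> * (\<Sum>i\<in>I. \<Sum>l\<in>I. ?p i * ?p l * (T i i (?u i) (?u i) - T i l (?u i) (?u l)))"
        by simp
      also have "\<dots> \<le> 0"
      proof (rule mult_nonneg_nonpos)
        have "?p i * ?p l * (T i i (?u i) (?u i) - T i l (?u i) (?u l)) \<le> 0" if "i \<in> I" "l \<in> I" for i l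
        proof (rule mult_nonneg_nonpos)
          show "T i i (?u i) (?u i) - T i l (?u i) (?u l) \<le> 0"
            using mult_left_mono[OF cov[OF that, of "?u i" "?u l"] sc] by (simp add: T)
        qed (simp add: p_nonneg)
        then show "(\<Sum>i\<in>I. \<Sum>l\<in>I. ?p i * ?p l * (T i i (?u i) (?u i) - T i l (?u i) (?u l))) \<le> 0"
          by (intro sum_nonpos)
      qed simp
      finally show ?thesis .
    qed
    have "(\<integral>x. \<beta> * (\<Sum>k\<in>K. \<Phi>' \<theta> x k) \<partial>?G) \<le> 0"
      using Bochner_Integration.integral_nonneg[of ?G "\<lambda>x. - (\<beta> * (\<Sum>k\<in>K. \<Phi>' \<theta> x k))"] nonpos by simp
    then show "\<exists>y. ((\<lambda>\<theta>. \<integral>x. ln (Z \<theta> x) \<partial>?G) has_real_derivative y) (at \<theta>) \<and> y \<le> 0"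
      using expectation_ln_Z_deriv by blast
  qed simp
  then show ?thesis by (simp add: Z_def u_def U_def)
qed

end

section \<open>Soft maxima and smoothed norms\<close>

lemma (in prob_space) integrable_Max:
  fixes X :: "'i \<Rightarrow> 'a \<Rightarrow> real"
  assumes I: "finite I" "I \<noteq> {}" and X: "\<And>i. i \<in> I \<Longrightarrow> integrable M (X i)"
  shows "integrable M (\<lambda>w. MAX i\<in>I. X i w)"
proof (rule Bochner_Integration.integrable_bound)
  show "integrable M (\<lambda>w. \<Sum>i\<in>I. \<bar>X i w\<bar>)"
    using X by (intro Bochner_Integration.integrable_sum integrable_abs)
  note [measurable] = borel_measurable_integrable[OF X]
  show "(\<lambda>w. MAX i\<in>I. X i w) \<in> borel_measurable M"
    using I by (intro borel_measurable_Max) auto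
  show "AE w in M. norm (MAX i\<in>I. X i w) \<le> norm (\<Sum>i\<in>I. \<bar>X i w\<bar>)"
  proof (rule AE_I2)
    fix w
    have "(MAX i\<in>I. X i w) \<in> (\<lambda>i. X i w) ` I" using I by (intro Max_in) auto
    then obtain i where "i \<in> I" "(MAX i\<in>I. X i w) = X i w" by auto
    moreover then have "\<bar>X i w\<bar> \<le> (\<Sum>i\<in>I. \<bar>X i w\<bar>)" using I by (intro member_le_sum) auto
    ultimately show "norm (MAX i\<in>I. X i w) \<le> norm (\<Sum>i\<in>I. \<bar>X i w\<bar>)" by simp
  qed
qed

lemma Min_eq_uminus_Max:
  fixes X :: "'i \<Rightarrow> real"
  assumes "finite I" "I \<noteq> {}"
  shows "(MIN i\<in>I. X i) = - (MAX i\<in>I. - X i)"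
  using assms minus_Max_eq_Min[of "(\<lambda>i. - X i) ` I"] by (simp add: image_image)

lemma (in prob_space) integrable_Min:
  fixes X :: "'i \<Rightarrow> 'a \<Rightarrow> real"
  assumes I: "finite I" "I \<noteq> {}" and X: "\<And>i. i \<in> I \<Longrightarrow> integrable M (X i)"
  shows "integrable M (\<lambda>w. MIN i\<in>I. X i w)"
  unfolding Min_eq_uminus_Max[OF I]
  using integrable_Max[OF I, of "\<lambda>i w. - X i w"] X by simp

text \<open>The soft maximum divided by \<beta> exceeds the maximum by at most ln (card I) /
  \<beta>, which is arbitrarily small for large \<beta>.\<close>

lemma (in prob_space) expectation_Max_le_of_soft_max_le:
  fixes X Y :: "'i \<Rightarrow> 'a \<Rightarrow> real"
  assumes I: "finite I" "I \<noteq> {}"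
    and X: "\<And>i. i \<in> I \<Longrightarrow> integrable M (X i)" and Y: "\<And>i. i \<in> I \<Longrightarrow> integrable M (Y i)"
    and le: "\<And>\<beta>. \<beta> > 0 \<Longrightarrow> expectation (\<lambda>w. ln (\<Sum>i\<in>I. exp (\<beta> * X i w)))
                          \<le> expectation (\<lambda>w. ln (\<Sum>i\<in>I. exp (\<beta> * Y i w)))"
  shows "expectation (\<lambda>w. MAX i\<in>I. X i w) \<le> expectation (\<lambda>w. MAX i\<in>I. Y i w)"
proof (rule field_le_epsilon)
  fix \<delta> :: real assume \<delta>: "\<delta> > 0"
  have c: "ln (real (card I)) \<ge> 0" using I by (simp add: Suc_le_eq card_gt_0_iff)
  \<comment> \<open>Large enough for ln (card I) / \<beta> <= \<delta>; the added 1 keeps \<beta>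
    positive when there is only one index.\<close>
  define \<beta> where "\<beta> = (ln (real (card I)) + 1) / \<delta>"
  have \<beta>: "\<beta> > 0" "\<beta> * \<delta> = ln (real (card I)) + 1" using \<delta> c by (auto simp: \<beta>_def intro!: divide_pos_pos)
  have "\<beta> * expectation (\<lambda>w. MAX i\<in>I. X i w) = expectation (\<lambda>w. \<beta> * (MAX i\<in>I. X i w))" by simp
  also have "\<dots> \<le> expectation (\<lambda>w. ln (\<Sum>i\<in>I. exp (\<beta> * X i w)))"
  proof (intro integral_mono integrable_mult_right integrable_Max integrable_ln_sum_exp I X)
    fix w
    have "(MAX i\<in>I. X i w) \<in> (\<lambda>i. X i w) ` I" using I by (intro Max_in) auto
    then obtain i where i: "i \<in> I" "(MAX i\<in>I. X i w) = X i w" by auto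
    show "\<beta> * (MAX i\<in>I. X i w) \<le> ln (\<Sum>i\<in>I. exp (\<beta> * X i w))"
      unfolding i(2) using le_ln_sum_exp[OF I(1) i(1), of "\<lambda>i. \<beta> * X i w"] .
  qed
  also have "\<dots> \<le> expectation (\<lambda>w. ln (\<Sum>i\<in>I. exp (\<beta> * Y i w)))" by (rule le[OF \<beta>(1)])
  also have "\<dots> \<le> expectation (\<lambda>w. ln (card I) + \<beta> * (MAX i\<in>I. Y i w))"
    using \<beta> I by (intro integral_mono Bochner_Integration.integrable_add integrable_const integrable_mult_right
        integrable_Max integrable_ln_sum_exp Y ln_sum_exp_le mult_left_mono) auto
  also have "\<dots> = ln (card I) + \<beta> * expectation (\<lambda>w. MAX i\<in>I. Y i w)"
    using integrable_Max[OF I Y] by (simp add: prob_space)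
  finally have "\<beta> * expectation (\<lambda>w. MAX i\<in>I. X i w) \<le> \<beta> * (expectation (\<lambda>w. MAX i\<in>I. Y i w) + \<delta>)"
    using \<beta>(2) by (simp add: distrib_left)
  then show "expectation (\<lambda>w. MAX i\<in>I. X i w) \<le> expectation (\<lambda>w. MAX i\<in>I. Y i w) + \<delta>"
    using \<beta>(1) by simp
qed

text \<open>A soft maximum with a negative parameter is one of the negated variables with a positive
  parameter.\<close>

lemma (in prob_space) expectation_Min_ge_of_soft_max_le:
  fixes X Y :: "'i \<Rightarrow> 'a \<Rightarrow> real"
  assumes I: "finite I" "I \<noteq> {}"
    and X: "\<And>i. i \<in> I \<Longrightarrow> integrable M (X i)" and Y: "\<And>i. i \<in> I \<Longrightarrow> integrable M (Y i)"
    and le: "\<And>\<beta>. \<beta> < 0 \<Longrightarrow> expectation (\<lambda>w. ln (\<Sum>i\<in>I. exp (\<beta> * X i w)))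
                          \<le> expectation (\<lambda>w. ln (\<Sum>i\<in>I. exp (\<beta> * Y i w)))"
  shows "expectation (\<lambda>w. MIN i\<in>I. Y i w) \<le> expectation (\<lambda>w. MIN i\<in>I. X i w)"
proof -
  have "expectation (\<lambda>w. MAX i\<in>I. - X i w) \<le> expectation (\<lambda>w. MAX i\<in>I. - Y i w)"
    using X Y le[of "- \<beta>" for \<beta>] by (intro expectation_Max_le_of_soft_max_le I) auto
  then show ?thesis unfolding Min_eq_uminus_Max[OF I] by simp
qed

lemma sum_UNIV_Plus:
  "(\<Sum>k\<in>(UNIV::('a::finite + 'b::finite) set). f k) = (\<Sum>a\<in>UNIV. f (Inl a)) + (\<Sum>b\<in>UNIV. f (Inr b))"
  by (subst UNIV_Plus_UNIV[symmetric], subst sum.Plus) auto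

lemma sum_UNIV_Times:
  "(\<Sum>k\<in>(UNIV::('a::finite \<times> 'b::finite) set). f k) = (\<Sum>a\<in>UNIV. \<Sum>b\<in>UNIV. f (a, b))"
  by (simp add: sum.cartesian_product flip: UNIV_Times_UNIV)

section \<open>A smooth substitute for the Euclidean norm\<close>

definition smooth_norm :: "real \<Rightarrow> 'a::euclidean_space \<Rightarrow> real" where
  "smooth_norm \<delta> v = sqrt (v \<bullet> v + \<delta>\<^sup>2)"

context
  fixes \<delta> :: real
  assumes \<delta>: "\<delta> > 0"
begin

lemma smooth_norm_ge: "norm v \<le> smooth_norm \<delta> v" "\<delta> \<le> smooth_norm \<delta> v" "0 < smooth_norm \<delta> v"
proof -
  show "norm v \<le> smooth_norm \<delta> v" by (simp add: smooth_norm_def norm_eq_sqrt_inner)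
  show d: "\<delta> \<le> smooth_norm \<delta> v" unfolding smooth_norm_def by (rule real_le_rsqrt) simp
  show "0 < smooth_norm \<delta> v" using d \<delta> by linarith
qed

lemma smooth_norm_le: "smooth_norm \<delta> v \<le> norm v + \<delta>"
  using sqrt_add_le_add_sqrt[of "v \<bullet> v" "\<delta>\<^sup>2"] \<delta> by (simp add: smooth_norm_def norm_eq_sqrt_inner)

lemma smooth_norm_has_derivative:
  "(smooth_norm \<delta> has_derivative (\<lambda>h. (v /\<^sub>R smooth_norm \<delta> v) \<bullet> h)) (at v)"
proof -
  have pos: "v \<bullet> v + \<delta>\<^sup>2 > 0" using \<delta> by (simp add: add_nonneg_pos)
  have "((\<lambda>v. sqrt (v \<bullet> v + \<delta>\<^sup>2)) has_derivative (\<lambda>h. (v \<bullet> h + h \<bullet> v) * (inverse (sqrt (v \<bullet> v + \<delta>\<^sup>2)) / 2))) (at v)"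
    using pos by (auto intro!: derivative_eq_intros simp: field_simps)
  also have "(\<lambda>h. (v \<bullet> h + h \<bullet> v) * (inverse (sqrt (v \<bullet> v + \<delta>\<^sup>2)) / 2)) = (\<lambda>h. (v /\<^sub>R sqrt (v \<bullet> v + \<delta>\<^sup>2)) \<bullet> h)"
  proof
    fix h
    have "h \<bullet> v = v \<bullet> h" by (rule inner_commute)
    then show "(v \<bullet> h + h \<bullet> v) * (inverse (sqrt (v \<bullet> v + \<delta>\<^sup>2)) / 2) = (v /\<^sub>R sqrt (v \<bullet> v + \<delta>\<^sup>2)) \<bullet> h"
      by (simp only: inner_scaleR_left) simp
  qed
  finally show ?thesis unfolding smooth_norm_def[abs_def] .
qed

definition smooth_norm_hessian :: "'a::euclidean_space \<Rightarrow> 'a \<Rightarrow> 'a" where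
  "smooth_norm_hessian v h = h /\<^sub>R smooth_norm \<delta> v - ((v \<bullet> h) / smooth_norm \<delta> v ^ 3) *\<^sub>R v"

lemma smooth_norm_gradient_has_derivative:
  "((\<lambda>v. v /\<^sub>R smooth_norm \<delta> v) has_derivative smooth_norm_hessian v) (at v)"
proof -
  have pos: "smooth_norm \<delta> v > 0" by (rule smooth_norm_ge)
  have "((\<lambda>v. v /\<^sub>R smooth_norm \<delta> v) has_derivative
     (\<lambda>h. inverse (smooth_norm \<delta> v) *\<^sub>R h + (- (inverse (smooth_norm \<delta> v) * ((v /\<^sub>R smooth_norm \<delta> v) \<bullet> h) * inverse (smooth_norm \<delta> v))) *\<^sub>R v)) (at v)"
    using pos by (auto intro!: derivative_eq_intros smooth_norm_has_derivative)
  also have "(\<lambda>h. inverse (smooth_norm \<delta> v) *\<^sub>R h + (- (inverse (smooth_norm \<delta> v) * ((v /\<^sub>R smooth_norm \<delta> v) \<bullet> h) * inverse (smooth_norm \<delta> v))) *\<^sub>R v)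
     = smooth_norm_hessian v"
    by (auto simp: smooth_norm_hessian_def fun_eq_iff power3_eq_cube divide_inverse mult_ac)
  finally show ?thesis .
qed

lemma norm_smooth_norm_gradient_le: "norm (v /\<^sub>R smooth_norm \<delta> v) \<le> 1"
  using smooth_norm_ge[of v] by (simp add: divide_le_eq flip: divide_inverse_commute)

lemma continuous_smooth_norm: "continuous_on UNIV (smooth_norm \<delta>)"
  unfolding smooth_norm_def[abs_def] by (intro continuous_intros)

lemma continuous_smooth_norm_hessian: "continuous_on UNIV (\<lambda>v. smooth_norm_hessian v h)"
  unfolding smooth_norm_hessian_def
  by (intro continuous_intros continuous_smooth_norm) (use less_imp_neq[OF smooth_norm_ge(3)] in auto)

text \<open>Each of the two terms of the Hessian has norm at most |h| /
  \<open>smooth_norm \<delta> v\<close>, and the denominator is at least \<delta>. The bound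
  degenerates as \<delta> tends to 0, but it only has to be finite for each fixed \<delta>.\<close>

lemma norm_smooth_norm_hessian_le: "norm (smooth_norm_hessian v h) \<le> 2 / \<delta> * norm h"
proof -
  define \<phi> where "\<phi> = smooth_norm \<delta> v"
  have \<phi>: "\<phi> > 0" "\<delta> \<le> \<phi>" "norm v \<le> \<phi>" using smooth_norm_ge[of v] by (auto simp: \<phi>_def)
  have "norm (((v \<bullet> h) / \<phi> ^ 3) *\<^sub>R v) = \<bar>v \<bullet> h\<bar> * norm v / \<phi> ^ 3" using \<phi> by simp
  also have "\<dots> \<le> (norm v * norm h) * norm v / \<phi> ^ 3"
    using \<phi> by (intro divide_right_mono mult_right_mono Cauchy_Schwarz_ineq2) auto
  also have "\<dots> \<le> (\<phi> * norm h) * \<phi> / \<phi> ^ 3"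
    using \<phi> by (intro divide_right_mono mult_mono) auto
  also have "\<dots> = norm h / \<phi>" using \<phi> by (simp add: power3_eq_cube)
  finally have 1: "norm (((v \<bullet> h) / \<phi> ^ 3) *\<^sub>R v) \<le> norm h / \<phi>" .
  have "norm (smooth_norm_hessian v h) \<le> norm (h /\<^sub>R \<phi>) + norm (((v \<bullet> h) / \<phi> ^ 3) *\<^sub>R v)"
    unfolding smooth_norm_hessian_def \<phi>_def by (rule norm_triangle_ineq4)
  also have "\<dots> \<le> norm h / \<phi> + norm h / \<phi>" using 1 \<phi> by (simp add: divide_inverse_commute)
  also have "\<dots> \<le> norm h / \<delta> + norm h / \<delta>"
    using \<phi> \<delta> by (intro add_mono divide_left_mono) auto
  finally show ?thesis by simp
qed

end

section \<open>Extremal values of Gaussian matrices\<close>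

definition matrix_of :: "('m \<times> 'n \<Rightarrow> real) \<Rightarrow> real ^ 'n::finite ^ 'm::finite" where
  "matrix_of x = (\<chi> i j. x (i, j))"

lemma axis_scale: "axis i (c::real) = c *\<^sub>R axis i 1"
  by (simp add: vec_eq_iff axis_def)

text \<open>One Gaussian vector carries the entries of A on its \<open>Inl\<close> coordinates and
  g, h on its \<open>Inr\<close> coordinates. The interpolated vectors live in R^m x R, where
  \<open>P\<close> produces (A z, 0) and \<open>Q\<close> produces (g, <h, z>). Paired with
  gradients (n, 1) and (n', 1), the covariance is <n, n'> <z, w> for the first family and <n, n'> +
  <z, w> for the second.\<close>

lemma gordon_soft_max:
  fixes Z :: "(real ^ 'n::finite) set" and \<delta> \<beta> :: real
  assumes Z: "finite Z" "Z \<noteq> {}" "\<forall>z\<in>Z. norm z = 1" and \<delta>: "\<delta> > 0"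
  defines "G \<equiv> gaussian_product (UNIV :: (('m::finite \<times> 'n) + ('m + 'n)) set)"
  shows "(\<integral>x. ln (\<Sum>z\<in>Z. exp (\<beta> * smooth_norm \<delta> (matrix_of (\<lambda>p. x (Inl p)) *v z))) \<partial>G)
    \<le> (\<integral>x. ln (\<Sum>z\<in>Z. exp (\<beta> * (smooth_norm \<delta> (\<chi> i. x (Inr (Inl i))) + (\<chi> j. x (Inr (Inr j))) \<bullet> z))) \<partial>G)"
proof -
  define \<psi> :: "(real ^ 'm) \<times> real \<Rightarrow> real" where "\<psi> w = smooth_norm \<delta> (fst w) + snd w" for w
  define D :: "(real ^ 'm) \<times> real \<Rightarrow> (real ^ 'm) \<times> real" where "D w = (fst w /\<^sub>R smooth_norm \<delta> (fst w), 1)" for w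
  define H :: "(real ^ 'm) \<times> real \<Rightarrow> (real ^ 'm) \<times> real \<Rightarrow> (real ^ 'm) \<times> real"
    where "H w v = (smooth_norm_hessian \<delta> (fst w) (fst v), 0)" for w v
  define P :: "real ^ 'n \<Rightarrow> ('m \<times> 'n) + ('m + 'n) \<Rightarrow> (real ^ 'm) \<times> real"
    where "P z k = (case k of Inl (a, b) \<Rightarrow> (axis a (z $ b), 0) | Inr _ \<Rightarrow> 0)" for z k
  define Q :: "real ^ 'n \<Rightarrow> ('m \<times> 'n) + ('m + 'n) \<Rightarrow> (real ^ 'm) \<times> real"
    where "Q z k = (case k of Inl _ \<Rightarrow> 0 | Inr (Inl a) \<Rightarrow> (axis a 1, 0) | Inr (Inr b) \<Rightarrow> (0, z $ b))" for z k
  \<comment> \<open>The gradient bound 2 covers (n, 1) with |n| <= 1; the Hessian bound is that of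
    the smoothed norm.\<close>
  interpret gaussian_interpolation Z "UNIV :: (('m \<times> 'n) + ('m + 'n)) set" \<psi> D H \<beta> 2 "2 / \<delta>" P Q
  proof
    fix w :: "(real ^ 'm) \<times> real"
    have fst: "(fst has_derivative fst) (at w)" and snd: "(snd has_derivative snd) (at w)"
      by (auto intro: bounded_linear_imp_has_derivative bounded_linear_fst bounded_linear_snd)
    show "(\<psi> has_derivative (\<lambda>v. D w \<bullet> v)) (at w)"
      unfolding \<psi>_def[abs_def] D_def inner_prod_def
      using has_derivative_add[OF has_derivative_compose[OF fst smooth_norm_has_derivative[OF \<delta>]] snd]
      by simp
    show "(D has_derivative H w) (at w)"
      unfolding D_def[abs_def] H_def[abs_def]
      by (intro has_derivative_Pair has_derivative_compose[OF fst smooth_norm_gradient_has_derivative[OF \<delta>]] has_derivative_const)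
    show "continuous_on UNIV (\<lambda>x. H x v)" for v
      unfolding H_def
      by (intro continuous_intros continuous_on_compose2[OF continuous_smooth_norm_hessian[OF \<delta>]]) auto
    show "norm (D w) \<le> 2"
      using norm_Pair_le[of "fst w /\<^sub>R smooth_norm \<delta> (fst w)" "1::real"] norm_smooth_norm_gradient_le[OF \<delta>, of "fst w"]
      by (simp add: D_def)
    show "norm (H w v) \<le> 2 / \<delta> * norm v" for v
    proof -
      have "norm (H w v) \<le> 2 / \<delta> * norm (fst v)"
        using norm_smooth_norm_hessian_le[OF \<delta>, of "fst w" "fst v"] by (simp add: H_def norm_Pair)
      also have "\<dots> \<le> 2 / \<delta> * norm v" using \<delta> norm_fst_le[of "fst v" "snd v"] by (intro mult_left_mono) auto
      finally show ?thesis .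
    qed
  qed (use Z in auto)
  have P_sum: "(\<Sum>k\<in>UNIV. x k *\<^sub>R P z k) = (matrix_of (\<lambda>p. x (Inl p)) *v z, 0)" for x z
  proof -
    have "(\<Sum>k\<in>UNIV. x k *\<^sub>R P z k) = (\<Sum>a\<in>UNIV. \<Sum>b\<in>UNIV. (axis a (x (Inl (a, b)) * z $ b), 0))"
      unfolding sum_UNIV_Plus sum_UNIV_Times by (simp add: P_def axis_scale[of _ "_ * _"] axis_scale[of _ "_ $ _"])
    also have "\<dots> = (\<Sum>a\<in>UNIV. \<Sum>b\<in>UNIV. axis a (x (Inl (a, b)) * z $ b), 0)"
      by (simp add: prod_eq_iff fst_sum snd_sum)
    also have "(\<Sum>a\<in>UNIV. \<Sum>b\<in>UNIV. axis a (x (Inl (a, b)) * z $ b)) = matrix_of (\<lambda>p. x (Inl p)) *v z"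
      by (subst sum.swap)
         (simp add: vec_eq_iff matrix_of_def matrix_vector_mult_def sum_component axis_def if_distrib sum.delta' cong: if_cong)
    finally show ?thesis .
  qed
  have Q_sum: "(\<Sum>k\<in>UNIV. x k *\<^sub>R Q z k) = ((\<chi> i. x (Inr (Inl i))), (\<chi> j. x (Inr (Inr j))) \<bullet> z)" for x z
  proof -
    have "(\<Sum>k\<in>UNIV. x k *\<^sub>R Q z k) = (\<Sum>a\<in>UNIV. (axis a (x (Inr (Inl a))), 0)) + (\<Sum>b\<in>UNIV. (0, x (Inr (Inr b)) * z $ b))"
      unfolding sum_UNIV_Plus by (simp add: Q_def axis_scale[of _ "x _"])
    also have "\<dots> = (\<Sum>a\<in>UNIV. axis a (x (Inr (Inl a))), \<Sum>b\<in>UNIV. x (Inr (Inr b)) * z $ b)"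
      by (simp add: prod_eq_iff fst_sum snd_sum)
    also have "(\<Sum>a\<in>UNIV. axis a (x (Inr (Inl a)))) = (\<chi> i. x (Inr (Inl i)))"
      by (simp add: vec_eq_iff sum_component axis_def if_distrib sum.delta' cong: if_cong)
    finally show ?thesis by (simp add: inner_vec_def)
  qed
  have DP: "(\<Sum>k\<in>UNIV. (D y \<bullet> P l k) * (D x \<bullet> P i k)) = (fst (D y) \<bullet> fst (D x)) * (l \<bullet> i)" for x y l i
  proof -
    have "(\<Sum>k\<in>UNIV. (D y \<bullet> P l k) * (D x \<bullet> P i k))
        = (\<Sum>a\<in>UNIV. \<Sum>b\<in>UNIV. (fst (D y) $ a * fst (D x) $ a) * (l $ b * i $ b))"
      unfolding sum_UNIV_Plus sum_UNIV_Times by (simp add: P_def inner_prod_def inner_axis mult_ac)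
    also have "\<dots> = (\<Sum>a\<in>UNIV. fst (D y) $ a * fst (D x) $ a) * (\<Sum>b\<in>UNIV. l $ b * i $ b)"
      by (rule sum_product[symmetric])
    finally show ?thesis by (simp add: inner_vec_def)
  qed
  have DQ: "(\<Sum>k\<in>UNIV. (D y \<bullet> Q l k) * (D x \<bullet> Q i k)) = fst (D y) \<bullet> fst (D x) + l \<bullet> i" for x y l i
  proof -
    have "snd (D x) = 1" for x by (simp add: D_def)
    then have "(\<Sum>k\<in>UNIV. (D y \<bullet> Q l k) * (D x \<bullet> Q i k))
        = (\<Sum>a\<in>UNIV. fst (D y) $ a * fst (D x) $ a) + (\<Sum>b\<in>UNIV. l $ b * i $ b)"
      unfolding sum_UNIV_Plus by (simp add: Q_def inner_prod_def inner_axis)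
    then show ?thesis by (simp add: inner_vec_def)
  qed
  have n1: "norm (fst (D x)) \<le> 1" for x using norm_smooth_norm_gradient_le[OF \<delta>] by (simp add: D_def)
  have le1: "v \<bullet> w \<le> 1" if "norm v \<le> 1" "norm w \<le> 1" for v w :: "'z::euclidean_space"
    using norm_cauchy_schwarz[of v w] mult_mono[OF that] by simp
  have "(\<integral>x. ln (\<Sum>i\<in>Z. exp (\<beta> * \<psi> (\<Sum>k\<in>UNIV. x k *\<^sub>R P i k))) \<partial>G)
       \<le> (\<integral>x. ln (\<Sum>i\<in>Z. exp (\<beta> * \<psi> (\<Sum>k\<in>UNIV. x k *\<^sub>R Q i k))) \<partial>G)"
    unfolding G_def
  proof (rule comparison)
    show "P i k = 0 \<or> Q l k = 0" for i l k by (auto simp: P_def Q_def split: sum.split)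
    \<comment> \<open>Both sides are the trace of the Hessian of the smoothed norm: on the left
      every diagonal entry is weighted by |z|^2 = 1, on the right the scalar component has no second
      derivative.\<close>
    show "(\<Sum>k\<in>UNIV. H x (P i k) \<bullet> P i k) = (\<Sum>k\<in>UNIV. H x (Q i k) \<bullet> Q i k)" if "i \<in> Z" for i x
    proof -
      interpret h: linear "smooth_norm_hessian \<delta> (fst x)"
        using smooth_norm_gradient_has_derivative[OF \<delta>] by (rule has_derivative_linear)
      let ?h = "\<lambda>a. smooth_norm_hessian \<delta> (fst x) (axis a 1) \<bullet> axis a 1"
      have ii: "(\<Sum>b\<in>UNIV. i $ b * i $ b) = 1"
        using Z(3)[rule_format, OF that] by (simp add: norm_eq_1 inner_vec_def)
      have "(\<Sum>k\<in>UNIV. H x (P i k) \<bullet> P i k) = (\<Sum>a\<in>UNIV. \<Sum>b\<in>UNIV. ?h a * (i $ b * i $ b))"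
        unfolding sum_UNIV_Plus sum_UNIV_Times
        by (simp add: P_def H_def inner_prod_def axis_scale[of _ "i $ _"] h.scale mult_ac)
      also have "\<dots> = (\<Sum>a\<in>UNIV. ?h a)" by (simp add: sum_distrib_left[symmetric] ii)
      also have "\<dots> = (\<Sum>k\<in>UNIV. H x (Q i k) \<bullet> Q i k)"
        unfolding sum_UNIV_Plus by (simp add: Q_def H_def inner_prod_def)
      finally show ?thesis .
    qed
    show "(\<Sum>k\<in>UNIV. (D x \<bullet> P i k) * (D x \<bullet> P i k)) - (\<Sum>k\<in>UNIV. (D x \<bullet> Q i k) * (D x \<bullet> Q i k))
     \<le> (\<Sum>k\<in>UNIV. (D y \<bullet> P l k) * (D x \<bullet> P i k)) - (\<Sum>k\<in>UNIV. (D y \<bullet> Q l k) * (D x \<bullet> Q i k))"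
      if "i \<in> Z" "l \<in> Z" for i l x y
    proof -
      \<comment> \<open>Hence the left-hand side equals -1, and the claim is that a product of two
        nonnegative factors is nonnegative.\<close>
      have "i \<bullet> i = 1" using Z(3)[rule_format, OF that(1)] by (simp add: norm_eq_1)
      moreover have "fst (D y) \<bullet> fst (D x) \<le> 1" by (rule le1[OF n1 n1])
      moreover have "l \<bullet> i \<le> 1" using Z(3) that by (intro le1) auto
      moreover note mult_nonneg_nonneg[of "1 - fst (D y) \<bullet> fst (D x)" "1 - l \<bullet> i"]
      ultimately show ?thesis unfolding DP DQ by (simp add: algebra_simps)
    qed
  qed
  then show ?thesis unfolding P_sum Q_sum by (simp add: \<psi>_def)
qed

text \<open>Both processes are linear in the Gaussian coordinates and, since |e| = 1, have the same
  covariance <z, w>. With \<psi> the identity there is no Hessian term, and the covariance condition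
  holds with equality.\<close>

lemma gaussian_linear_form_soft_max:
  fixes Z :: "(real ^ 'n::finite) set" and e :: "real ^ 'm::finite" and \<beta> :: real
  assumes Z: "finite Z" "Z \<noteq> {}" and e: "norm e = 1"
  defines "G \<equiv> gaussian_product (UNIV :: (('m \<times> 'n) + 'n) set)"
  shows "(\<integral>x. ln (\<Sum>z\<in>Z. exp (\<beta> * ((matrix_of (\<lambda>p. x (Inl p)) *v z) \<bullet> e))) \<partial>G)
    \<le> (\<integral>x. ln (\<Sum>z\<in>Z. exp (\<beta> * ((\<chi> j. x (Inr j)) \<bullet> z))) \<partial>G)"
proof -
  define P :: "real ^ 'n \<Rightarrow> ('m \<times> 'n) + 'n \<Rightarrow> real"
    where "P z k = (case k of Inl (a, b) \<Rightarrow> e $ a * z $ b | Inr _ \<Rightarrow> 0)" for z k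
  define Q :: "real ^ 'n \<Rightarrow> ('m \<times> 'n) + 'n \<Rightarrow> real"
    where "Q z k = (case k of Inl _ \<Rightarrow> 0 | Inr b \<Rightarrow> z $ b)" for z k
  interpret gaussian_interpolation Z "UNIV :: (('m \<times> 'n) + 'n) set" "\<lambda>x. x" "\<lambda>_. 1" "\<lambda>_ _. 0" \<beta> 1 0 P Q
    by unfold_locales (use Z in auto)
  have P_sum: "(\<Sum>k\<in>UNIV. x k *\<^sub>R P z k) = (matrix_of (\<lambda>p. x (Inl p)) *v z) \<bullet> e" for x z
    unfolding sum_UNIV_Plus sum_UNIV_Times
    by (simp add: P_def inner_vec_def matrix_of_def matrix_vector_mult_def sum_distrib_left sum_distrib_right mult_ac)
  have Q_sum: "(\<Sum>k\<in>UNIV. x k *\<^sub>R Q z k) = (\<chi> j. x (Inr j)) \<bullet> z" for x z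
    unfolding sum_UNIV_Plus by (simp add: Q_def inner_vec_def)
  have ee: "(\<Sum>a\<in>UNIV. e $ a * e $ a) = 1" using e by (simp add: norm_eq_1 inner_vec_def)
  have PP: "(\<Sum>k\<in>UNIV. P l k * P i k) = (\<Sum>k\<in>UNIV. Q l k * Q i k)" for l i
  proof -
    have "(\<Sum>k\<in>UNIV. P l k * P i k) = (\<Sum>a\<in>UNIV. e $ a * e $ a) * (\<Sum>b\<in>UNIV. l $ b * i $ b)"
      unfolding sum_UNIV_Plus sum_UNIV_Times by (simp add: P_def sum_product mult_ac)
    also have "\<dots> = (\<Sum>k\<in>UNIV. Q l k * Q i k)"
      unfolding sum_UNIV_Plus by (simp add: Q_def ee)
    finally show ?thesis .
  qed
  have "(\<integral>x. ln (\<Sum>i\<in>Z. exp (\<beta> * (\<Sum>k\<in>UNIV. x k *\<^sub>R P i k))) \<partial>G)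
       \<le> (\<integral>x. ln (\<Sum>i\<in>Z. exp (\<beta> * (\<Sum>k\<in>UNIV. x k *\<^sub>R Q i k))) \<partial>G)"
    unfolding G_def
  proof (rule comparison)
    show "P i k = 0 \<or> Q l k = 0" for i l k by (auto simp: P_def Q_def split: sum.split)
  qed (auto simp: PP)
  then show ?thesis unfolding P_sum Q_sum .
qed

section \<open>Measurability, Lipschitz estimates and marginals\<close>

lemma measurable_vec_lambda:
  fixes f :: "'a \<Rightarrow> 'n::finite \<Rightarrow> 'b::euclidean_space"
  assumes "\<And>i. (\<lambda>x. f x i) \<in> borel_measurable M"
  shows "(\<lambda>x. \<chi> i. f x i) \<in> borel_measurable M"
proof (subst borel_measurable_euclidean_space, rule ballI)
  fix b :: "'b ^ 'n" assume "b \<in> Basis"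
  then obtain i u where "b = axis i u" by (auto simp: Basis_vec_def)
  then show "(\<lambda>x. (\<chi> i. f x i) \<bullet> b) \<in> borel_measurable M"
    using assms by (simp add: inner_axis)
qed

lemma measurable_vec_of [measurable]:
  "(\<lambda>x. \<chi> i. x (g i)) \<in> borel_measurable (gaussian_product (UNIV :: 'k::finite set))"
  by (rule measurable_vec_lambda) measurable

lemma measurable_matrix_of [measurable]:
  "(\<lambda>x. matrix_of (\<lambda>p. x (g p))) \<in> borel_measurable (gaussian_product (UNIV :: 'k::finite set))"
  unfolding matrix_of_def by (intro measurable_vec_lambda) measurable

lemma continuous_matrix_vector_mult: "continuous_on UNIV (\<lambda>A :: real ^ 'n::finite ^ 'm::finite. A *v z)"
  unfolding matrix_vector_mult_def
  by (intro continuous_on_vec_lambda continuous_on_sum continuous_intros)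

lemma measurable_matrix_vector_mult [measurable]:
  fixes A :: "'a \<Rightarrow> real ^ 'n::finite ^ 'm::finite"
  assumes "A \<in> borel_measurable M"
  shows "(\<lambda>x. A x *v z) \<in> borel_measurable M"
  using measurable_compose[OF assms borel_measurable_continuous_onI[OF continuous_matrix_vector_mult]] .

text \<open>\<open>norm A\<close> is the Frobenius norm, so this is the Cauchy-Schwarz inequality in
  every row.\<close>

lemma norm_matrix_vector_mult_le:
  fixes A :: "real ^ 'n::finite ^ 'm::finite"
  shows "norm (A *v z) \<le> norm A * norm z"
proof -
  have "norm (A *v z) \<le> L2_set (\<lambda>i. norm (A $ i) * norm z) UNIV"
    unfolding norm_vec_def[of "A *v z"]
    by (intro L2_set_mono) (auto simp: matrix_vector_mul_component Cauchy_Schwarz_ineq2)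
  also have "\<dots> = norm A * norm z"
    unfolding norm_vec_def[of A] by (rule L2_set_left_distrib[symmetric]) simp
  finally show ?thesis .
qed

text \<open>Links the norm of a matrix difference to the Euclidean distance of the coordinates, in
  which concentration measures Lipschitz constants.\<close>

lemma norm_matrix_of: "norm (matrix_of x) = sqrt (\<Sum>p\<in>UNIV. (x p)\<^sup>2)"
  unfolding norm_vec_def L2_set_def matrix_of_def sum_UNIV_Times by (simp add: sum_nonneg)

lemma norm_vec_of: "norm (\<chi> i. (x i :: real)) = sqrt (\<Sum>i\<in>UNIV. (x i)\<^sup>2)"
  unfolding norm_vec_def L2_set_def by simp

lemma matrix_of_diff: "matrix_of x - matrix_of y = matrix_of (\<lambda>p. x p - y p)"
  by (simp add: matrix_of_def vec_eq_iff)

text \<open>Such a function is dominated by its value at the origin plus a multiple of the sum of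
  the absolute coordinates.\<close>

lemma integrable_gaussian_lipschitz:
  fixes f :: "('k::finite \<Rightarrow> real) \<Rightarrow> real"
  assumes [measurable]: "f \<in> borel_measurable (gaussian_product UNIV)"
    and lip: "\<And>x y. f x - f y \<le> C * sqrt (\<Sum>i\<in>UNIV. (x i - y i)\<^sup>2)" and "C \<ge> 0"
  shows "integrable (gaussian_product UNIV) f"
proof (rule Bochner_Integration.integrable_bound)
  interpret prob_space "gaussian_product (UNIV::'k set)" by (rule prob_space_gaussian_product)
  show "integrable (gaussian_product UNIV) (\<lambda>x. \<bar>f (\<lambda>_. 0)\<bar> + C * (\<Sum>i\<in>(UNIV::'k set). \<bar>x i\<bar>))"
    by (intro Bochner_Integration.integrable_add Bochner_Integration.integrable_sum integrable_mult_right
        integrable_abs integrable_gaussian_component integrable_const) auto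
  show "AE x in gaussian_product UNIV. norm (f x) \<le> norm (\<bar>f (\<lambda>_. 0)\<bar> + C * (\<Sum>i\<in>UNIV. \<bar>x i\<bar>))"
  proof (rule AE_I2)
    fix x :: "'k \<Rightarrow> real"
    have "sqrt (\<Sum>i\<in>UNIV. (x i)\<^sup>2) \<le> (\<Sum>i\<in>UNIV. \<bar>x i\<bar>)"
      using L2_set_le_sum_abs[of x UNIV] by (simp add: L2_set_def)
    then have "C * sqrt (\<Sum>i\<in>UNIV. (x i)\<^sup>2) \<le> C * (\<Sum>i\<in>UNIV. \<bar>x i\<bar>)"
      using assms(3) by (rule mult_left_mono)
    then show "norm (f x) \<le> norm (\<bar>f (\<lambda>_. 0)\<bar> + C * (\<Sum>i\<in>UNIV. \<bar>x i\<bar>))"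
      using lip[of x "\<lambda>_. 0"] lip[of "\<lambda>_. 0" x] by simp
  qed
qed simp

text \<open>Distinct coordinates of a Gaussian product again form a Gaussian product. This takes
  statements about the joint vector (A, g, h) back to A, g or h alone.\<close>

lemma gaussian_marginal:
  fixes F :: "('j::finite \<Rightarrow> real) \<Rightarrow> real" and g :: "'j \<Rightarrow> 'k::finite"
  assumes g: "inj g" and [measurable]: "F \<in> borel_measurable (gaussian_product UNIV)"
  shows "(\<integral>x. F (\<lambda>j. x (g j)) \<partial>gaussian_product UNIV) = (\<integral>x. F x \<partial>gaussian_product UNIV)"
    and "integrable (gaussian_product UNIV) (\<lambda>x. F (\<lambda>j. x (g j))) \<longleftrightarrow> integrable (gaussian_product UNIV) F"
proof -
  have d: "distr (gaussian_product UNIV) (gaussian_product UNIV) (\<lambda>x j. x (g j)) = gaussian_product UNIV"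
    using distr_PiM_reindex[of UNIV "\<lambda>_. std_normal_distribution" g UNIV] g
    by (simp add: prob_space_normal_density restrict_UNIV)
  have [measurable]: "(\<lambda>x j. x (g j)) \<in> measurable (gaussian_product UNIV) (gaussian_product UNIV)"
    by (rule measurable_PiM_single') auto
  show "(\<integral>x. F (\<lambda>j. x (g j)) \<partial>gaussian_product UNIV) = (\<integral>x. F x \<partial>gaussian_product UNIV)"
    by (subst d[symmetric], subst integral_distr) auto
  show "integrable (gaussian_product UNIV) (\<lambda>x. F (\<lambda>j. x (g j))) \<longleftrightarrow> integrable (gaussian_product UNIV) F"
    using integrable_distr_eq[of "\<lambda>x j. x (g j)" "gaussian_product UNIV" "gaussian_product UNIV" F]
    unfolding d by simp
qed

lemma Max_diff_le:
  fixes f g :: "'a \<Rightarrow> real"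
  assumes "finite Z" "Z \<noteq> {}" "\<And>z. z \<in> Z \<Longrightarrow> f z - g z \<le> d"
  shows "(MAX z\<in>Z. f z) - (MAX z\<in>Z. g z) \<le> d"
proof -
  have "(MAX z\<in>Z. f z) \<in> f ` Z" using assms by (intro Max_in) auto
  then obtain z where z: "z \<in> Z" "(MAX z\<in>Z. f z) = f z" by auto
  have "g z \<le> (MAX z\<in>Z. g z)" using z assms by (intro Max_ge) auto
  then show ?thesis using assms(3)[OF z(1)] z(2) by linarith
qed

lemma Min_diff_le:
  fixes f g :: "'a \<Rightarrow> real"
  assumes "finite Z" "Z \<noteq> {}" "\<And>z. z \<in> Z \<Longrightarrow> f z - g z \<le> d"
  shows "(MIN z\<in>Z. f z) - (MIN z\<in>Z. g z) \<le> d"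
  unfolding Min_eq_uminus_Max[OF assms(1,2)]
  using Max_diff_le[OF assms(1,2), of "\<lambda>z. - g z" "\<lambda>z. - f z" d] assms(3) by (simp add: algebra_simps)

context
  fixes Z :: "(real ^ 'n::finite) set"
  assumes Z: "finite Z" "Z \<noteq> {}" and norm_Z: "\<forall>z\<in>Z. norm z = 1"
begin

lemma norm_matrix_of_mult_diff:
  assumes "z \<in> Z"
  shows "norm (matrix_of x *v z :: real ^ 'm::finite) - norm (matrix_of y *v z :: real ^ 'm) \<le> sqrt (\<Sum>p\<in>UNIV. (x p - y p)\<^sup>2)"
proof -
  have "norm (matrix_of x *v z :: real ^ 'm) - norm (matrix_of y *v z :: real ^ 'm) \<le> norm (matrix_of x *v z - matrix_of y *v z :: real ^ 'm)"
    by (rule norm_triangle_ineq2)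
  also have "matrix_of x *v z - matrix_of y *v z = matrix_of (\<lambda>p. x p - y p) *v z"
    by (simp only: matrix_vector_mult_diff_rdistrib[symmetric] matrix_of_diff)
  also have "norm (matrix_of (\<lambda>p. x p - y p) *v z :: real ^ 'm) \<le> sqrt (\<Sum>p\<in>UNIV. (x p - y p)\<^sup>2)"
    using norm_matrix_vector_mult_le[of "matrix_of (\<lambda>p. x p - y p) :: real ^ 'n ^ 'm" z] norm_Z[rule_format, OF assms]
    by (simp add: norm_matrix_of)
  finally show ?thesis .
qed

lemma matrix_of_inner_diff:
  assumes "z \<in> Z" "norm e = 1"
  shows "(matrix_of x *v z) \<bullet> e - (matrix_of y *v z) \<bullet> e \<le> sqrt (\<Sum>p\<in>UNIV. (x p - y p)\<^sup>2)"
proof -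
  have "(matrix_of x *v z) \<bullet> e - (matrix_of y *v z) \<bullet> e = (matrix_of (\<lambda>p. x p - y p) *v z) \<bullet> e"
    by (simp only: matrix_vector_mult_diff_rdistrib[symmetric] matrix_of_diff inner_diff_left[symmetric])
  also have "\<dots> \<le> norm (matrix_of (\<lambda>p. x p - y p) *v z) * norm e" by (rule norm_cauchy_schwarz)
  also have "\<dots> \<le> sqrt (\<Sum>p\<in>UNIV. (x p - y p)\<^sup>2)"
    using norm_matrix_vector_mult_le[of "matrix_of (\<lambda>p. x p - y p)" z] norm_Z[rule_format, OF assms(1)] assms(2)
    by (simp add: norm_matrix_of)
  finally show ?thesis .
qed

lemma vec_of_inner_diff:
  assumes "norm z = 1"
  shows "(\<chi> i. x i) \<bullet> z - (\<chi> i. y i) \<bullet> z \<le> sqrt (\<Sum>p\<in>UNIV. (x p - y p)\<^sup>2)"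
proof -
  have "(\<chi> i. x i) \<bullet> z - (\<chi> i. y i) \<bullet> z = (\<chi> i. x i - y i) \<bullet> z"
    by (simp add: inner_vec_def sum_subtractf left_diff_distrib)
  also have "\<dots> \<le> norm (\<chi> i. x i - y i) * norm z" by (rule norm_cauchy_schwarz)
  finally show ?thesis using assms by (simp add: norm_vec_of)
qed

lemma integrable_finite_processes:
  assumes "z \<in> Z"
  shows "integrable (gaussian_product UNIV) (\<lambda>x. norm (matrix_of x *v z :: real ^ 'm::finite))"
    and "norm e = 1 \<Longrightarrow> integrable (gaussian_product UNIV) (\<lambda>x. (matrix_of x *v z :: real ^ 'm) \<bullet> e)"
    and "integrable (gaussian_product UNIV) (\<lambda>x. (\<chi> i. x i) \<bullet> z)"
    and "integrable (gaussian_product UNIV) (\<lambda>x. norm (\<chi> i. x i :: real ^ 'm))"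
proof -
  have [measurable]: "(\<lambda>x. matrix_of x :: real ^ 'n ^ 'm) \<in> borel_measurable (gaussian_product UNIV)"
    using measurable_matrix_of[of "\<lambda>p. p"] .
  show "integrable (gaussian_product UNIV) (\<lambda>x. norm (matrix_of x *v z :: real ^ 'm))"
    by (rule integrable_gaussian_lipschitz[of _ 1]) (use norm_matrix_of_mult_diff[OF assms] in auto)
  show "integrable (gaussian_product UNIV) (\<lambda>x. (matrix_of x *v z :: real ^ 'm) \<bullet> e)" if "norm e = 1"
    by (rule integrable_gaussian_lipschitz[of _ 1]) (use matrix_of_inner_diff[OF assms that] in auto)
  show "integrable (gaussian_product UNIV) (\<lambda>x. (\<chi> i. x i) \<bullet> z)"
    by (rule integrable_gaussian_lipschitz[of _ 1]) (use vec_of_inner_diff norm_Z[rule_format, OF assms] in auto)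
  show "integrable (gaussian_product UNIV) (\<lambda>x. norm (\<chi> i. x i :: real ^ 'm))"
  proof (rule integrable_gaussian_lipschitz[of _ 1])
    fix x y :: "'m \<Rightarrow> real"
    have "norm (\<chi> i. x i :: real ^ 'm) - norm (\<chi> i. y i :: real ^ 'm) \<le> norm ((\<chi> i. x i) - (\<chi> i. y i) :: real ^ 'm)"
      by (rule norm_triangle_ineq2)
    also have "(\<chi> i. x i) - (\<chi> i. y i) = (\<chi> i. x i - y i :: real ^ 'm)" by (simp add: vec_eq_iff)
    finally show "norm (\<chi> i. x i :: real ^ 'm) - norm (\<chi> i. y i :: real ^ 'm) \<le> 1 * sqrt (\<Sum>i\<in>UNIV. (x i - y i)\<^sup>2)"
      by (simp add: norm_vec_of)
  qed auto
qed

end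

lemma integrable_smooth_norm:
  assumes "\<delta> > 0" "integrable M (\<lambda>x. norm (f x :: 'b::euclidean_space))" "f \<in> borel_measurable M" "prob_space M"
  shows "integrable M (\<lambda>x. smooth_norm \<delta> (f x))"
proof (rule Bochner_Integration.integrable_bound)
  interpret prob_space M by fact
  show "integrable M (\<lambda>x. norm (f x) + \<delta>)" using assms by simp
  show "(\<lambda>x. smooth_norm \<delta> (f x)) \<in> borel_measurable M"
    using measurable_compose[OF assms(3) borel_measurable_continuous_onI[OF continuous_smooth_norm[OF assms(1)]]] .
  show "AE x in M. norm (smooth_norm \<delta> (f x)) \<le> norm (norm (f x) + \<delta>)"
  proof (rule AE_I2)
    fix x
    show "norm (smooth_norm \<delta> (f x)) \<le> norm (norm (f x) + \<delta>)"
      using smooth_norm_le[OF assms(1), of "f x"] smooth_norm_ge(3)[OF assms(1), of "f x"] by simp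
  qed
qed

section \<open>The inequalities of Chevet and Gordon\<close>

context
  fixes Z :: "(real ^ 'n::finite) set"
  assumes Z: "finite Z" "Z \<noteq> {}" and norm_Z: "\<forall>z\<in>Z. norm z = 1"
begin

lemma gordon_marginals:
  fixes G :: "('m::finite \<times> 'n + ('m + 'n) \<Rightarrow> real) measure"
  defines "G \<equiv> gaussian_product UNIV"
  shows "z \<in> Z \<Longrightarrow> integrable G (\<lambda>x. norm (matrix_of (\<lambda>p. x (Inl p)) *v z :: real ^ 'm))"
    and "z \<in> Z \<Longrightarrow> integrable G (\<lambda>x. (\<chi> j. x (Inr (Inr j))) \<bullet> z)"
    and "integrable G (\<lambda>x. norm (\<chi> i. x (Inr (Inl i)) :: real ^ 'm))"
    and "(\<integral>x. (MAX z\<in>Z. norm (matrix_of (\<lambda>p. x (Inl p)) *v z :: real ^ 'm)) \<partial>G)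
          = (\<integral>x. (MAX z\<in>Z. norm (matrix_of x *v z :: real ^ 'm)) \<partial>gaussian_product UNIV)"
    and "(\<integral>x. (MIN z\<in>Z. norm (matrix_of (\<lambda>p. x (Inl p)) *v z :: real ^ 'm)) \<partial>G)
          = (\<integral>x. (MIN z\<in>Z. norm (matrix_of x *v z :: real ^ 'm)) \<partial>gaussian_product UNIV)"
    and "(\<integral>x. (MAX z\<in>Z. (\<chi> j. x (Inr (Inr j))) \<bullet> z) \<partial>G) = (\<integral>x. (MAX z\<in>Z. (\<chi> j. x j) \<bullet> z) \<partial>gaussian_product UNIV)"
    and "(\<integral>x. (MIN z\<in>Z. (\<chi> j. x (Inr (Inr j))) \<bullet> z) \<partial>G) = (\<integral>x. (MIN z\<in>Z. (\<chi> j. x j) \<bullet> z) \<partial>gaussian_product UNIV)"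
    and "(\<integral>x. norm (\<chi> i. x (Inr (Inl i)) :: real ^ 'm) \<partial>G) = (\<integral>x. norm (\<chi> i. x i :: real ^ 'm) \<partial>gaussian_product UNIV)"
proof -
  obtain z0 where z0: "z0 \<in> Z" using Z by auto
  note int = integrable_finite_processes[OF Z norm_Z]
  have rr: "inj (\<lambda>j. Inr (Inr j) :: 'm \<times> 'n + ('m + 'n))" "inj (\<lambda>j. Inr (Inl j) :: 'm \<times> 'n + ('m + 'n))"
    and l: "inj (\<lambda>p. Inl p :: 'm \<times> 'n + ('m + 'n))"
    by (auto simp: inj_def)
  have M1: "integrable (gaussian_product UNIV) (\<lambda>x. MAX z\<in>Z. norm (matrix_of x *v z :: real ^ 'm))"
    and M2: "integrable (gaussian_product UNIV) (\<lambda>x. MIN z\<in>Z. norm (matrix_of x *v z :: real ^ 'm))"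
    and M3: "integrable (gaussian_product UNIV) (\<lambda>x. MAX z\<in>Z. (\<chi> j. x j) \<bullet> z)"
    and M4: "integrable (gaussian_product UNIV) (\<lambda>x. MIN z\<in>Z. (\<chi> j. x j) \<bullet> z)"
    by (intro prob_space.integrable_Max prob_space.integrable_Min prob_space_gaussian_product Z int; assumption)+
  note meas = borel_measurable_integrable
  show "integrable G (\<lambda>x. norm (matrix_of (\<lambda>p. x (Inl p)) *v z :: real ^ 'm))" if "z \<in> Z"
    using gaussian_marginal(2)[OF l meas[OF int(1)[OF that]]] int(1)[OF that] by (simp add: G_def)
  show "integrable G (\<lambda>x. (\<chi> j. x (Inr (Inr j))) \<bullet> z)" if "z \<in> Z"
    using gaussian_marginal(2)[OF rr(1) meas[OF int(3)[OF that]]] int(3)[OF that] by (simp add: G_def)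
  show "integrable G (\<lambda>x. norm (\<chi> i. x (Inr (Inl i)) :: real ^ 'm))"
    using gaussian_marginal(2)[OF rr(2) meas[OF int(4)[OF z0]]] int(4)[OF z0] by (simp add: G_def)
  show "(\<integral>x. (MAX z\<in>Z. norm (matrix_of (\<lambda>p. x (Inl p)) *v z :: real ^ 'm)) \<partial>G)
          = (\<integral>x. (MAX z\<in>Z. norm (matrix_of x *v z :: real ^ 'm)) \<partial>gaussian_product UNIV)"
    unfolding G_def by (rule gaussian_marginal(1)[OF l meas[OF M1]])
  show "(\<integral>x. (MIN z\<in>Z. norm (matrix_of (\<lambda>p. x (Inl p)) *v z :: real ^ 'm)) \<partial>G)
          = (\<integral>x. (MIN z\<in>Z. norm (matrix_of x *v z :: real ^ 'm)) \<partial>gaussian_product UNIV)"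
    unfolding G_def by (rule gaussian_marginal(1)[OF l meas[OF M2]])
  show "(\<integral>x. (MAX z\<in>Z. (\<chi> j. x (Inr (Inr j))) \<bullet> z) \<partial>G) = (\<integral>x. (MAX z\<in>Z. (\<chi> j. x j) \<bullet> z) \<partial>gaussian_product UNIV)"
    unfolding G_def by (rule gaussian_marginal(1)[OF rr(1) meas[OF M3]])
  show "(\<integral>x. (MIN z\<in>Z. (\<chi> j. x (Inr (Inr j))) \<bullet> z) \<partial>G) = (\<integral>x. (MIN z\<in>Z. (\<chi> j. x j) \<bullet> z) \<partial>gaussian_product UNIV)"
    unfolding G_def by (rule gaussian_marginal(1)[OF rr(1) meas[OF M4]])
  show "(\<integral>x. norm (\<chi> i. x (Inr (Inl i)) :: real ^ 'm) \<partial>G) = (\<integral>x. norm (\<chi> i. x i :: real ^ 'm) \<partial>gaussian_product UNIV)"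
    unfolding G_def by (rule gaussian_marginal(1)[OF rr(2) meas[OF int(4)[OF z0]]])
qed

text \<open>Both come from \<open>gordon_soft_max\<close>, Chevet's inequality with positive and
  Gordon's with negative \<beta>. Replacing the norm by the smoothed norm costs at most \<delta> on
  either side, and \<delta> is arbitrary.\<close>

lemma chevet:
  "(\<integral>x. (MAX z\<in>Z. norm (matrix_of x *v z :: real ^ 'm::finite)) \<partial>gaussian_product UNIV)
    \<le> (\<integral>x. norm (\<chi> i. x i :: real ^ 'm) \<partial>gaussian_product UNIV) + (\<integral>x. (MAX z\<in>Z. (\<chi> j. x j) \<bullet> z) \<partial>gaussian_product UNIV)"
  and gordon:
  "(\<integral>x. norm (\<chi> i. x i :: real ^ 'm) \<partial>gaussian_product UNIV) + (\<integral>x. (MIN z\<in>Z. (\<chi> j. x j) \<bullet> z) \<partial>gaussian_product UNIV)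
    \<le> (\<integral>x. (MIN z\<in>Z. norm (matrix_of x *v z :: real ^ 'm)) \<partial>gaussian_product UNIV)"
proof -
  define G :: "('m \<times> 'n + ('m + 'n) \<Rightarrow> real) measure" where "G = gaussian_product UNIV"
  interpret prob_space G unfolding G_def by (rule prob_space_gaussian_product)
  let ?A = "\<lambda>x. matrix_of (\<lambda>p. x (Inl p)) :: real ^ 'n ^ 'm" and ?g = "\<lambda>x. (\<chi> i. x (Inr (Inl i))) :: real ^ 'm"
    and ?h = "\<lambda>x. (\<chi> j. x (Inr (Inr j))) :: real ^ 'n"
  note marg = gordon_marginals[where ?'m = 'm, folded G_def]
  have [measurable]: "?A \<in> borel_measurable G" "?g \<in> borel_measurable G" "?h \<in> borel_measurable G"
    unfolding G_def by measurable
  have "expectation (\<lambda>x. MAX z\<in>Z. norm (?A x *v z)) \<le> expectation (\<lambda>x. norm (?g x)) + expectation (\<lambda>x. MAX z\<in>Z. ?h x \<bullet> z) + \<delta>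
    \<and> expectation (\<lambda>x. norm (?g x)) + expectation (\<lambda>x. MIN z\<in>Z. ?h x \<bullet> z) \<le> expectation (\<lambda>x. MIN z\<in>Z. norm (?A x *v z)) + \<delta>"
    if \<delta>: "\<delta> > 0" for \<delta>
  proof -
    let ?X = "\<lambda>z x. smooth_norm \<delta> (?A x *v z)" and ?Y = "\<lambda>z x. smooth_norm \<delta> (?g x) + ?h x \<bullet> z"
    have X: "integrable G (?X z)" if "z \<in> Z" for z
      by (rule integrable_smooth_norm[OF \<delta> marg(1)[OF that]]) (unfold_locales, measurable)
    have g: "integrable G (\<lambda>x. smooth_norm \<delta> (?g x))"
      by (rule integrable_smooth_norm[OF \<delta> marg(3)]) (unfold_locales, measurable)
    have Y: "integrable G (?Y z)" if "z \<in> Z" for z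
      using g marg(2)[OF that] by simp
    have soft: "expectation (\<lambda>x. ln (\<Sum>z\<in>Z. exp (\<beta> * ?X z x))) \<le> expectation (\<lambda>x. ln (\<Sum>z\<in>Z. exp (\<beta> * ?Y z x)))" for \<beta>
      using gordon_soft_max[OF Z norm_Z \<delta>, where ?'m = 'm, of \<beta>] by (simp add: G_def)
    have "expectation (\<lambda>x. MAX z\<in>Z. norm (?A x *v z)) \<le> expectation (\<lambda>x. MAX z\<in>Z. ?X z x)"
    proof (intro integral_mono integrable_Max Z X marg(1))
      show "(MAX z\<in>Z. norm (?A x *v z)) \<le> (MAX z\<in>Z. ?X z x)" for x
      proof -
        have "(MAX z\<in>Z. norm (?A x *v z)) - (MAX z\<in>Z. ?X z x) \<le> 0"
          by (intro Max_diff_le Z) (simp add: smooth_norm_ge(1)[OF \<delta>])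
        then show ?thesis by simp
      qed
    qed
    also have "\<dots> \<le> expectation (\<lambda>x. MAX z\<in>Z. ?Y z x)"
      by (rule expectation_Max_le_of_soft_max_le[OF Z X Y soft])
    also have "\<dots> \<le> expectation (\<lambda>x. (norm (?g x) + \<delta>) + (MAX z\<in>Z. ?h x \<bullet> z))"
    proof (intro integral_mono integrable_Max Z Y Bochner_Integration.integrable_add marg(2,3) integrable_const)
      show "(MAX z\<in>Z. ?Y z x) \<le> (norm (?g x) + \<delta>) + (MAX z\<in>Z. ?h x \<bullet> z)" for x
      proof -
        have "(MAX z\<in>Z. ?Y z x) - (MAX z\<in>Z. ?h x \<bullet> z) \<le> norm (?g x) + \<delta>"
          by (intro Max_diff_le Z) (simp add: smooth_norm_le[OF \<delta>])
        then show ?thesis by simp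
      qed
    qed
    also have "\<dots> = expectation (\<lambda>x. norm (?g x)) + \<delta> + expectation (\<lambda>x. MAX z\<in>Z. ?h x \<bullet> z)"
      using marg(3) integrable_Max[OF Z marg(2)] by (simp add: prob_space)
    finally have 1: "expectation (\<lambda>x. MAX z\<in>Z. norm (?A x *v z)) \<le> \<dots>" .
    have "expectation (\<lambda>x. norm (?g x)) + expectation (\<lambda>x. MIN z\<in>Z. ?h x \<bullet> z) = expectation (\<lambda>x. norm (?g x) + (MIN z\<in>Z. ?h x \<bullet> z))"
      using marg(3) integrable_Min[OF Z marg(2)] by simp
    also have "\<dots> \<le> expectation (\<lambda>x. MIN z\<in>Z. ?Y z x)"
    proof (intro integral_mono integrable_Min Z Y Bochner_Integration.integrable_add marg(2,3))
      show "norm (?g x) + (MIN z\<in>Z. ?h x \<bullet> z) \<le> (MIN z\<in>Z. ?Y z x)" for x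
      proof -
        have "(MIN z\<in>Z. ?h x \<bullet> z) - (MIN z\<in>Z. ?Y z x) \<le> - norm (?g x)"
          by (intro Min_diff_le Z) (simp add: smooth_norm_ge(1)[OF \<delta>])
        then show ?thesis by simp
      qed
    qed
    also have "\<dots> \<le> expectation (\<lambda>x. MIN z\<in>Z. ?X z x)"
      by (rule expectation_Min_ge_of_soft_max_le[OF Z X Y soft])
    also have "\<dots> \<le> expectation (\<lambda>x. (MIN z\<in>Z. norm (?A x *v z)) + \<delta>)"
    proof (intro integral_mono integrable_Min Z X Bochner_Integration.integrable_add marg(1) integrable_const)
      show "(MIN z\<in>Z. ?X z x) \<le> (MIN z\<in>Z. norm (?A x *v z)) + \<delta>" for x
      proof -
        have "(MIN z\<in>Z. ?X z x) - (MIN z\<in>Z. norm (?A x *v z)) \<le> \<delta>"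
          by (intro Min_diff_le Z) (use smooth_norm_le[OF \<delta>] in \<open>simp add: algebra_simps\<close>)
        then show ?thesis by simp
      qed
    qed
    also have "\<dots> = expectation (\<lambda>x. MIN z\<in>Z. norm (?A x *v z)) + \<delta>"
      using integrable_Min[OF Z marg(1)] by (simp add: prob_space)
    finally show ?thesis using 1 by simp
  qed
  then have "expectation (\<lambda>x. MAX z\<in>Z. norm (?A x *v z)) \<le> expectation (\<lambda>x. norm (?g x)) + expectation (\<lambda>x. MAX z\<in>Z. ?h x \<bullet> z)"
    "expectation (\<lambda>x. norm (?g x)) + expectation (\<lambda>x. MIN z\<in>Z. ?h x \<bullet> z) \<le> expectation (\<lambda>x. MIN z\<in>Z. norm (?A x *v z))"
    by (auto intro: field_le_epsilon)
  then show "(\<integral>x. (MAX z\<in>Z. norm (matrix_of x *v z :: real ^ 'm)) \<partial>gaussian_product UNIV)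
      \<le> (\<integral>x. norm (\<chi> i. x i :: real ^ 'm) \<partial>gaussian_product UNIV) + (\<integral>x. (MAX z\<in>Z. (\<chi> j. x j) \<bullet> z) \<partial>gaussian_product UNIV)"
    "(\<integral>x. norm (\<chi> i. x i :: real ^ 'm) \<partial>gaussian_product UNIV) + (\<integral>x. (MIN z\<in>Z. (\<chi> j. x j) \<bullet> z) \<partial>gaussian_product UNIV)
      \<le> (\<integral>x. (MIN z\<in>Z. norm (matrix_of x *v z :: real ^ 'm)) \<partial>gaussian_product UNIV)"
    by (simp_all only: marg(4-8))
qed

lemma expectation_Max_linear_form_le:
  fixes e :: "real ^ 'm::finite"
  assumes e: "norm e = 1"
  shows "(\<integral>x. (MAX z\<in>Z. (matrix_of x *v z) \<bullet> e) \<partial>gaussian_product UNIV)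
    \<le> (\<integral>x. (MAX z\<in>Z. (\<chi> j. x j) \<bullet> z) \<partial>gaussian_product UNIV)"
proof -
  define G :: "('m \<times> 'n + 'n \<Rightarrow> real) measure" where "G = gaussian_product UNIV"
  interpret prob_space G unfolding G_def by (rule prob_space_gaussian_product)
  note int = integrable_finite_processes[OF Z norm_Z]
  have inj: "inj (\<lambda>p. Inl p :: 'm \<times> 'n + 'n)" "inj (\<lambda>j. Inr j :: 'm \<times> 'n + 'n)" by (auto simp: inj_def)
  let ?X = "\<lambda>z x. (matrix_of (\<lambda>p. x (Inl p)) *v z) \<bullet> e" and ?Y = "\<lambda>z x. (\<chi> j. x (Inr j)) \<bullet> z"
  have X: "integrable G (?X z)" if "z \<in> Z" for z
    using gaussian_marginal(2)[OF inj(1) borel_measurable_integrable[OF int(2)[OF that e]]] int(2)[OF that e] by (simp add: G_def)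
  have Y: "integrable G (?Y z)" if "z \<in> Z" for z
    using gaussian_marginal(2)[OF inj(2) borel_measurable_integrable[OF int(3)[OF that]]] int(3)[OF that] by (simp add: G_def)
  have M1: "integrable (gaussian_product UNIV) (\<lambda>x. MAX z\<in>Z. (matrix_of x *v z) \<bullet> e)"
    and M2: "integrable (gaussian_product UNIV) (\<lambda>x. MAX z\<in>Z. (\<chi> j. x j) \<bullet> z)"
    by (intro prob_space.integrable_Max prob_space_gaussian_product Z int e; assumption)+
  have "expectation (\<lambda>x. MAX z\<in>Z. ?X z x) \<le> expectation (\<lambda>x. MAX z\<in>Z. ?Y z x)"
    by (rule expectation_Max_le_of_soft_max_le[OF Z X Y])
       (use gaussian_linear_form_soft_max[OF Z e] in \<open>auto simp: G_def\<close>)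
  also have "expectation (\<lambda>x. MAX z\<in>Z. ?X z x) = (\<integral>x. (MAX z\<in>Z. (matrix_of x *v z) \<bullet> e) \<partial>gaussian_product UNIV)"
    unfolding G_def by (rule gaussian_marginal(1)[OF inj(1) borel_measurable_integrable[OF M1]])
  also have "expectation (\<lambda>x. MAX z\<in>Z. ?Y z x) = (\<integral>x. (MAX z\<in>Z. (\<chi> j. x j) \<bullet> z) \<partial>gaussian_product UNIV)"
    unfolding G_def by (rule gaussian_marginal(1)[OF inj(2) borel_measurable_integrable[OF M2]])
  finally show ?thesis .
qed

end

section \<open>Suprema over a symmetric subset of the sphere\<close>

context
  fixes K :: "(real ^ 'n::finite) set"
  assumes K: "K \<subseteq> sphere 0 1" and sym: "\<And>z. z \<in> K \<Longrightarrow> - z \<in> K" and ne: "K \<noteq> {}"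
begin

lemma bdd_above_inner_sphere: "bdd_above ((\<lambda>z. g \<bullet> z) ` K)"
proof (rule bdd_aboveI2)
  fix z assume "z \<in> K"
  then show "g \<bullet> z \<le> norm g" using norm_cauchy_schwarz[of g z] K by auto
qed

lemma inner_le_SUP: "z \<in> K \<Longrightarrow> g \<bullet> z \<le> (SUP z\<in>K. g \<bullet> z)"
  using cSUP_upper[OF _ bdd_above_inner_sphere] .

lemma SUP_inner_diff_le: "(SUP z\<in>K. g \<bullet> z) - (SUP z\<in>K. h \<bullet> z) \<le> norm (g - h)"
proof -
  have "g \<bullet> z \<le> (SUP z\<in>K. h \<bullet> z) + norm (g - h)" if z: "z \<in> K" for z
  proof -
    have "g \<bullet> z = h \<bullet> z + (g - h) \<bullet> z" by (simp add: inner_diff_left)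
    moreover have "h \<bullet> z \<le> (SUP z\<in>K. h \<bullet> z)" using z by (rule inner_le_SUP)
    moreover have "(g - h) \<bullet> z \<le> norm (g - h)" using norm_cauchy_schwarz[of "g - h" z] K z by auto
    ultimately show ?thesis by linarith
  qed
  then have "(SUP z\<in>K. g \<bullet> z) \<le> (SUP z\<in>K. h \<bullet> z) + norm (g - h)" using ne by (intro cSUP_least)
  then show ?thesis by simp
qed

text \<open>The supremum may range over an uncountable set; measurability comes from its Lipschitz
  continuity in g.\<close>

lemma measurable_SUP_inner: "(\<lambda>g. SUP z\<in>K. g \<bullet> z) \<in> borel_measurable borel"
proof (rule borel_measurable_continuous_onI)
  have "1-lipschitz_on UNIV (\<lambda>g. SUP z\<in>K. g \<bullet> z)"
  proof (rule lipschitz_onI)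
    fix g h :: "real ^ 'n"
    show "dist (SUP z\<in>K. g \<bullet> z) (SUP z\<in>K. h \<bullet> z) \<le> 1 * dist g h"
      using SUP_inner_diff_le[of g h] SUP_inner_diff_le[of h g]
      by (simp add: dist_norm abs_le_iff norm_minus_commute)
  qed simp
  then show "continuous_on UNIV (\<lambda>g. SUP z\<in>K. g \<bullet> z)" by (rule lipschitz_on_continuous_on)
qed

lemma integrable_SUP_inner: "integrable (gaussian_product UNIV) (\<lambda>x. SUP z\<in>K. (\<chi> j. x j) \<bullet> z)"
proof (rule integrable_gaussian_lipschitz[of _ 1])
  show "(\<lambda>x. SUP z\<in>K. (\<chi> j. x j) \<bullet> z) \<in> borel_measurable (gaussian_product UNIV)"
    using measurable_compose[OF measurable_vec_of measurable_SUP_inner] .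
  fix x y :: "'n \<Rightarrow> real"
  have "(SUP z\<in>K. (\<chi> j. x j) \<bullet> z) - (SUP z\<in>K. (\<chi> j. y j) \<bullet> z) \<le> norm ((\<chi> j. x j) - (\<chi> j. y j) :: real ^ 'n)"
    by (rule SUP_inner_diff_le)
  also have "(\<chi> j. x j) - (\<chi> j. y j) = (\<chi> j. x j - y j :: real ^ 'n)" by (simp add: vec_eq_iff)
  finally show "(SUP z\<in>K. (\<chi> j. x j) \<bullet> z) - (SUP z\<in>K. (\<chi> j. y j) \<bullet> z) \<le> 1 * sqrt (\<Sum>i\<in>UNIV. (x i - y i)\<^sup>2)"
    by (simp add: norm_vec_of)
qed simp

lemma gaussian_width_eq: "gaussian_width K = (\<integral>x. (SUP z\<in>K. (\<chi> j. x j) \<bullet> z) \<partial>gaussian_product UNIV)"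
  unfolding gaussian_width_def std_gaussian_def using ne
  by (simp add: integral_distr[OF measurable_vec_of measurable_SUP_inner])

lemma gaussian_width_nonneg: "gaussian_width K \<ge> 0"
  unfolding gaussian_width_eq
proof (rule Bochner_Integration.integral_nonneg)
  fix x :: "'n \<Rightarrow> real"
  obtain z where z: "z \<in> K" using ne by auto
  have "g \<bullet> z \<le> (SUP z\<in>K. g \<bullet> z)" "g \<bullet> (- z) \<le> (SUP z\<in>K. g \<bullet> z)" for g
    using z sym by (intro inner_le_SUP; simp)+
  from this[of "\<chi> j. x j"] show "0 \<le> (SUP z\<in>K. (\<chi> j. x j) \<bullet> z)" by simp
qed

text \<open>By the symmetry of \<open>K\<close>, the lower bound for the minimum is the upper bound
  for the maximum taken at - z.\<close>

lemma expectation_extrema_le_gaussian_width: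
  assumes Z: "finite Z" "Z \<noteq> {}" "Z \<subseteq> K"
  shows "(\<integral>x. (MAX z\<in>Z. (\<chi> j. x j) \<bullet> z) \<partial>gaussian_product UNIV) \<le> gaussian_width K"
    and "- gaussian_width K \<le> (\<integral>x. (MIN z\<in>Z. (\<chi> j. x j) \<bullet> z) \<partial>gaussian_product UNIV)"
proof -
  interpret prob_space "gaussian_product (UNIV :: 'n set)" by (rule prob_space_gaussian_product)
  have norm_Z: "\<forall>z\<in>Z. norm z = 1" using Z K by auto
  note int = integrable_finite_processes(3)[OF Z(1,2) norm_Z]
  show "(\<integral>x. (MAX z\<in>Z. (\<chi> j. x j) \<bullet> z) \<partial>gaussian_product UNIV) \<le> gaussian_width K"
    unfolding gaussian_width_eq
    using Z by (intro integral_mono integrable_SUP_inner integrable_Max int Max.boundedI) (auto intro: inner_le_SUP)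
  have "expectation (\<lambda>x. - (SUP z\<in>K. (\<chi> j. x j) \<bullet> z)) \<le> (\<integral>x. (MIN z\<in>Z. (\<chi> j. x j) \<bullet> z) \<partial>gaussian_product UNIV)"
  proof (intro integral_mono integrable_minus integrable_SUP_inner integrable_Min int Z)
    fix x :: "'n \<Rightarrow> real"
    have "- (SUP z\<in>K. (\<chi> j. x j) \<bullet> z) \<le> (\<chi> j. x j) \<bullet> z" if "z \<in> Z" for z
      using inner_le_SUP[OF sym, of z "\<chi> j. x j"] that Z by auto
    then show "- (SUP z\<in>K. (\<chi> j. x j) \<bullet> z) \<le> (MIN z\<in>Z. (\<chi> j. x j) \<bullet> z)"
      using Z by (intro Min.boundedI) auto
  qed
  then show "- gaussian_width K \<le> (\<integral>x. (MIN z\<in>Z. (\<chi> j. x j) \<bullet> z) \<partial>gaussian_product UNIV)"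
    by (simp add: gaussian_width_eq)
qed

end

section \<open>Tail bounds over a countable set of directions\<close>

text \<open>Continuity from below along an enumeration of \<open>C\<close>. No union bound is
  involved, so the finite estimates, all with the same right-hand side, lose nothing on the way to a
  dense set.\<close>

lemma (in prob_space) prob_countable_UN_le:
  assumes C: "countable C" and B: "\<And>z. z \<in> C \<Longrightarrow> B z \<in> events"
    and le: "\<And>Z. finite Z \<Longrightarrow> Z \<noteq> {} \<Longrightarrow> Z \<subseteq> C \<Longrightarrow> prob (\<Union>z\<in>Z. B z) \<le> c" and c: "c \<ge> 0"
  shows "prob (\<Union>z\<in>C. B z) \<le> c"
proof (cases "C = {}")
  case False
  let ?f = "from_nat_into C"
  have r: "range ?f = C" using C False by (rule range_from_nat_into[rotated])
  define A where "A n = (\<Union>z\<in>?f ` {..n}. B z)" for n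
  have A: "range A \<subseteq> events" using B r by (auto simp: A_def intro!: sets.finite_UN)
  have "incseq A" by (rule incseq_SucI) (auto simp: A_def atMost_Suc)
  from finite_Lim_measure_incseq[OF A this] have "(\<lambda>n. prob (A n)) \<longlonglongrightarrow> prob (\<Union>n. A n)" .
  moreover have "prob (A n) \<le> c" for n
    unfolding A_def using r by (intro le) auto
  moreover have "(\<Union>n. A n) = (\<Union>z\<in>C. B z)"
  proof -
    have "(\<Union>n. A n) = (\<Union>z\<in>range ?f. B z)" by (auto simp: A_def)
    then show ?thesis by (simp only: r)
  qed
  ultimately show ?thesis by (auto intro: LIMSEQ_le_const2)
qed (use c in simp)

context
  fixes K :: "(real ^ 'n::finite) set" and \<eta> :: real and C :: "(real ^ 'n) set"
  assumes K: "K \<subseteq> sphere 0 1" and sym: "\<And>z. z \<in> K \<Longrightarrow> - z \<in> K" and \<eta>: "\<eta> > 0"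
    and C: "countable C" "C \<subseteq> K"
begin

text \<open>For finite \<open>Z\<close> the maximum and the negated minimum inherit the Lipschitz
  constant 1 of their members, and Chevet's and Gordon's inequalities bound their means through the
  width; concentration adds \<open>\<eta>\<close>. None of these bounds depends on
  \<open>Z\<close>.\<close>

lemma gaussian_max_norm_tail:
  "measure (gaussian_product UNIV) (\<Union>z\<in>C. {x. (\<integral>x. norm (\<chi> i. x i :: real ^ 'm::finite) \<partial>gaussian_product UNIV)
      + gaussian_width K + \<eta> \<le> norm (matrix_of x *v z :: real ^ 'm)}) \<le> exp (- (\<eta>\<^sup>2 / 2))" (is ?max)
  and gaussian_min_norm_tail:
  "measure (gaussian_product UNIV) (\<Union>z\<in>C. {x. norm (matrix_of x *v z :: real ^ 'm)
      \<le> (\<integral>x. norm (\<chi> i. x i :: real ^ 'm) \<partial>gaussian_product UNIV) - gaussian_width K - \<eta>}) \<le> exp (- (\<eta>\<^sup>2 / 2))" (is ?min)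
proof -
  let ?G = "gaussian_product (UNIV :: ('m \<times> 'n) set)"
  interpret prob_space ?G by (rule prob_space_gaussian_product)
  define r where "r = (\<integral>x. norm (\<chi> i. x i :: real ^ 'm) \<partial>gaussian_product UNIV)"
  have [measurable]: "(\<lambda>x. matrix_of x :: real ^ 'n ^ 'm) \<in> borel_measurable ?G"
    using measurable_matrix_of[of "\<lambda>p. p"] .
  have sp: "space ?G = UNIV" by (simp add: space_PiM)
  have meas: "{x. r + gaussian_width K + \<eta> \<le> norm (matrix_of x *v z :: real ^ 'm)} \<in> events"
    "{x. norm (matrix_of x *v z :: real ^ 'm) \<le> r - gaussian_width K - \<eta>} \<in> events" for z
  proof -
    have "{x \<in> space ?G. r + gaussian_width K + \<eta> \<le> norm (matrix_of x *v z :: real ^ 'm)} \<in> events"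
      "{x \<in> space ?G. norm (matrix_of x *v z :: real ^ 'm) \<le> r - gaussian_width K - \<eta>} \<in> events"
      by measurable
    then show "{x. r + gaussian_width K + \<eta> \<le> norm (matrix_of x *v z :: real ^ 'm)} \<in> events"
      "{x. norm (matrix_of x *v z :: real ^ 'm) \<le> r - gaussian_width K - \<eta>} \<in> events" by (simp_all add: sp)
  qed
  have fin: "prob (\<Union>z\<in>Z. {x. r + gaussian_width K + \<eta> \<le> norm (matrix_of x *v z :: real ^ 'm)}) \<le> exp (- (\<eta>\<^sup>2 / 2))
     \<and> prob (\<Union>z\<in>Z. {x. norm (matrix_of x *v z :: real ^ 'm) \<le> r - gaussian_width K - \<eta>}) \<le> exp (- (\<eta>\<^sup>2 / 2))"
    if Z: "finite Z" "Z \<noteq> {}" "Z \<subseteq> C" for Z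
  proof -
    have ZK: "Z \<subseteq> K" and ne: "K \<noteq> {}" using Z C by auto
    then have nZ: "\<forall>z\<in>Z. norm z = 1" using K by auto
    note int = integrable_finite_processes(1)[OF Z(1,2) nZ]
    let ?X = "\<lambda>x. MAX z\<in>Z. norm (matrix_of x *v z :: real ^ 'm)" and ?Y = "\<lambda>x. - (MIN z\<in>Z. norm (matrix_of x *v z :: real ^ 'm))"
    have X: "integrable ?G ?X" and Y: "integrable ?G ?Y"
      by (intro integrable_minus integrable_Max integrable_Min Z int; assumption)+
    have EX: "expectation ?X \<le> r + gaussian_width K"
      using chevet[OF Z(1,2) nZ, where ?'m = 'm] expectation_extrema_le_gaussian_width(1)[OF K sym ne Z(1,2) ZK]
      by (simp add: r_def)
    have EY: "expectation ?Y \<le> - (r - gaussian_width K)"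
      using gordon[OF Z(1,2) nZ, where ?'m = 'm] expectation_extrema_le_gaussian_width(2)[OF K sym ne Z(1,2) ZK]
      by (simp add: r_def)
    have "prob (\<Union>z\<in>Z. {x. r + gaussian_width K + \<eta> \<le> norm (matrix_of x *v z :: real ^ 'm)})
        \<le> prob {x \<in> space ?G. expectation ?X + \<eta> \<le> ?X x}"
    proof (rule finite_measure_mono)
      show "(\<Union>z\<in>Z. {x. r + gaussian_width K + \<eta> \<le> norm (matrix_of x *v z :: real ^ 'm)}) \<subseteq> {x \<in> space ?G. expectation ?X + \<eta> \<le> ?X x}"
      proof clarify
        fix z x assume z: "z \<in> Z" "r + gaussian_width K + \<eta> \<le> norm (matrix_of x *v z :: real ^ 'm)"
        have "norm (matrix_of x *v z :: real ^ 'm) \<le> ?X x" using Z z by (intro Max_ge) auto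
        then show "x \<in> space ?G \<and> expectation ?X + \<eta> \<le> ?X x" using z EX by (simp add: sp)
      qed
    qed (use X in measurable)
    also have "\<dots> \<le> exp (- (\<eta>\<^sup>2 / 2))"
      by (rule gaussian_concentration[OF finite X _ \<eta>])
         (intro Max_diff_le Z norm_matrix_of_mult_diff[OF Z(1,2) nZ])
    finally have 1: "prob (\<Union>z\<in>Z. {x. r + gaussian_width K + \<eta> \<le> norm (matrix_of x *v z :: real ^ 'm)}) \<le> exp (- (\<eta>\<^sup>2 / 2))" .
    have "prob (\<Union>z\<in>Z. {x. norm (matrix_of x *v z :: real ^ 'm) \<le> r - gaussian_width K - \<eta>})
        \<le> prob {x \<in> space ?G. expectation ?Y + \<eta> \<le> ?Y x}"
    proof (rule finite_measure_mono)
      show "(\<Union>z\<in>Z. {x. norm (matrix_of x *v z :: real ^ 'm) \<le> r - gaussian_width K - \<eta>}) \<subseteq> {x \<in> space ?G. expectation ?Y + \<eta> \<le> ?Y x}"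
      proof clarify
        fix z x assume z: "z \<in> Z" "norm (matrix_of x *v z :: real ^ 'm) \<le> r - gaussian_width K - \<eta>"
        have "- ?Y x \<le> norm (matrix_of x *v z :: real ^ 'm)" using Z z by (simp only: minus_minus) (intro Min_le, auto)
        then show "x \<in> space ?G \<and> expectation ?Y + \<eta> \<le> ?Y x" using z EY by (simp add: sp)
      qed
    qed (use Y in measurable)
    also have "\<dots> \<le> exp (- (\<eta>\<^sup>2 / 2))"
    proof (rule gaussian_concentration[OF finite Y _ \<eta>])
      fix x y :: "'m \<times> 'n \<Rightarrow> real"
      have "(MIN z\<in>Z. norm (matrix_of y *v z :: real ^ 'm)) - (MIN z\<in>Z. norm (matrix_of x *v z :: real ^ 'm)) \<le> sqrt (\<Sum>i\<in>UNIV. (y i - x i)\<^sup>2)"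
        by (intro Min_diff_le Z norm_matrix_of_mult_diff[OF Z(1,2) nZ])
      then show "?Y x - ?Y y \<le> sqrt (\<Sum>i\<in>UNIV. (x i - y i)\<^sup>2)" by (simp add: power2_commute)
    qed
    finally show ?thesis using 1 by blast
  qed
  show ?max using prob_countable_UN_le[OF C(1) meas(1)] fin by (simp add: r_def)
  show ?min using prob_countable_UN_le[OF C(1) meas(2)] fin by (simp add: r_def)
qed

text \<open>The argument of the norm tails with linear forms, where the width alone bounds the mean.
  Here \<open>e\<close> is a fixed vector; random noise is reduced to this case by
  conditioning.\<close>

lemma gaussian_linear_form_tail:
  fixes e :: "real ^ 'm::finite"
  assumes e: "norm e = 1"
  shows "measure (gaussian_product UNIV) (\<Union>z\<in>C. {x. gaussian_width K + \<eta> \<le> (matrix_of x *v z) \<bullet> e}) \<le> exp (- (\<eta>\<^sup>2 / 2))"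
proof -
  let ?G = "gaussian_product (UNIV :: ('m \<times> 'n) set)"
  interpret prob_space ?G by (rule prob_space_gaussian_product)
  have [measurable]: "(\<lambda>x. matrix_of x :: real ^ 'n ^ 'm) \<in> borel_measurable ?G"
    using measurable_matrix_of[of "\<lambda>p. p"] .
  have sp: "space ?G = UNIV" by (simp add: space_PiM)
  show ?thesis
  proof (rule prob_countable_UN_le[OF C(1)])
    have "{x \<in> space ?G. gaussian_width K + \<eta> \<le> (matrix_of x *v z) \<bullet> e} \<in> events" for z by measurable
    then show "{x. gaussian_width K + \<eta> \<le> (matrix_of x *v z) \<bullet> e} \<in> events" for z by (simp add: sp)
  next
    fix Z assume Z: "finite Z" "Z \<noteq> {}" "Z \<subseteq> C"
    have ZK: "Z \<subseteq> K" and ne: "K \<noteq> {}" using Z C by auto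
    then have nZ: "\<forall>z\<in>Z. norm z = 1" using K by auto
    let ?X = "\<lambda>x. MAX z\<in>Z. (matrix_of x *v z) \<bullet> e"
    have X: "integrable ?G ?X"
      by (intro integrable_Max Z integrable_finite_processes(2)[OF Z(1,2) nZ] e)
    have EX: "expectation ?X \<le> gaussian_width K"
      using expectation_Max_linear_form_le[OF Z(1,2) nZ e] expectation_extrema_le_gaussian_width(1)[OF K sym ne Z(1,2) ZK]
      by simp
    have "prob (\<Union>z\<in>Z. {x. gaussian_width K + \<eta> \<le> (matrix_of x *v z) \<bullet> e}) \<le> prob {x \<in> space ?G. expectation ?X + \<eta> \<le> ?X x}"
    proof (rule finite_measure_mono)
      show "(\<Union>z\<in>Z. {x. gaussian_width K + \<eta> \<le> (matrix_of x *v z) \<bullet> e}) \<subseteq> {x \<in> space ?G. expectation ?X + \<eta> \<le> ?X x}"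
      proof clarify
        fix z x assume z: "z \<in> Z" "gaussian_width K + \<eta> \<le> (matrix_of x *v z) \<bullet> e"
        have "(matrix_of x *v z) \<bullet> e \<le> ?X x" using Z z by (intro Max_ge) auto
        then show "x \<in> space ?G \<and> expectation ?X + \<eta> \<le> ?X x" using z EX by (simp add: sp)
      qed
    qed (use X in measurable)
    also have "\<dots> \<le> exp (- (\<eta>\<^sup>2 / 2))"
      by (rule gaussian_concentration[OF finite X _ \<eta>])
         (intro Max_diff_le Z matrix_of_inner_diff[OF Z(1,2) nZ] e)
    finally show "prob (\<Union>z\<in>Z. {x. gaussian_width K + \<eta> \<le> (matrix_of x *v z) \<bullet> e}) \<le> exp (- (\<eta>\<^sup>2 / 2))" .
  qed simp
qed

end

section \<open>The expected norm of a Gaussian vector\<close>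

text \<open>The upper bound is the AM-GM inequality for f^2 / sqrt m and sqrt m. The lower bound is
  Hoelder's inequality E f^2 <= (E f)^(2/3) (E f^4)^(1/3) with E f^2 = m and E f^4 = m (m + 2), in a
  linearized form: 3 y^2 - y^4 <= 2 y is integrated at y = f / s, where s^2 = m + 2 is the quotient
  of the two moments.\<close>

lemma expectation_norm_gaussian:
  defines "r \<equiv> \<integral>x. norm (\<chi> i. x i :: real ^ 'm::finite) \<partial>gaussian_product UNIV"
  shows "r \<le> sqrt (real CARD('m))" and "real CARD('m) / sqrt (real CARD('m) + 2) \<le> r"
proof -
  let ?G = "gaussian_product (UNIV :: 'm set)"
  interpret prob_space ?G by (rule prob_space_gaussian_product)
  define m where "m = real CARD('m)"
  have m: "m > 0" by (simp add: m_def)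
  define f where "f x = norm (\<chi> i. x i :: real ^ 'm)" for x
  \<comment> \<open>A one-point set of unit vectors instantiates the context in which this
    integrability was proved.\<close>
  have int: "integrable ?G f"
    unfolding f_def[abs_def] by (rule integrable_finite_processes(4)[of "{axis undefined 1}" "axis undefined 1"]) (auto simp: norm_axis_1)
  have sq: "(f x)\<^sup>2 = (\<Sum>i\<in>UNIV. (x i)\<^sup>2)" for x by (simp add: f_def norm_vec_of sum_nonneg)
  have int2: "integrable ?G (\<lambda>x. (f x)\<^sup>2)"
    unfolding sq by (intro Bochner_Integration.integrable_sum integrable_gaussian_component) auto
  have E2: "expectation (\<lambda>x. (f x)\<^sup>2) = m"
    unfolding sq by (subst Bochner_Integration.integral_sum) (auto simp: integrable_gaussian_component m_def)
  have r: "r = expectation f" unfolding r_def f_def[abs_def] ..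
  have "r \<le> expectation (\<lambda>x. ((f x)\<^sup>2 / sqrt m + sqrt m) / 2)"
    unfolding r
  proof (intro integral_mono int)
    show "integrable ?G (\<lambda>x. ((f x)\<^sup>2 / sqrt m + sqrt m) / 2)" using int2 by simp
    fix x
    have "0 \<le> (f x - sqrt m)\<^sup>2 / sqrt m" using m by simp
    also have "\<dots> = (f x)\<^sup>2 / sqrt m + sqrt m - 2 * f x"
      using m by (simp add: power2_diff add_divide_distrib diff_divide_distrib) (simp add: field_simps)
    finally show "f x \<le> ((f x)\<^sup>2 / sqrt m + sqrt m) / 2" by simp
  qed
  also have "\<dots> = sqrt m" using int2 m by (simp add: E2 prob_space real_div_sqrt)
  finally show "r \<le> sqrt (real CARD('m))" by (simp add: m_def)

  have prod2: "integrable ?G (\<lambda>x. (x i)\<^sup>2 * (x j)\<^sup>2) \<and> expectation (\<lambda>x. (x i)\<^sup>2 * (x j)\<^sup>2) = (if i = j then 3 else 1)" for i j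
  proof (cases "i = j")
    case True
    have "(x i)\<^sup>2 * (x i)\<^sup>2 = (x i) ^ 4" for x :: "'m \<Rightarrow> real" by (simp add: power2_eq_square power4_eq_xxxx mult_ac)
    then show ?thesis using True integrable_gaussian_component(3)[of UNIV i 4] integrable_gaussian_component(5)[of UNIV i] by simp
  next
    case False
    interpret P: product_sigma_finite "\<lambda>_::'m. std_normal_distribution" by (rule product_sigma_finite_gaussian)
    interpret N: prob_space std_normal_distribution by (rule prob_space_normal_density) simp
    \<comment> \<open>Filling up with the constant 1 away from i and j makes the mixed moment a
      product over all coordinates, to which independence applies.\<close>
    let ?h = "\<lambda>k t. if k \<in> {i, j} then t\<^sup>2 else (1::real)"
    have h: "integrable std_normal_distribution (?h k)" for k
      using integrable_std_normal_distribution_moment[of 2] by (cases "k \<in> {i, j}") auto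
    have Eh: "(\<integral>t. ?h k t \<partial>std_normal_distribution) = 1" for k
      using std_normal_distribution_even_moments(1)[of 1] N.prob_space by (cases "k \<in> {i, j}") auto
    have p: "(\<Prod>k\<in>UNIV. ?h k (x k)) = (x i)\<^sup>2 * (x j)\<^sup>2" for x :: "'m \<Rightarrow> real"
    proof -
      have "(\<Prod>k\<in>UNIV. ?h k (x k)) = (\<Prod>k\<in>{i, j}. (x k)\<^sup>2)"
        by (rule prod.mono_neutral_cong_right) auto
      then show ?thesis using False by simp
    qed
    show ?thesis
      using P.product_integrable_prod[of UNIV ?h, OF finite h] P.product_integral_prod[of UNIV ?h, OF finite h]
      unfolding p Eh using False by simp
  qed
  have q: "(f x) ^ 4 = (\<Sum>i\<in>UNIV. \<Sum>j\<in>UNIV. (x i)\<^sup>2 * (x j)\<^sup>2)" for x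
  proof -
    have "(f x) ^ 4 = (f x)\<^sup>2 * (f x)\<^sup>2" by (simp add: power2_eq_square power4_eq_xxxx mult_ac)
    then show ?thesis unfolding sq sum_product .
  qed
  have int4: "integrable ?G (\<lambda>x. (f x) ^ 4)"
    unfolding q using prod2 by (intro Bochner_Integration.integrable_sum) auto
  have E4: "expectation (\<lambda>x. (f x) ^ 4) = m * (m + 2)"
  proof -
    have "expectation (\<lambda>x. (f x) ^ 4) = (\<Sum>i\<in>(UNIV::'m set). \<Sum>j\<in>UNIV. if i = j then 3 else 1)"
      unfolding q using prod2 by (simp add: Bochner_Integration.integral_sum Bochner_Integration.integrable_sum)
    also have "\<dots> = (\<Sum>i\<in>(UNIV::'m set). \<Sum>j\<in>UNIV. 1 + (if i = j then 2 else 0))"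
      by (intro sum.cong) auto
    also have "\<dots> = m * (m + 2)" by (simp add: sum.distrib m_def)
    finally show ?thesis .
  qed
  define s where "s = sqrt (m + 2)"
  have s: "s > 0" "s\<^sup>2 = m + 2" using m by (auto simp: s_def)
  have "expectation (\<lambda>x. 3 / (2 * s) * (f x)\<^sup>2 - 1 / (2 * s ^ 3) * (f x) ^ 4) \<le> r"
    unfolding r
  proof (intro integral_mono int)
    show "integrable ?G (\<lambda>x. 3 / (2 * s) * (f x)\<^sup>2 - 1 / (2 * s ^ 3) * (f x) ^ 4)" using int2 int4 by simp
    fix x
    define y where "y = f x / s"
    have y: "y \<ge> 0" "f x = y * s" using s by (auto simp: y_def f_def)
    \<comment> \<open>The product expands to y^4 - 3 y^2 + 2 y. Its double root at y = 1 makes the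
      estimate tight where f concentrates.\<close>
    have "0 \<le> y * (1 - y)\<^sup>2 * (y + 2)" using y by (intro mult_nonneg_nonneg) auto
    then have "(3 * y\<^sup>2 - y ^ 4) \<le> 2 * y"
      by (simp add: power2_eq_square power4_eq_xxxx algebra_simps)
    then have "(3 * y\<^sup>2 - y ^ 4) * (s / 2) \<le> 2 * y * (s / 2)" using s by (intro mult_right_mono) auto
    moreover have "(3 * y\<^sup>2 - y ^ 4) * (s / 2) = 3 / (2 * s) * (f x)\<^sup>2 - 1 / (2 * s ^ 3) * (f x) ^ 4"
      unfolding y(2) using s(1) by (simp add: power2_eq_square power3_eq_cube power4_eq_xxxx field_simps)
    ultimately show "3 / (2 * s) * (f x)\<^sup>2 - 1 / (2 * s ^ 3) * (f x) ^ 4 \<le> f x" using y(2) by simp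
  qed
  moreover have "expectation (\<lambda>x. 3 / (2 * s) * (f x)\<^sup>2 - 1 / (2 * s ^ 3) * (f x) ^ 4) = 3 / (2 * s) * m - 1 / (2 * s ^ 3) * (m * s\<^sup>2)"
    using int2 int4 by (simp add: E2 E4 s(2))
  moreover have "3 / (2 * s) * m - 1 / (2 * s ^ 3) * (m * s\<^sup>2) = m / s"
    using s(1) by (simp add: power2_eq_square power3_eq_cube field_simps)
  ultimately show "real CARD('m) / sqrt (real CARD('m) + 2) \<le> r" by (simp add: s_def m_def)
qed

section \<open>The deterministic recursion\<close>

lemma orth_proj:
  fixes V :: "'a::euclidean_space set"
  assumes V: "subspace V"
  shows orth_proj_in: "orth_proj V v \<in> V"
    and orth_proj_orthogonal: "u \<in> V \<Longrightarrow> (v - orth_proj V v) \<bullet> u = 0"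
proof -
  obtain y z where yz: "y \<in> span V" "\<And>w. w \<in> span V \<Longrightarrow> orthogonal z w" "v = y + z"
    using orthogonal_subspace_decomp_exists by blast
  have sp: "span V = V" using V by (simp add: span_eq_iff)
  have ex: "y \<in> V \<and> (\<forall>u\<in>V. orthogonal (v - y) u)" using yz sp by simp
  have "orth_proj V v = y" unfolding orth_proj_def
  proof (rule the_equality)
    show "y \<in> V \<and> (\<forall>u\<in>V. orthogonal (v - y) u)" by (rule ex)
  next
    fix p assume p: "p \<in> V \<and> (\<forall>u\<in>V. orthogonal (v - p) u)"
    have py: "p - y \<in> V" using p ex V by (auto intro: subspace_diff)
    have "(v - y) \<bullet> (p - y) = 0" "(v - p) \<bullet> (p - y) = 0" using p ex py by (auto simp: orthogonal_def)
    then have "(p - y) \<bullet> (p - y) = 0" by (simp add: inner_diff_left)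
    then show "p = y" by simp
  qed
  then show "orth_proj V v \<in> V" "u \<in> V \<Longrightarrow> (v - orth_proj V v) \<bullet> u = 0"
    using ex by (auto simp: orthogonal_def)
qed

lemma norm_add_orthogonal:
  assumes "u \<bullet> v = 0"
  shows "(norm (u + v))\<^sup>2 = (norm u)\<^sup>2 + (norm v)\<^sup>2"
  using assms by (intro norm_add_Pythagorean) (simp add: orthogonal_def)

lemma norm_diff_orth_proj_le:
  assumes V: "subspace V" and u: "u \<in> V"
  shows "norm (v - orth_proj V v) \<le> norm (v - u)"
proof (rule power2_le_imp_le)
  let ?p = "orth_proj V v"
  have "(v - ?p) \<bullet> (?p - u) = 0"
    using orth_proj_in[OF V] u by (intro orth_proj_orthogonal V subspace_diff)
  from norm_add_orthogonal[OF this]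
  have "(norm (v - u))\<^sup>2 = (norm (v - ?p))\<^sup>2 + (norm (?p - u))\<^sup>2" by simp
  then show "(norm (v - ?p))\<^sup>2 \<le> (norm (v - u))\<^sup>2" by simp
qed simp

lemma subspace_set_plus:
  assumes "subspace V" "subspace W"
  shows "subspace (V + W)"
proof -
  have "V + W = {x + y | x y. x \<in> V \<and> y \<in> W}" by (auto simp: set_plus_def)
  then show ?thesis using subspace_sums[OF assms] by simp
qed

lemma subspace_sums_1: "subspace_sums S 1 = S"
  by (auto simp: subspace_sums_def intro: exI[of _ "\<lambda>_. V" for V])

lemma subspace_sums_2: "subspace_sums S 2 = {V + W | V W. V \<in> S \<and> W \<in> S}"
proof
  show "subspace_sums S 2 \<subseteq> {V + W | V W. V \<in> S \<and> W \<in> S}"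
    by (auto simp: subspace_sums_def numeral_2_eq_2)
  show "{V + W | V W. V \<in> S \<and> W \<in> S} \<subseteq> subspace_sums S 2"
  proof clarify
    fix V W assume "V \<in> S" "W \<in> S"
    then show "V + W \<in> subspace_sums S 2"
      unfolding subspace_sums_def
      by (intro CollectI exI[of _ "\<lambda>i. if i = 0 then V else W"]) (auto simp: numeral_2_eq_2)
  qed
qed

lemma subspace_sums_4:
  assumes "W \<in> subspace_sums S 2" "H \<in> subspace_sums S 2"
  shows "W + H \<in> subspace_sums S 4"
proof -
  from assms obtain V1 V2 V3 V4 where V: "V1 \<in> S" "V2 \<in> S" "V3 \<in> S" "V4 \<in> S" "W = V1 + V2" "H = V3 + V4"
    by (auto simp: subspace_sums_2)
  let ?V = "\<lambda>i::nat. if i = 0 then V1 else if i = 1 then V2 else if i = 2 then V3 else V4"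
  have "(\<Sum>i<4. ?V i) = W + H" using V by (simp add: eval_nat_numeral add.assoc)
  moreover have "\<forall>i<4. ?V i \<in> S" using V by auto
  ultimately show ?thesis unfolding subspace_sums_def by (intro CollectI exI[of _ ?V]) auto
qed

lemma subspace_of_subspace_sums:
  assumes "\<forall>V\<in>S. subspace V" "W \<in> subspace_sums S B"
  shows "subspace W"
proof -
  obtain V where V: "\<forall>i<B. V i \<in> S" "W = (\<Sum>i<B. V i)" using assms(2) by (auto simp: subspace_sums_def)
  have "n \<le> B \<Longrightarrow> subspace (\<Sum>i<n. V i)" for n
  proof (induction n)
    case 0
    have "(\<Sum>i<0. V i) = {0}" by simp
    then show ?case using subspace_single_0 by metis
  next
    case (Suc n)
    then show ?case using V(1) assms(1) by (auto intro: subspace_set_plus)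
  qed
  then show ?thesis by (simp add: V(2))
qed

section \<open>Error analysis of one iteration\<close>

text \<open>Polarization, applied after u and v have been rescaled to the common norm |u| |v|;
  unscaled vectors would give (|u|^2 + |v|^2) / 2 in place of |u| |v|. The lower estimate is the
  upper one at - v. In operator terms, f^T f compressed to \<open>Z\<close> is the scalar (a^2 +
  b^2) / 2 up to an error of norm (a^2 - b^2) / 2.\<close>

lemma bi_lipschitz_inner:
  fixes f :: "'a::real_inner \<Rightarrow> 'b::real_inner"
  assumes f: "linear f" and Z: "subspace Z"
    and lo: "\<And>z. z \<in> Z \<Longrightarrow> b * norm z \<le> norm (f z)" and up: "\<And>z. z \<in> Z \<Longrightarrow> norm (f z) \<le> a * norm z"
    and b: "b \<ge> 0" and uv: "u \<in> Z" "v \<in> Z"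
  shows "\<bar>f u \<bullet> f v - (a\<^sup>2 + b\<^sup>2) / 2 * (u \<bullet> v)\<bar> \<le> (a\<^sup>2 - b\<^sup>2) / 2 * (norm u * norm v)"
proof -
  interpret linear f by fact
  have upper: "f u \<bullet> f v - (a\<^sup>2 + b\<^sup>2) / 2 * (u \<bullet> v) \<le> (a\<^sup>2 - b\<^sup>2) / 2 * (norm u * norm v)"
    if uv: "u \<in> Z" "v \<in> Z" for u v
  proof (cases "u = 0 \<or> v = 0")
    case True
    then show ?thesis by (auto simp: zero)
  next
    case False
    define n where "n = norm u * norm v"
    have n: "n > 0" using False by (simp add: n_def)
    define u' where "u' = norm v *\<^sub>R u"
    define v' where "v' = norm u *\<^sub>R v"
    have nn: "u' \<bullet> u' = n\<^sup>2" "v' \<bullet> v' = n\<^sup>2" "u' \<bullet> v' = n * (u \<bullet> v)"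
      by (simp_all add: u'_def v'_def n_def power2_norm_eq_inner[symmetric] power_mult_distrib)
    have in_Z: "u' + v' \<in> Z" "u' - v' \<in> Z"
      using uv Z by (auto simp: u'_def v'_def intro: subspace_add subspace_diff subspace_scale)
    have "(norm (f (u' + v')))\<^sup>2 \<le> (a * norm (u' + v'))\<^sup>2"
      using up[OF in_Z(1)] by (intro power_mono) auto
    then have 1: "f (u' + v') \<bullet> f (u' + v') \<le> a\<^sup>2 * ((u' + v') \<bullet> (u' + v'))"
      by (simp only: power2_norm_eq_inner[symmetric] power_mult_distrib)
    have "(b * norm (u' - v'))\<^sup>2 \<le> (norm (f (u' - v')))\<^sup>2"
      using lo[OF in_Z(2)] b by (intro power_mono) auto
    then have 2: "b\<^sup>2 * ((u' - v') \<bullet> (u' - v')) \<le> f (u' - v') \<bullet> f (u' - v')"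
      by (simp only: power2_norm_eq_inner[symmetric] power_mult_distrib)
    have "4 * (f u' \<bullet> f v') = f (u' + v') \<bullet> f (u' + v') - f (u' - v') \<bullet> f (u' - v')"
      by (simp add: add diff inner_add_left inner_add_right inner_diff_left inner_diff_right inner_commute)
    also have "\<dots> \<le> a\<^sup>2 * ((u' + v') \<bullet> (u' + v')) - b\<^sup>2 * ((u' - v') \<bullet> (u' - v'))" using 1 2 by simp
    also have "\<dots> = a\<^sup>2 * (2 * n\<^sup>2 + 2 * (n * (u \<bullet> v))) - b\<^sup>2 * (2 * n\<^sup>2 - 2 * (n * (u \<bullet> v)))"
      by (simp add: inner_add_left inner_add_right inner_diff_left inner_diff_right inner_commute[of v' u'] nn)
    finally have "4 * (f u' \<bullet> f v') \<le> a\<^sup>2 * (2 * n\<^sup>2 + 2 * (n * (u \<bullet> v))) - b\<^sup>2 * (2 * n\<^sup>2 - 2 * (n * (u \<bullet> v)))" .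
    moreover have "f u' \<bullet> f v' = n * (f u \<bullet> f v)" by (simp add: u'_def v'_def scale n_def)
    moreover have "4 * (n * ((a\<^sup>2 - b\<^sup>2) / 2 * n)) = 2 * (a\<^sup>2 - b\<^sup>2) * n\<^sup>2"
      by (simp add: power2_eq_square[of n])
    moreover have "4 * (n * (f u \<bullet> f v - (a\<^sup>2 + b\<^sup>2) / 2 * (u \<bullet> v)))
        = 4 * (n * (f u \<bullet> f v)) - 2 * (a\<^sup>2 + b\<^sup>2) * (n * (u \<bullet> v))"
      by (simp add: right_diff_distrib)
    moreover have "a\<^sup>2 * (2 * n\<^sup>2 + 2 * (n * (u \<bullet> v))) - b\<^sup>2 * (2 * n\<^sup>2 - 2 * (n * (u \<bullet> v)))
        = 2 * (a\<^sup>2 - b\<^sup>2) * n\<^sup>2 + 2 * (a\<^sup>2 + b\<^sup>2) * (n * (u \<bullet> v))"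
      by (simp add: algebra_simps)
    ultimately have "n * (f u \<bullet> f v - (a\<^sup>2 + b\<^sup>2) / 2 * (u \<bullet> v)) \<le> n * ((a\<^sup>2 - b\<^sup>2) / 2 * n)"
      by linarith
    from mult_left_le_imp_le[OF this n] show ?thesis by (simp only: n_def)
  qed
  have "- v \<in> Z" using uv Z by (simp add: subspace_neg)
  from upper[OF uv(1) this]
  have "- (f u \<bullet> f v) + (a\<^sup>2 + b\<^sup>2) / 2 * (u \<bullet> v) \<le> (a\<^sup>2 - b\<^sup>2) / 2 * (norm u * norm v)"
    by (simp only: neg inner_minus_right norm_minus_cancel mult_minus_right diff_minus_eq_add)
  with upper[OF uv] show ?thesis unfolding abs_le_iff by linarith
qed

text \<open>\<open>p\<close> and \<open>d\<close> will be the two orthogonal parts of the least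
  squares error. Their worst values are inserted, and after multiplication by (1 + k)^2 the
  coefficients of g^2, g N and N^2 are compared separately, with k^2 <= k. At k = 0 the noise
  contributes sqrt 5 N, and 9 / 4 is sqrt 5 rounded up.\<close>

lemma estimation_error_bound:
  fixes k p d h N :: real
  assumes k: "0 \<le> k" "k \<le> 1" and nn: "0 \<le> p" "0 \<le> d" "0 \<le> h" "0 \<le> N"
    and p: "(1 + k) * p \<le> 2 * (k * h + N)" and d: "d \<le> k * p + N"
  shows "p\<^sup>2 + d\<^sup>2 \<le> (2 * (k * h) + 9 / 4 * N)\<^sup>2"
proof -
  define g where "g = k * h"
  have g: "g \<ge> 0" using k nn by (simp add: g_def)
  define \<alpha> where "\<alpha> = 2 * (g + N) / (1 + k)"
  have \<alpha>: "p \<le> \<alpha>" "\<alpha> \<ge> 0" "(1 + k) * \<alpha> = 2 * (g + N)"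
    using p k g nn by (auto simp: \<alpha>_def g_def pos_le_divide_eq mult.commute)
  have "d \<le> k * \<alpha> + N" using d \<alpha>(1) k by (meson add_right_mono mult_left_mono order_trans)
  then have "p\<^sup>2 + d\<^sup>2 \<le> \<alpha>\<^sup>2 + (k * \<alpha> + N)\<^sup>2"
    using \<alpha> nn by (intro add_mono power_mono) auto
  also have "\<dots> \<le> (2 * g + 9 / 4 * N)\<^sup>2"
  proof -
    have "(1 + k)\<^sup>2 * (\<alpha>\<^sup>2 + (k * \<alpha> + N)\<^sup>2) = ((1 + k) * \<alpha>)\<^sup>2 + (k * ((1 + k) * \<alpha>) + (1 + k) * N)\<^sup>2"
      by (simp add: power2_eq_square algebra_simps)
    also have "\<dots> = (2 * (g + N))\<^sup>2 + (k * (2 * (g + N)) + (1 + k) * N)\<^sup>2" by (simp only: \<alpha>(3))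
    also have "\<dots> = g\<^sup>2 * (4 + 4 * k\<^sup>2) + (g * N) * (8 + 4 * k + 12 * k\<^sup>2) + N\<^sup>2 * (5 + 6 * k + 9 * k\<^sup>2)"
      by (simp add: power2_eq_square algebra_simps)
    also have "\<dots> \<le> g\<^sup>2 * (4 * (1 + k)\<^sup>2) + (g * N) * (9 * (1 + k)\<^sup>2) + N\<^sup>2 * (81 / 16 * (1 + k)\<^sup>2)"
    proof (intro add_mono mult_left_mono)
      have kk: "k\<^sup>2 \<le> k" using k by (simp add: power2_eq_square mult_left_le)
      show "4 + 4 * k\<^sup>2 \<le> 4 * (1 + k)\<^sup>2" using k by (simp add: power2_eq_square algebra_simps)
      show "8 + 4 * k + 12 * k\<^sup>2 \<le> 9 * (1 + k)\<^sup>2" using k kk by (simp add: power2_eq_square algebra_simps)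
      show "5 + 6 * k + 9 * k\<^sup>2 \<le> 81 / 16 * (1 + k)\<^sup>2" using k kk by (simp add: power2_eq_square algebra_simps)
    qed (use g nn in auto)
    also have "\<dots> = (1 + k)\<^sup>2 * (2 * g + 9 / 4 * N)\<^sup>2" by (simp add: power2_eq_square algebra_simps)
    finally show ?thesis using k by simp
  qed
  finally show ?thesis by (simp add: g_def)
qed

text \<open>On Z = W + H, where \<open>H\<close> contains x and the previous iterate, A^T A acts as
  the scalar c up to D, so the proxy v acts as c h up to D |h| + N. Since \<open>W\<close> captures
  v at least as well as \<open>H\<close> does, the part \<open>hp\<close> of h missed by
  \<open>W\<close> satisfies c |hp| <= 2 (D |h| + N). Least squares on V + W adds an error
  \<open>d\<close> orthogonal to the missed part of x. Pruning to \<open>V'\<close> at most doubles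
  the distance to x, because the subspace of x is a competitor.\<close>

lemma gcosamp_step:
  fixes A :: "real ^ 'n::finite ^ 'm::finite" and x xt xt' x' :: "real ^ 'n" and e :: "real ^ 'm"
    and a b N :: real
  defines "k \<equiv> (a\<^sup>2 - b\<^sup>2) / (2 * b\<^sup>2)"
  assumes S: "\<forall>V\<in>S. subspace V"
    and x: "x \<in> V0" "V0 \<in> S" and xt: "xt \<in> V" "V = {0} \<or> V \<in> S"
    and ab: "0 < b" "b \<le> a" "k \<le> 1" and N: "0 \<le> N"
    and lo: "\<And>z. z \<in> subspace_union S 4 \<Longrightarrow> b * norm z \<le> norm (A *v z)"
    and up: "\<And>z. z \<in> subspace_union S 4 \<Longrightarrow> norm (A *v z) \<le> a * norm z"
    and noise: "\<And>z. z \<in> subspace_union S 4 \<Longrightarrow> (A *v z) \<bullet> e \<le> N * norm z"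
    and W: "is_arg_min (\<lambda>W. norm (v - orth_proj W v)) (\<lambda>W. W \<in> subspace_sums S 2) W"
    and v: "v = transpose A *v ((A *v x + e) - A *v xt)"
    and tilde: "is_arg_min (\<lambda>z. norm ((A *v x + e) - A *v z)) (\<lambda>z. z \<in> V + W) xtil"
    and V': "is_arg_min (\<lambda>W. norm (xtil - orth_proj W xtil)) (\<lambda>W. W \<in> S) V'"
    and x': "x' = orth_proj V' xtil"
  shows "norm (x' - x) \<le> 4 * k * norm (xt - x) + 9 / 2 * N / b\<^sup>2"
proof -
  \<comment> \<open>Centre and radius of A^T A on \<open>Z\<close>; in units of b^2 they are 1 + k
    and k.\<close>
  define c where "c = (a\<^sup>2 + b\<^sup>2) / 2"
  define D where "D = (a\<^sup>2 - b\<^sup>2) / 2"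
  have b2: "b\<^sup>2 > 0" using ab by simp
  have D0: "D \<ge> 0" using ab by (simp add: D_def power_mono)
  have Dk: "D = k * b\<^sup>2" using b2 by (simp add: D_def k_def)
  have k0: "k \<ge> 0" using ab by (simp add: k_def power_mono)
  have ck: "c = (1 + k) * b\<^sup>2" using Dk by (simp add: c_def D_def field_simps)
  have c0: "c > 0" using ck k0 b2 by simp
  \<comment> \<open>In the first iteration V = {0} need not belong to \<open>S\<close>;
    \<open>V0\<close> takes its place, so that \<open>H\<close> is a sum of two members of
    \<open>S\<close> in every iteration.\<close>
  define U where "U = (if V = {0} then V0 else V)"
  have U: "U \<in> S" "V \<subseteq> U" using x xt S by (auto simp: U_def subspace_0)
  define H where "H = V0 + U"
  have H2: "H \<in> subspace_sums S 2" using x U by (auto simp: H_def subspace_sums_2)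
  have W2: "W \<in> subspace_sums S 2" using W by (simp add: is_arg_min_def)
  have sub: "subspace V0" "subspace U" "subspace H" "subspace W"
    using S x U H2 W2 subspace_of_subspace_sums by auto
  have subV: "subspace V" using xt S by auto
  define Z where "Z = W + H"
  have subZ: "subspace Z" unfolding Z_def using sub by (intro subspace_set_plus)
  have Z4: "z \<in> subspace_union S 4" if "z \<in> Z" for z
    using subspace_sums_4[OF W2 H2] that by (auto simp: subspace_union_def Z_def)
  have WZ: "W \<subseteq> Z" and HZ: "H \<subseteq> Z"
    using sub subspace_0 unfolding Z_def by (force simp: set_plus_def)+
  have xH: "x \<in> H" and VH: "V \<subseteq> H"
    using x U sub subspace_0 unfolding H_def by (force simp: set_plus_def)+
  have VWZ: "V + W \<subseteq> Z" using VH by (auto simp: Z_def set_plus_def) (metis add.commute subsetD)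
  have lin: "linear ((*v) A)" by (rule matrix_vector_mul_linear)
  have ip: "\<bar>(A *v u) \<bullet> (A *v w) - c * (u \<bullet> w)\<bar> \<le> D * (norm u * norm w)" if "u \<in> Z" "w \<in> Z" for u w
    unfolding c_def D_def using ab
    by (intro bi_lipschitz_inner[OF lin subZ _ _ _ that] lo up Z4) auto
  have noiseZ: "\<bar>e \<bullet> (A *v z)\<bar> \<le> N * norm z" if "z \<in> Z" for z
    using noise[OF Z4[OF that]] noise[OF Z4[OF subspace_neg[OF subZ that]]]
    by (simp add: inner_commute linear_neg[OF lin] abs_le_iff)
  define h where "h = x - xt"
  have hH: "h \<in> H" unfolding h_def using xH xt VH sub by (intro subspace_diff) auto
  have vh: "v \<bullet> w = (A *v h) \<bullet> (A *v w) + e \<bullet> (A *v w)" for w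
  proof -
    have "v \<bullet> w = ((A *v x + e) - A *v xt) \<bullet> (A *v w)"
      unfolding v by (simp only: transpose_matrix_vector dot_lmul_matrix)
    also have "(A *v x + e) - A *v xt = A *v h + e" by (simp add: h_def linear_diff[OF lin])
    finally show ?thesis by (simp add: inner_add_left)
  qed

  define PZ where "PZ = orth_proj Z v"
  define PW where "PW = orth_proj W v"
  define PH where "PH = orth_proj H v"
  have inZ: "PZ \<in> Z" "PW \<in> Z" "PH \<in> Z"
    using orth_proj_in[OF subZ, of v] orth_proj_in[OF sub(4), of v] orth_proj_in[OF sub(3), of v] WZ HZ
    by (auto simp: PZ_def PW_def PH_def)
  \<comment> \<open>The part of v orthogonal to \<open>Z\<close> is common to all candidates, so the
    selection rule compares distances from \<open>PZ\<close>.\<close>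
  have decomp: "(norm (v - q))\<^sup>2 = (norm (v - PZ))\<^sup>2 + (norm (PZ - q))\<^sup>2" if "q \<in> Z" for q
  proof -
    have "(v - PZ) \<bullet> (PZ - q) = 0"
      unfolding PZ_def using inZ(1) that subZ by (intro orth_proj_orthogonal subspace_diff) (auto simp: PZ_def)
    from norm_add_orthogonal[OF this] show ?thesis by simp
  qed
  have "norm (v - PW) \<le> norm (v - PH)"
    using W H2 by (auto simp: is_arg_min_def PW_def PH_def not_less)
  then have "(norm (v - PW))\<^sup>2 \<le> (norm (v - PH))\<^sup>2" by (intro power_mono) auto
  then have "(norm (PZ - PW))\<^sup>2 \<le> (norm (PZ - PH))\<^sup>2" using decomp[OF inZ(2)] decomp[OF inZ(3)] by linarith
  then have le_q: "norm (PZ - PW) \<le> norm (PZ - PH)" by (rule power2_le_imp_le) simp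
  \<comment> \<open>The difference q is orthogonal to \<open>H\<close>, which contains h. In <v, q>
    the scalar part c <h, q> therefore vanishes, and only the deviation D and the noise
    remain.\<close>
  have q: "norm (PZ - PH) \<le> D * norm h + N"
  proof -
    let ?q = "PZ - PH"
    have qZ: "?q \<in> Z" using inZ subZ by (intro subspace_diff)
    have orthH: "?q \<bullet> u = 0" if "u \<in> H" for u
    proof -
      have "(v - PH) \<bullet> u = 0" unfolding PH_def by (rule orth_proj_orthogonal[OF sub(3) that])
      moreover have "(v - PZ) \<bullet> u = 0" unfolding PZ_def using HZ that by (intro orth_proj_orthogonal[OF subZ]) auto
      ultimately show ?thesis by (simp add: inner_diff_left)
    qed
    have "?q \<bullet> PH = 0" using orth_proj_in[OF sub(3)] by (intro orthH) (simp add: PH_def)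
    moreover have "(v - PZ) \<bullet> ?q = 0" unfolding PZ_def[symmetric] using orth_proj_orthogonal[OF subZ qZ, of v] by (simp add: PZ_def)
    ultimately have "(norm ?q)\<^sup>2 = v \<bullet> ?q"
      by (simp add: power2_norm_eq_inner inner_diff_left inner_diff_right inner_commute)
    also have "\<dots> = (A *v h) \<bullet> (A *v ?q) + e \<bullet> (A *v ?q)" by (rule vh)
    also have "\<dots> \<le> D * (norm h * norm ?q) + N * norm ?q"
      using ip[of h ?q] hH HZ qZ orthH[OF hH] noiseZ[OF qZ] by (auto simp: inner_commute abs_le_iff)
    finally have "norm ?q * norm ?q \<le> norm ?q * (D * norm h + N)"
      by (simp add: power2_eq_square algebra_simps)
    then show ?thesis using D0 N by (cases "?q = 0") auto
  qed
  define hp where "hp = h - orth_proj W h"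
  have PWh: "orth_proj W h \<in> W" by (rule orth_proj_in[OF sub(4)])
  have hpZ: "hp \<in> Z" unfolding hp_def using hH HZ PWh WZ subZ by (intro subspace_diff) auto
  have hpW: "hp \<bullet> u = 0" if "u \<in> W" for u unfolding hp_def by (rule orth_proj_orthogonal[OF sub(4) that])
  \<comment> \<open>Two estimates of <v, hp>: from above by the selection estimate, since hp is
    orthogonal to \<open>W\<close>; from below by c |hp|^2 - D |h| |hp| - N |hp|.\<close>
  have hp: "c * norm hp \<le> 2 * (D * norm h + N)"
  proof -
    have "(v - PZ) \<bullet> hp = 0" unfolding PZ_def by (rule orth_proj_orthogonal[OF subZ hpZ])
    moreover have "PW \<bullet> hp = 0"
      unfolding PW_def by (subst inner_commute, rule hpW) (rule orth_proj_in[OF sub(4)])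
    ultimately have "v \<bullet> hp = (PZ - PW) \<bullet> hp" by (simp add: inner_diff_left)
    also have "\<dots> \<le> norm (PZ - PW) * norm hp" by (rule norm_cauchy_schwarz)
    also have "\<dots> \<le> (D * norm h + N) * norm hp" using le_q q by (intro mult_right_mono) auto
    finally have 1: "(A *v h) \<bullet> (A *v hp) + e \<bullet> (A *v hp) \<le> (D * norm h + N) * norm hp" by (simp only: vh)
    have "h \<bullet> hp = hp \<bullet> hp" using hpW[OF PWh] by (simp add: hp_def inner_diff_left inner_commute)
    then have "c * (norm hp)\<^sup>2 - D * (norm h * norm hp) \<le> (A *v h) \<bullet> (A *v hp)"
      using ip[of h hp] hH HZ hpZ by (auto simp: power2_norm_eq_inner abs_le_iff)
    moreover have "- (N * norm hp) \<le> e \<bullet> (A *v hp)" using noiseZ[OF hpZ] by (simp add: abs_le_iff)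
    ultimately have "norm hp * (c * norm hp) \<le> norm hp * (2 * (D * norm h + N))"
      using 1 by (simp add: power2_eq_square algebra_simps)
    then show ?thesis using D0 N by (cases "hp = 0") auto
  qed

  have subT: "subspace (V + W)" by (rule subspace_set_plus[OF subV sub(4)])
  define Px where "Px = orth_proj (V + W) x"
  have PxT: "Px \<in> V + W" unfolding Px_def by (rule orth_proj_in[OF subT])
  define p where "p = norm (x - Px)"
  have p_le: "p \<le> norm hp"
  proof -
    \<comment> \<open>A competitor for the projection of x to V + W; its distance from x is
      |hp|.\<close>
    have "xt + orth_proj W h \<in> V + W" using xt PWh by (intro set_plus_intro)
    from norm_diff_orth_proj_le[OF subT this, of x] show ?thesis by (simp add: p_def Px_def hp_def h_def algebra_simps)
  qed
  have xtT: "xtil \<in> V + W" using tilde by (simp add: is_arg_min_def)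
  define d where "d = xtil - Px"
  have dT: "d \<in> V + W" unfolding d_def using xtT PxT subT by (intro subspace_diff)
  have dZ: "d \<in> Z" and xPZ: "x - Px \<in> Z"
    using dT VWZ xH HZ PxT subZ by (auto intro!: subspace_diff)
  have orth: "(x - Px) \<bullet> d = 0" unfolding Px_def by (rule orth_proj_orthogonal[OF subT dT])
  \<comment> \<open>The normal equations: the image of a least squares minimizer is the projection
    of the data to the image of V + W, by comparison with a preimage z of that projection.\<close>
  have normal: "((A *v x + e) - A *v xtil) \<bullet> (A *v d) = 0"
  proof -
    let ?L = "(\<lambda>z. A *v z) ` (V + W)" and ?y = "A *v x + e"
    have subL: "subspace ?L" using lin subT by (rule linear_subspace_image)
    obtain z where z: "z \<in> V + W" "orth_proj ?L ?y = A *v z" using orth_proj_in[OF subL, of ?y] by auto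
    have "(?y - A *v z) \<bullet> (A *v z - A *v xtil) = 0"
    proof -
      have "A *v (z - xtil) \<in> ?L" using z xtT subT by (auto intro: subspace_diff)
      from orth_proj_orthogonal[OF subL this, of ?y] show ?thesis
        by (simp add: z(2) linear_diff[OF lin])
    qed
    from norm_add_orthogonal[OF this]
    have "(norm (?y - A *v xtil))\<^sup>2 = (norm (?y - A *v z))\<^sup>2 + (norm (A *v z - A *v xtil))\<^sup>2"
    proof -
      have "?y - A *v z + (A *v z - A *v xtil) = ?y - A *v xtil" by (simp only: add_diff_eq diff_add_cancel)
      with \<open>(norm (?y - A *v z + (A *v z - A *v xtil)))\<^sup>2 = _\<close> show ?thesis by (simp only:)
    qed
    moreover have "norm (?y - A *v xtil) \<le> norm (?y - A *v z)"
      using tilde z(1) by (auto simp: is_arg_min_def not_less)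
    then have "(norm (?y - A *v xtil))\<^sup>2 \<le> (norm (?y - A *v z))\<^sup>2" by (intro power_mono) auto
    ultimately have "A *v z = A *v xtil" by simp
    then show ?thesis using orth_proj_orthogonal[OF subL, of "A *v d" ?y] z(2) dT by auto
  qed
  \<comment> \<open>The normal equations tested with \<open>d\<close>. As x - Px is orthogonal to
    \<open>d\<close>, the scalar part of A^T A drops out again.\<close>
  have d_le: "b\<^sup>2 * norm d \<le> D * p + N"
  proof -
    have "(A *v x + e) - A *v xtil = A *v (x - Px) + e - A *v d"
      by (simp add: d_def linear_diff[OF lin])
    then have "(A *v d) \<bullet> (A *v d) = (A *v (x - Px)) \<bullet> (A *v d) + e \<bullet> (A *v d)"
      using normal by (simp only: inner_diff_left inner_add_left)
    also have "\<dots> \<le> D * (p * norm d) + N * norm d"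
      using ip[OF xPZ dZ] noiseZ[OF dZ] by (simp add: orth abs_le_iff p_def)
    finally have "(norm (A *v d))\<^sup>2 \<le> D * (p * norm d) + N * norm d" by (simp add: power2_norm_eq_inner)
    moreover have "(b * norm d)\<^sup>2 \<le> (norm (A *v d))\<^sup>2" using lo[OF Z4[OF dZ]] ab by (intro power_mono) auto
    ultimately have "norm d * (b\<^sup>2 * norm d) \<le> norm d * (D * p + N)"
      by (simp add: power2_eq_square algebra_simps)
    then show ?thesis using D0 N by (cases "d = 0") (auto simp: p_def)
  qed
  have tri: "(norm (xtil - x))\<^sup>2 = p\<^sup>2 + (norm d)\<^sup>2"
  proof -
    have "(x - Px) \<bullet> (- d) = 0" using orth by simp
    from norm_add_orthogonal[OF this] show ?thesis by (simp add: p_def d_def norm_minus_commute)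
  qed
  have num: "p\<^sup>2 + (norm d)\<^sup>2 \<le> (2 * (k * norm h) + 9 / 4 * (N / b\<^sup>2))\<^sup>2"
  proof (rule estimation_error_bound)
    have "c * p \<le> 2 * (D * norm h + N)" using p_le hp c0 by (meson mult_left_mono less_imp_le order_trans)
    moreover have "b\<^sup>2 * ((1 + k) * p) = c * p" by (simp only: ck mult_ac)
    moreover have "b\<^sup>2 * (2 * (k * norm h + N / b\<^sup>2)) = 2 * (D * norm h + N)"
      using b2 by (simp add: Dk distrib_left mult_ac)
    ultimately have "b\<^sup>2 * ((1 + k) * p) \<le> b\<^sup>2 * (2 * (k * norm h + N / b\<^sup>2))" by linarith
    then show "(1 + k) * p \<le> 2 * (k * norm h + N / b\<^sup>2)" using b2 by simp
    have "b\<^sup>2 * norm d \<le> b\<^sup>2 * (k * p + N / b\<^sup>2)" using d_le b2 by (simp add: Dk distrib_left mult_ac)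
    then show "norm d \<le> k * p + N / b\<^sup>2" using b2 by simp
  qed (use k0 ab N in \<open>auto simp: p_def\<close>)
  have til: "norm (xtil - x) \<le> 2 * (k * norm h) + 9 / 4 * (N / b\<^sup>2)"
    by (rule power2_le_imp_le) (use num tri k0 N in auto)
  have "norm (x' - x) \<le> norm (xtil - x') + norm (xtil - x)"
    using norm_triangle_ineq[of "x' - xtil" "xtil - x"] by (simp add: norm_minus_commute)
  moreover have "norm (xtil - x') \<le> norm (xtil - orth_proj V0 xtil)"
    using V' x(2) by (auto simp: is_arg_min_def x' not_less)
  moreover have "norm (xtil - orth_proj V0 xtil) \<le> norm (xtil - x)"
    by (rule norm_diff_orth_proj_le[OF sub(1) x(1)])
  ultimately have "norm (x' - x) \<le> 2 * norm (xtil - x)" by linarith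
  also have "\<dots> \<le> 2 * (2 * (k * norm h) + 9 / 4 * (N / b\<^sup>2))"
    by (intro mult_left_mono til) simp
  finally show ?thesis by (simp add: h_def norm_minus_commute)
qed

text \<open>The additive term \<xi> |e| / (1 - \<rho>) is the fixed point of q -> \<rho> q + \<xi>
  |e|, so the induction over the iterations closes exactly.\<close>

lemma gcosamp_error:
  fixes A :: "real ^ 'n::finite ^ 'm::finite" and x :: "real ^ 'n" and e :: "real ^ 'm"
    and a b N \<rho> \<xi> :: real
  assumes S: "\<forall>V\<in>S. subspace V" and x: "x \<in> subspace_union S 1"
    and ab: "0 < b" "b \<le> a" "(a\<^sup>2 - b\<^sup>2) / (2 * b\<^sup>2) \<le> 1" and N: "0 \<le> N"
    and lo: "\<And>z. z \<in> subspace_union S 4 \<Longrightarrow> b * norm z \<le> norm (A *v z)"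
    and up: "\<And>z. z \<in> subspace_union S 4 \<Longrightarrow> norm (A *v z) \<le> a * norm z"
    and noise: "\<And>z. z \<in> subspace_union S 4 \<Longrightarrow> (A *v z) \<bullet> e \<le> N * norm z"
    and X: "gcosamp_iterates A (A *v x + e) S X"
    and \<rho>: "4 * ((a\<^sup>2 - b\<^sup>2) / (2 * b\<^sup>2)) \<le> \<rho>" "\<rho> < 1" and \<xi>: "9 / 2 * N / b\<^sup>2 \<le> \<xi> * norm e"
  shows "norm (X t - x) \<le> \<rho> ^ t * norm (X 0 - x) + \<xi> / (1 - \<rho>) * norm e"
proof -
  obtain V0 where V0: "V0 \<in> S" "x \<in> V0" using x unfolding subspace_union_def subspace_sums_1 by auto
  from X obtain r V V\<Delta> Vt xt where it: "r 0 = A *v x + e" "X 0 = 0" "V 0 = {0}"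
    and step: "\<And>t. is_arg_min (\<lambda>W. norm (transpose A *v r t - orth_proj W (transpose A *v r t))) (\<lambda>W. W \<in> subspace_sums S 2) (V\<Delta> (Suc t))"
     "\<And>t. Vt (Suc t) = V t + V\<Delta> (Suc t)"
     "\<And>t. is_arg_min (\<lambda>z. norm ((A *v x + e) - A *v z)) (\<lambda>z. z \<in> Vt (Suc t)) (xt (Suc t))"
     "\<And>t. is_arg_min (\<lambda>W. norm (xt (Suc t) - orth_proj W (xt (Suc t)))) (\<lambda>W. W \<in> S) (V (Suc t))"
     "\<And>t. X (Suc t) = orth_proj (V (Suc t)) (xt (Suc t))"
     "\<And>t. r (Suc t) = (A *v x + e) - A *v X (Suc t)"
    unfolding gcosamp_iterates_def Let_def by blast
  have res: "r t = (A *v x + e) - A *v X t" for t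
    using it step(6) by (cases t) auto
  have VS: "V t = {0} \<or> V t \<in> S" for t
    using it step(4) by (cases t) (auto simp: is_arg_min_def)
  have XV: "X t \<in> V t" for t
  proof (cases t)
    case (Suc s)
    have "V (Suc s) \<in> S" using step(4) by (auto simp: is_arg_min_def)
    then show ?thesis using S step(5) orth_proj_in Suc by auto
  qed (simp add: it)
  have \<rho>0: "\<rho> \<ge> 0"
  proof -
    have "0 \<le> (a\<^sup>2 - b\<^sup>2) / (2 * b\<^sup>2)" using ab by (simp add: power_mono)
    then show ?thesis using \<rho> by linarith
  qed
  have one: "norm (X (Suc t) - x) \<le> \<rho> * norm (X t - x) + \<xi> * norm e" for t
  proof -
    have "norm (X (Suc t) - x) \<le> 4 * ((a\<^sup>2 - b\<^sup>2) / (2 * b\<^sup>2)) * norm (X t - x) + 9 / 2 * N / b\<^sup>2"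
      by (rule gcosamp_step[OF S V0(2,1) XV VS ab N lo up noise step(1)[of t] _ _ step(4)[of t] step(5)[of t]])
         (use res step(2,3)[of t] in simp_all)
    also have "\<dots> \<le> \<rho> * norm (X t - x) + \<xi> * norm e"
      using \<rho> \<xi> by (intro add_mono mult_right_mono) auto
    finally show ?thesis .
  qed
  have "norm (X t - x) \<le> \<rho> ^ t * norm (X 0 - x) + (\<xi> * norm e) / (1 - \<rho>)"
  proof (induction t)
    case 0
    have "0 \<le> 9 / 2 * N / b\<^sup>2" using N by simp
    then have "0 \<le> \<xi> * norm e" using \<xi> by linarith
    then show ?case using \<rho> by simp
  next
    case (Suc t)
    have "norm (X (Suc t) - x) \<le> \<rho> * (\<rho> ^ t * norm (X 0 - x) + (\<xi> * norm e) / (1 - \<rho>)) + \<xi> * norm e"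
      using one[of t] mult_left_mono[OF Suc.IH \<rho>0] by linarith
    also have "\<dots> = \<rho> ^ Suc t * norm (X 0 - x) + (\<xi> * norm e) / (1 - \<rho>)"
    proof -
      have "\<rho> * (q / (1 - \<rho>)) + q = q / (1 - \<rho>)" for q
        using \<rho>(2) by (simp add: field_simps)
      then show ?thesis by (simp add: distrib_left mult.assoc)
    qed
    finally show ?case .
  qed
  then show ?thesis by simp
qed

section \<open>The error bound\<close>

text \<open>The first estimate amounts to (m - 1)^2 (m + 2) <= m^3, that is, 2 <= 3 m. Together the
  three place m / sqrt (m + 2) and m / sqrt (m + 1) within 1 / sqrt m of each other.\<close>

lemma div_sqrt_add_2_bounds:
  fixes m :: real
  assumes "m \<ge> 1"
  shows "sqrt m - 1 / sqrt m \<le> m / sqrt (m + 2)" "m / sqrt (m + 1) \<le> sqrt m" "m / sqrt (m + 2) \<le> m / sqrt (m + 1)"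
proof -
  have "((m - 1) * sqrt (m + 2))\<^sup>2 \<le> (m * sqrt m)\<^sup>2"
  proof -
    have "(m - 1)\<^sup>2 * (m + 2) \<le> m\<^sup>2 * m"
      using assms by (simp add: power2_eq_square algebra_simps)
    then show ?thesis using assms by (simp add: power_mult_distrib)
  qed
  then have *: "(m - 1) * sqrt (m + 2) \<le> m * sqrt m"
    by (rule power2_le_imp_le) (use assms in simp)
  have "sqrt m - 1 / sqrt m = (m - 1) / sqrt m"
    using assms by (simp only: diff_divide_distrib real_div_sqrt)
  then have "(sqrt m - 1 / sqrt m) * sqrt (m + 2) = (m - 1) * sqrt (m + 2) / sqrt m" by simp
  also have "\<dots> \<le> m" using * assms by (simp add: divide_le_eq)
  finally show "sqrt m - 1 / sqrt m \<le> m / sqrt (m + 2)" using assms by (simp add: pos_le_divide_eq)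
  have "m = sqrt m * sqrt m" using assms by simp
  also have "\<dots> \<le> sqrt m * sqrt (m + 1)" using assms by (intro mult_left_mono) auto
  finally show "m / sqrt (m + 1) \<le> sqrt m" using assms by (simp add: divide_le_eq)
  show "m / sqrt (m + 2) \<le> m / sqrt (m + 1)" using assms by (intro divide_left_mono) auto
qed

text \<open>With B = m / sqrt (m + 1) - s, the condition that rho is not 1 reads 4 (a^2 - B^2) < B
  a. It keeps a / B below the positive root of 4 r^2 - r - 4, about 1.133. Since b and B are at
  least 18 and differ by at most 1 / 20, everything else is a comparison of numbers.\<close>

lemma gcosamp_constants:
  fixes m s :: real
  assumes s: "s \<ge> 7 / 5" and m: "m \<ge> 14.5\<^sup>2 * s\<^sup>2 + 1" and \<rho>: "gcosamp_rho m (s\<^sup>2) \<noteq> 1"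
  defines "a \<equiv> sqrt m + s" and "b \<equiv> m / sqrt (m + 2) - s"
  shows "0 < b" "b \<le> a" "(a\<^sup>2 - b\<^sup>2) / (2 * b\<^sup>2) \<le> 1"
    "4 * ((a\<^sup>2 - b\<^sup>2) / (2 * b\<^sup>2)) \<le> gcosamp_rho m (s\<^sup>2)" "gcosamp_rho m (s\<^sup>2) < 1"
    "9 / 2 * s / b\<^sup>2 \<le> gcosamp_xi m (s\<^sup>2)"
proof -
  have m1: "m \<ge> 1" using m by (smt (verit) zero_le_power2 mult_nonneg_nonneg)
  define B where "B = m / sqrt (m + 1) - s"
  define \<mu> where "\<mu> = sqrt m"
  have \<mu>m: "\<mu>\<^sup>2 = m" "\<mu> \<ge> 0" using m1 by (auto simp: \<mu>_def)
  have "(14.5 * s)\<^sup>2 \<le> \<mu>\<^sup>2" unfolding power_mult_distrib using m \<mu>m by linarith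
  then have \<mu>s: "14.5 * s \<le> \<mu>" by (rule power2_le_imp_le[OF _ \<mu>m(2)])
  \<comment> \<open>14.5 times 7 / 5 is 20.3.\<close>
  then have \<mu>20: "\<mu> \<ge> 20" using s by simp
  then have inv: "1 / \<mu> \<le> 1 / 20" by (intro divide_left_mono) auto
  have sandwich: "\<mu> - 1 / \<mu> - s \<le> b" "b \<le> B" "B \<le> \<mu> - s"
    using div_sqrt_add_2_bounds[OF m1] by (auto simp: b_def B_def \<mu>_def)
  have bpos: "b \<ge> 18" using sandwich(1) \<mu>s \<mu>20 inv by linarith
  have Bb: "B - b \<le> 1 / \<mu>" using sandwich by linarith
  have bB: "99 / 100 * B \<le> b" using Bb inv bpos by linarith
  have Bpos: "B > 0" using sandwich(2) bpos by linarith
  have a: "a = \<mu> + s" by (simp add: a_def \<mu>_def)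
  have apos: "a > 0" using a \<mu>20 s by linarith
  have aB: "2 * s \<le> a - B" using sandwich a by linarith
  show "0 < b" using bpos by simp
  show ba: "b \<le> a" using sandwich aB s by linarith
  have sq: "sqrt (s\<^sup>2) = s" using s by simp
  define R where "R = 4 * ((a\<^sup>2 - B\<^sup>2) / (B * a))"
  have rho_eq: "gcosamp_rho m (s\<^sup>2) = min 1 R"
    unfolding gcosamp_rho_def sq by (simp only: R_def a_def B_def)
  then have R: "R < 1" "gcosamp_rho m (s\<^sup>2) = R" using \<rho> by (auto simp: min_def split: if_splits)
  show "gcosamp_rho m (s\<^sup>2) < 1" using R by simp
  have quad: "4 * (a\<^sup>2 - B\<^sup>2) < B * a"
    using R(1) Bpos apos by (simp add: R_def pos_divide_less_eq)
  \<comment> \<open>At r = 1.14 the quadratic 4 r^2 - r - 4 has the value 0.0584; the factor 4 a +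
    3.56 B comes from dividing by a - 1.14 B with this remainder.\<close>
  have a_le: "a \<le> 1.14 * B"
  proof (rule ccontr)
    assume "\<not> a \<le> 1.14 * B"
    then have "0 < (a - 1.14 * B) * (4 * a + 3.56 * B)" using apos Bpos by (intro mult_pos_pos) auto
    also have "\<dots> = 4 * (a * a) - a * B - 4.0584 * (B * B)" by (simp add: algebra_simps)
    finally have "4 * (a * a) - a * B - 4 * (B * B) > 0.0584 * (B * B)" by simp
    moreover have "B * B > 0" using Bpos by simp
    ultimately show False using quad by (simp add: power2_eq_square algebra_simps)
  qed
  have a2: "a\<^sup>2 \<le> 1.3 * B\<^sup>2"
  proof -
    have "a\<^sup>2 \<le> (1.14 * B)\<^sup>2" using a_le apos by (intro power_mono) auto
    also have "\<dots> \<le> 1.3 * B\<^sup>2" by (simp add: power_mult_distrib power2_eq_square)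
    finally show ?thesis .
  qed
  have b2: "49 / 50 * B\<^sup>2 \<le> b\<^sup>2"
  proof -
    have "(99 / 100 * B)\<^sup>2 \<le> b\<^sup>2" using bB Bpos by (intro power_mono) auto
    moreover have "(99 / 100 * B)\<^sup>2 = 9801 / 10000 * B\<^sup>2" by (simp add: power2_eq_square)
    ultimately show ?thesis using zero_le_power2[of B] by linarith
  qed
  have B2: "B\<^sup>2 > 0" using Bpos by simp
  \<comment> \<open>Replacing B by b costs B^2 - b^2 <= B / 10, at most one fiftieth of a^2 - B^2,
    since a - B >= 2 s makes the latter at least 5 B.\<close>
  have gap: "a\<^sup>2 - b\<^sup>2 \<le> 51 / 50 * (a\<^sup>2 - B\<^sup>2)"
  proof -
    have "a\<^sup>2 - B\<^sup>2 = (a - B) * (a + B)" by (simp add: power2_eq_square algebra_simps)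
    also have "\<dots> \<ge> (2 * s) * (2 * B)" using aB s Bpos by (intro mult_mono) auto
    finally have "(2 * s) * (2 * B) \<le> a\<^sup>2 - B\<^sup>2" .
    moreover have "14 / 5 * (2 * B) \<le> (2 * s) * (2 * B)"
      using s Bpos by (intro mult_right_mono) auto
    ultimately have 1: "14 / 5 * (2 * B) \<le> a\<^sup>2 - B\<^sup>2" by linarith
    have "B\<^sup>2 - b\<^sup>2 = (B - b) * (B + b)" by (simp add: power2_eq_square algebra_simps)
    also have "\<dots> \<le> 1 / 20 * (2 * B)"
      using Bb inv sandwich(2) bpos by (intro mult_mono) auto
    finally have 2: "B\<^sup>2 - b\<^sup>2 \<le> B / 10" by simp
    have "5 * B \<le> a\<^sup>2 - B\<^sup>2" using 1 Bpos by linarith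
    then have "B / 10 \<le> 1 / 50 * (a\<^sup>2 - B\<^sup>2)" by simp
    then have "B\<^sup>2 - b\<^sup>2 \<le> 1 / 50 * (a\<^sup>2 - B\<^sup>2)" using 2 by (rule order_trans[rotated])
    then show ?thesis by (simp add: field_simps)
  qed
  have pos: "a\<^sup>2 - B\<^sup>2 \<ge> 0" using aB s Bpos by (simp add: power_mono)
  have bpos2: "b\<^sup>2 > 0" using bpos by simp
  have "a\<^sup>2 - b\<^sup>2 \<le> 2 * b\<^sup>2" using a2 b2 B2 by linarith
  then show "(a\<^sup>2 - b\<^sup>2) / (2 * b\<^sup>2) \<le> 1" using bpos2 by simp
  have "4 * ((a\<^sup>2 - b\<^sup>2) / (2 * b\<^sup>2)) = 2 * (a\<^sup>2 - b\<^sup>2) / b\<^sup>2"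
  proof -
    have "4 * (X / (2 * Y)) = 2 * X / Y" for X Y :: real by simp
    then show ?thesis .
  qed
  also have "\<dots> \<le> 2 * (51 / 50 * (a\<^sup>2 - B\<^sup>2)) / (49 / 50 * B\<^sup>2)"
    using gap b2 B2 pos by (intro frac_le mult_left_mono) auto
  also have "\<dots> = (a\<^sup>2 - B\<^sup>2) * (102 / (49 * B\<^sup>2))"
  proof -
    have "2 * (51 / 50 * X) / (49 / 50 * Y) = X * (102 / (49 * Y))" for X Y :: real by simp
    then show ?thesis .
  qed
  \<comment> \<open>The one-step rate is 2 (a^2 - b^2) / b^2, while rho has the factor 4 over B a.
    The spare factor 2 pays for a / B <= 1.14 and for the 51 / 49 that came from replacing b by
    B.\<close>
  also have "\<dots> \<le> (a\<^sup>2 - B\<^sup>2) * (4 / (B * a))"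
  proof (intro mult_left_mono pos)
    have "102 * (B * a) \<le> 102 * (B * (1.14 * B))" using a_le Bpos by (intro mult_left_mono) auto
    also have "\<dots> \<le> 4 * (49 * B\<^sup>2)" by (simp add: power2_eq_square)
    finally show "102 / (49 * B\<^sup>2) \<le> 4 / (B * a)"
      using Bpos apos by (simp add: divide_le_eq pos_le_divide_eq mult.commute)
  qed
  also have "\<dots> = R" by (simp add: R_def)
  finally show "4 * ((a\<^sup>2 - b\<^sup>2) / (2 * b\<^sup>2)) \<le> gcosamp_rho m (s\<^sup>2)" using R by simp

  have den: "m\<^sup>2 / (m + 1) - s\<^sup>2 = B * (m / sqrt (m + 1) + s)"
    using m1 by (simp add: B_def power2_eq_square algebra_simps)
  have Bs: "m / sqrt (m + 1) + s \<le> a" "0 < m / sqrt (m + 1) + s"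
    using sandwich(3) Bpos s by (auto simp: B_def a)
  \<comment> \<open>The value 6 s / (B a) separates the two sides: 9 / 2 times 50 / 49 times 1.14 is
    below 6, and xi is at least 2 s / (B a) times 3, because its denominator is at most B a and a /
    B >= 1.\<close>
  have "9 / 2 * s / b\<^sup>2 \<le> 9 / 2 * s / (49 / 50 * B\<^sup>2)"
    using b2 B2 s bpos2 by (intro divide_left_mono) auto
  also have "\<dots> = s * (450 / (98 * B\<^sup>2))" by simp
  also have "\<dots> \<le> s * (6 / (B * a))"
  proof (intro mult_left_mono)
    have "450 * (B * a) \<le> 450 * (B * (1.14 * B))" using a_le Bpos by (intro mult_left_mono) auto
    also have "\<dots> \<le> 6 * (98 * B\<^sup>2)" by (simp add: power2_eq_square)
    finally show "450 / (98 * B\<^sup>2) \<le> 6 / (B * a)"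
      using Bpos apos by (simp add: divide_le_eq pos_le_divide_eq mult.commute)
  qed (use s in simp)
  also have "\<dots> = (2 * s * 1) / (B * a) * 3" by simp
  also have "\<dots> \<le> (2 * s * sqrt ((m + 1) / m)) / (B * (m / sqrt (m + 1) + s)) * (2 + a / B)"
  proof (rule mult_mono)
    show "(2 * s * 1) / (B * a) \<le> (2 * s * sqrt ((m + 1) / m)) / (B * (m / sqrt (m + 1) + s))"
    proof (rule frac_le)
      have "1 \<le> sqrt ((m + 1) / m)" using m1 by simp
      then show "2 * s * 1 \<le> 2 * s * sqrt ((m + 1) / m)" using s by (intro mult_left_mono) auto
      show "B * (m / sqrt (m + 1) + s) \<le> B * a" using Bs Bpos by (intro mult_left_mono) auto
      show "0 < B * (m / sqrt (m + 1) + s)" using Bs Bpos by (intro mult_pos_pos)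
      show "0 \<le> 2 * s * sqrt ((m + 1) / m)" using s m1 by simp
    qed
    show "3 \<le> 2 + a / B" using aB s Bpos by (simp add: pos_le_divide_eq)
    have "0 \<le> B * (m / sqrt (m + 1) + s)" using Bs Bpos by (intro mult_nonneg_nonneg) auto
    then show "0 \<le> (2 * s * sqrt ((m + 1) / m)) / (B * (m / sqrt (m + 1) + s))" using s m1 by simp
  qed simp
  also have "\<dots> = gcosamp_xi m (s\<^sup>2)"
    unfolding gcosamp_xi_def den sq by (simp add: a_def B_def)
  finally show "9 / 2 * s / b\<^sup>2 \<le> gcosamp_xi m (s\<^sup>2)" .
qed


section \<open>Dense sets of directions, the law of A, and the noise\<close>

lemma closed_norm_le_on_closure:
  fixes A :: "real ^ 'n::finite ^ 'm::finite"
  assumes "K \<subseteq> closure C" "z \<in> K"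
  shows "(\<And>z. z \<in> C \<Longrightarrow> norm (A *v z) \<le> a) \<Longrightarrow> norm (A *v z) \<le> a"
    and "(\<And>z. z \<in> C \<Longrightarrow> b \<le> norm (A *v z)) \<Longrightarrow> b \<le> norm (A *v z)"
    and "(\<And>z. z \<in> C \<Longrightarrow> (A *v z) \<bullet> e \<le> N) \<Longrightarrow> (A *v z) \<bullet> e \<le> N"
proof -
  have c: "continuous_on UNIV (\<lambda>z. A *v z)" by (rule linear_continuous_on) (rule matrix_vector_mul_bounded_linear)
  have "closed {z. norm (A *v z) \<le> a}" "closed {z. b \<le> norm (A *v z)}" "closed {z. (A *v z) \<bullet> e \<le> N}"
    by (intro closed_Collect_le continuous_intros c)+
  then have m: "C \<subseteq> {z. norm (A *v z) \<le> a} \<Longrightarrow> closure C \<subseteq> {z. norm (A *v z) \<le> a}"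
    "C \<subseteq> {z. b \<le> norm (A *v z)} \<Longrightarrow> closure C \<subseteq> {z. b \<le> norm (A *v z)}"
    "C \<subseteq> {z. (A *v z) \<bullet> e \<le> N} \<Longrightarrow> closure C \<subseteq> {z. (A *v z) \<bullet> e \<le> N}"
    by (simp_all add: closure_minimal)
  show "(\<And>z. z \<in> C \<Longrightarrow> norm (A *v z) \<le> a) \<Longrightarrow> norm (A *v z) \<le> a"
    using m(1) assms by blast
  show "(\<And>z. z \<in> C \<Longrightarrow> b \<le> norm (A *v z)) \<Longrightarrow> b \<le> norm (A *v z)"
    using m(2) assms by blast
  show "(\<And>z. z \<in> C \<Longrightarrow> (A *v z) \<bullet> e \<le> N) \<Longrightarrow> (A *v z) \<bullet> e \<le> N"
    using m(3) assms by blast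
qed

text \<open>Independence identifies the joint law of the entries with the product of their laws, and
  \<open>matrix_of\<close> reassembles the matrix from the pair-indexed entries.\<close>

lemma (in prob_space) gaussian_matrix_distr:
  fixes A :: "'a \<Rightarrow> real ^ 'n::finite ^ 'm::finite"
  assumes indep: "indep_vars (\<lambda>_. borel) (\<lambda>(i, j) \<omega>. A \<omega> $ i $ j) (UNIV :: ('m \<times> 'n) set)"
    and normal: "\<forall>i j. distributed M lborel (\<lambda>\<omega>. A \<omega> $ i $ j) (\<lambda>u. ennreal (std_normal_density u))"
  shows "A \<in> borel_measurable M"
    and "distr M borel A = distr (gaussian_product UNIV) borel matrix_of"
proof -
  have ent[measurable]: "(\<lambda>\<omega>. A \<omega> $ i $ j) \<in> borel_measurable M" for i j
    using normal distributed_measurable by fastforce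
  have "(\<lambda>\<omega>. \<chi> i. \<chi> j. A \<omega> $ i $ j) \<in> borel_measurable M"
    by (intro measurable_vec_lambda ent)
  then show A: "A \<in> borel_measurable M" by simp
  let ?\<Phi> = "\<lambda>\<omega>. \<lambda>p\<in>UNIV. (case p of (i, j) \<Rightarrow> \<lambda>\<omega>. A \<omega> $ i $ j) \<omega>"
  have d: "distr M borel (\<lambda>\<omega>. A \<omega> $ i $ j) = std_normal_distribution" for i j
  proof -
    have "distr M borel (\<lambda>\<omega>. A \<omega> $ i $ j) = distr M lborel (\<lambda>\<omega>. A \<omega> $ i $ j)"
      by (rule distr_cong) auto
    then show ?thesis using normal by (simp add: distributed_def)
  qed
  have "distr M (Pi\<^sub>M UNIV (\<lambda>_. borel)) ?\<Phi>
      = Pi\<^sub>M UNIV (\<lambda>p. distr M borel (case p of (i, j) \<Rightarrow> \<lambda>\<omega>. A \<omega> $ i $ j))"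
    by (rule indep_vars_iff_distr_eq_PiM'[THEN iffD1, OF _ _ indep]) auto
  also have "\<dots> = gaussian_product UNIV" by (intro PiM_cong refl) (auto simp: d split: prod.split)
  finally have g: "gaussian_product UNIV = distr M (Pi\<^sub>M UNIV (\<lambda>_. borel)) ?\<Phi>" by simp
  have \<Phi>: "?\<Phi> \<in> measurable M (Pi\<^sub>M UNIV (\<lambda>_. borel))"
    by (intro measurable_restrict) (auto split: prod.split)
  have "(\<lambda>x. matrix_of x :: real ^ 'n ^ 'm) \<in> borel_measurable (gaussian_product UNIV)"
    using measurable_matrix_of[of "\<lambda>p. p"] .
  moreover have "sets (gaussian_product (UNIV :: ('m \<times> 'n) set)) = sets (Pi\<^sub>M UNIV (\<lambda>_. borel))"
    by (intro sets_PiM_cong) auto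
  ultimately have mat: "matrix_of \<in> borel_measurable (Pi\<^sub>M (UNIV :: ('m \<times> 'n) set) (\<lambda>_. borel :: real measure))"
    by (simp cong: measurable_cong_sets)
  have "distr (gaussian_product UNIV) borel matrix_of = distr M borel (matrix_of \<circ> ?\<Phi>)"
    unfolding g by (rule distr_distr[OF mat \<Phi>])
  also have "matrix_of \<circ> ?\<Phi> = A" by (auto simp: matrix_of_def fun_eq_iff vec_eq_iff)
  finally show "distr M borel A = distr (gaussian_product UNIV) borel matrix_of" by simp
qed

lemma measure_gaussian_matrix:
  assumes [measurable]: "S \<in> sets borel"
  shows "measure (distr (gaussian_product UNIV) borel matrix_of) S
    = measure (gaussian_product UNIV) {x. (matrix_of x :: real ^ 'n::finite ^ 'm::finite) \<in> S}"
proof -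
  have [measurable]: "(\<lambda>x. matrix_of x :: real ^ 'n ^ 'm) \<in> borel_measurable (gaussian_product UNIV)"
    using measurable_matrix_of[of "\<lambda>p. p"] .
  show ?thesis by (subst measure_distr) (auto simp: space_PiM vimage_def)
qed

text \<open>Measurability of the exceptional events rests on \<open>C\<close> being countable. The
  third one is a set of pairs because A and the noise are both random.\<close>

lemma sets_matrix_Collect:
  assumes "countable C"
  shows "{A :: real ^ 'n::finite ^ 'm::finite. \<exists>z\<in>C. a \<le> norm (A *v z)} \<in> sets borel"
    "{A :: real ^ 'n ^ 'm. \<exists>z\<in>C. norm (A *v z) \<le> a} \<in> sets borel"
    "{p :: (real ^ 'n ^ 'm) \<times> (real ^ 'm). \<exists>z\<in>C. c * norm (snd p) < (fst p *v z) \<bullet> snd p} \<in> sets (borel \<Otimes>\<^sub>M borel)"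
proof -
  have [measurable]: "(\<lambda>A :: real ^ 'n ^ 'm. A *v z) \<in> borel_measurable borel" for z
    by (rule measurable_matrix_vector_mult) simp
  have [measurable]: "(\<lambda>p :: (real ^ 'n ^ 'm) \<times> (real ^ 'm). fst p *v z) \<in> borel_measurable (borel \<Otimes>\<^sub>M borel)" for z
    by (rule measurable_matrix_vector_mult) simp
  have "{A :: real ^ 'n ^ 'm. \<exists>z\<in>C. a \<le> norm (A *v z)} = (\<Union>z\<in>C. {A \<in> space borel. a \<le> norm (A *v z)})" by auto
  also have "\<dots> \<in> sets borel" using assms by (intro sets.countable_UN') auto
  finally show "{A :: real ^ 'n ^ 'm. \<exists>z\<in>C. a \<le> norm (A *v z)} \<in> sets borel" .
  have "{A :: real ^ 'n ^ 'm. \<exists>z\<in>C. norm (A *v z) \<le> a} = (\<Union>z\<in>C. {A \<in> space borel. norm (A *v z) \<le> a})" by auto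
  also have "\<dots> \<in> sets borel" using assms by (intro sets.countable_UN') auto
  finally show "{A :: real ^ 'n ^ 'm. \<exists>z\<in>C. norm (A *v z) \<le> a} \<in> sets borel" .
  have "{p :: (real ^ 'n ^ 'm) \<times> (real ^ 'm). \<exists>z\<in>C. c * norm (snd p) < (fst p *v z) \<bullet> snd p}
      = (\<Union>z\<in>C. {p \<in> space (borel \<Otimes>\<^sub>M borel). c * norm (snd p) < (fst p *v z) \<bullet> snd p})"
    by (auto simp: space_pair_measure)
  also have "\<dots> \<in> sets (borel \<Otimes>\<^sub>M borel)"
  proof (rule sets.countable_UN'[OF assms])
    have "{p \<in> space (borel \<Otimes>\<^sub>M borel). c * norm (snd p) < (fst p *v z) \<bullet> snd p} \<in> sets (borel \<Otimes>\<^sub>M borel)"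
      for z :: "real ^ 'n" by measurable
    then show "(\<lambda>z. {p \<in> space (borel \<Otimes>\<^sub>M borel). c * norm (snd p) < (fst p *v z) \<bullet> snd p}) ` C
        \<subseteq> sets (borel \<Otimes>\<^sub>M borel)" by auto
  qed
  finally show "{p :: (real ^ 'n ^ 'm) \<times> (real ^ 'm). \<exists>z\<in>C. c * norm (snd p) < (fst p *v z) \<bullet> snd p} \<in> sets (borel \<Otimes>\<^sub>M borel)" .
qed


text \<open>By independence the joint law of (A, e) is a product, and Fubini reduces the event to
  its sections at a fixed noise vector y. Division by |y| turns such a section into the event of
  \<open>gaussian_linear_form_tail\<close> for a unit vector.\<close>

lemma (in prob_space) gaussian_noise_tail:
  fixes A :: "'a \<Rightarrow> real ^ 'n::finite ^ 'm::finite" and e :: "'a \<Rightarrow> real ^ 'm"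
  assumes A[measurable]: "A \<in> borel_measurable M" and e[measurable]: "e \<in> borel_measurable M"
    and law: "distr M borel A = distr (gaussian_product UNIV) borel matrix_of"
    and ind: "indep_set (sets (vimage_algebra (space M) A borel)) (sets (vimage_algebra (space M) e borel))"
    and K: "K \<subseteq> sphere 0 1" "\<And>z. z \<in> K \<Longrightarrow> - z \<in> K" and \<eta>: "\<eta> > 0"
    and C: "countable C" "C \<subseteq> K"
  shows "prob {\<omega> \<in> space M. \<exists>z\<in>C. (gaussian_width K + \<eta>) * norm (e \<omega>) < (A \<omega> *v z) \<bullet> e \<omega>} \<le> exp (- (\<eta>\<^sup>2 / 2))"
proof -
  define c where "c = gaussian_width K + \<eta>"
  let ?S = "{p :: (real ^ 'n ^ 'm) \<times> (real ^ 'm). \<exists>z\<in>C. c * norm (snd p) < (fst p *v z) \<bullet> snd p}"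
  have S[measurable]: "?S \<in> sets (borel \<Otimes>\<^sub>M borel)" by (rule sets_matrix_Collect[OF C(1)])
  interpret PA: prob_space "distr M borel A" by (rule prob_space_distr) simp
  interpret Pe: prob_space "distr M borel e" by (rule prob_space_distr) simp
  interpret pair_sigma_finite "distr M borel A" "distr M borel e" ..
  have joint: "distr M borel A \<Otimes>\<^sub>M distr M borel e = distr M (borel \<Otimes>\<^sub>M borel) (\<lambda>\<omega>. (A \<omega>, e \<omega>))"
  proof (rule pair_measure_eqI)
    fix X Y assume XY: "X \<in> sets (distr M borel A)" "Y \<in> sets (distr M borel e)"
    have mem: "A -` X \<inter> space M \<in> sets (vimage_algebra (space M) A borel)"
      "e -` Y \<inter> space M \<in> sets (vimage_algebra (space M) e borel)"
      using XY by (auto simp: in_vimage_algebra)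
    have "prob ((A -` X \<inter> space M) \<inter> (e -` Y \<inter> space M)) = prob (A -` X \<inter> space M) * prob (e -` Y \<inter> space M)"
      using ind mem unfolding indep_sets2_eq by blast
    moreover have "(\<lambda>\<omega>. (A \<omega>, e \<omega>)) -` (X \<times> Y) \<inter> space M = (A -` X \<inter> space M) \<inter> (e -` Y \<inter> space M)" by auto
    moreover have "X \<times> Y \<in> sets (borel \<Otimes>\<^sub>M borel)" using XY by auto
    ultimately show "emeasure (distr M borel A) X * emeasure (distr M borel e) Y
        = emeasure (distr M (borel \<Otimes>\<^sub>M borel) (\<lambda>\<omega>. (A \<omega>, e \<omega>))) (X \<times> Y)"
      using XY by (simp add: emeasure_distr emeasure_eq_measure ennreal_mult)
  next
    show "sigma_finite_measure (distr M borel A)" "sigma_finite_measure (distr M borel e)" by unfold_locales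
    show "sets (distr M borel A \<Otimes>\<^sub>M distr M borel e) = sets (distr M (borel \<Otimes>\<^sub>M borel) (\<lambda>\<omega>. (A \<omega>, e \<omega>)))"
      unfolding sets_distr by (rule sets_pair_measure_cong) simp_all
  qed
  have sec: "emeasure (distr M borel A) ((\<lambda>x. (x, y)) -` ?S) \<le> ennreal (exp (- (\<eta>\<^sup>2 / 2)))" for y :: "real ^ 'm"
  proof (cases "y = 0")
    \<comment> \<open>The strict inequality in the event makes the section at y = 0 empty.\<close>
    case True
    then have "(\<lambda>x. (x, y)) -` ?S = {}" by auto
    then show ?thesis by simp
  next
    case False
    define u where "u = y /\<^sub>R norm y"
    have u: "norm u = 1" using False by (simp add: u_def)
    have T: "(\<lambda>x. (x, y)) -` ?S \<in> sets borel"
      using measurable_sets[OF measurable_Pair2'[of y borel borel] S] by (simp add: space_pair_measure)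
    let ?U = "\<Union>z\<in>C. {x. gaussian_width K + \<eta> \<le> (matrix_of x *v z) \<bullet> u}"
    have "PA.prob ((\<lambda>x. (x, y)) -` ?S) = measure (gaussian_product UNIV) {x. matrix_of x \<in> (\<lambda>x. (x, y)) -` ?S}"
      unfolding law by (rule measure_gaussian_matrix[OF T])
    also have "\<dots> \<le> measure (gaussian_product UNIV) ?U"
    proof (rule finite_measure.finite_measure_mono)
      show "finite_measure (gaussian_product (UNIV :: ('m \<times> 'n) set))"
        using prob_space_gaussian_product prob_space.finite_measure by blast
      show "{x. matrix_of x \<in> (\<lambda>x. (x, y)) -` ?S} \<subseteq> ?U"
      proof clarsimp
        fix x z assume z: "z \<in> C" "c * norm y < (matrix_of x *v z) \<bullet> y"
        have "(matrix_of x *v z) \<bullet> u = ((matrix_of x *v z) \<bullet> y) / norm y" by (simp add: u_def divide_inverse_commute)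
        then have "c \<le> (matrix_of x *v z) \<bullet> u" using z False by (simp add: pos_le_divide_eq)
        then show "\<exists>z\<in>C. gaussian_width K + \<eta> \<le> (matrix_of x *v z) \<bullet> u" using z by (auto simp: c_def)
      qed
      have [measurable]: "(\<lambda>x. matrix_of x :: real ^ 'n ^ 'm) \<in> borel_measurable (gaussian_product UNIV)"
        using measurable_matrix_of[of "\<lambda>p. p"] .
      have "{x \<in> space (gaussian_product UNIV). gaussian_width K + \<eta> \<le> (matrix_of x *v z) \<bullet> u} \<in> sets (gaussian_product UNIV)" for z
        by measurable
      then show "?U \<in> sets (gaussian_product UNIV)"
        using C(1) by (intro sets.countable_UN') (auto simp: space_PiM)
    qed
    also have "\<dots> \<le> exp (- (\<eta>\<^sup>2 / 2))" by (rule gaussian_linear_form_tail[OF K \<eta> C u])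
    finally show ?thesis by (simp add: PA.emeasure_eq_measure ennreal_leI)
  qed
  have "emeasure (distr M borel A \<Otimes>\<^sub>M distr M borel e) ?S = (\<integral>\<^sup>+y. emeasure (distr M borel A) ((\<lambda>x. (x, y)) -` ?S) \<partial>distr M borel e)"
    by (rule emeasure_pair_measure_alt2) (simp add: S cong: sets_pair_measure_cong)
  also have "\<dots> \<le> (\<integral>\<^sup>+y. ennreal (exp (- (\<eta>\<^sup>2 / 2))) \<partial>distr M borel e)"
    by (intro nn_integral_mono sec)
  also have "\<dots> = ennreal (exp (- (\<eta>\<^sup>2 / 2)))" using Pe.emeasure_space_1 by simp
  finally have "emeasure (distr M (borel \<Otimes>\<^sub>M borel) (\<lambda>\<omega>. (A \<omega>, e \<omega>))) ?S \<le> ennreal (exp (- (\<eta>\<^sup>2 / 2)))"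
    by (simp only: joint)
  then have "emeasure M ((\<lambda>\<omega>. (A \<omega>, e \<omega>)) -` ?S \<inter> space M) \<le> ennreal (exp (- (\<eta>\<^sup>2 / 2)))"
    by (subst (asm) emeasure_distr) (use S in measurable)
  then have "prob ((\<lambda>\<omega>. (A \<omega>, e \<omega>)) -` ?S \<inter> space M) \<le> exp (- (\<eta>\<^sup>2 / 2))"
    by (simp add: emeasure_eq_measure ennreal_le_iff)
  also have "(\<lambda>\<omega>. (A \<omega>, e \<omega>)) -` ?S \<inter> space M = {\<omega> \<in> space M. \<exists>z\<in>C. c * norm (e \<omega>) < (A \<omega> *v z) \<bullet> e \<omega>}"
    by auto
  finally show ?thesis by (simp add: c_def)
qed


section \<open>Assembly on the good event\<close>

lemma subspace_union_scale:
  assumes "\<forall>V\<in>S. subspace V" "z \<in> subspace_union S B"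
  shows "c *\<^sub>R z \<in> subspace_union S B"
proof -
  obtain W where W: "W \<in> subspace_sums S B" "z \<in> W" using assms(2) by (auto simp: subspace_union_def)
  then have "c *\<^sub>R z \<in> W" using subspace_of_subspace_sums[OF assms(1)] by (intro subspace_scale)
  then show ?thesis using W by (auto simp: subspace_union_def)
qed

theorem corollary5:
  fixes M :: "'w measure"
    and A :: "'w \<Rightarrow> real ^ 'n::finite ^ 'm::finite"
    and e :: "'w \<Rightarrow> real ^ 'm"
    and S :: "(real ^ 'n) set set"
    and x :: "real ^ 'n"
    and \<eta> m m0 \<epsilon> :: real
  assumes "prob_space M"
    and "\<forall>V\<in>S. subspace V"
    and "x \<in> subspace_union S 1"
    and "CARD('m) < CARD('n)"
    and "m = real CARD('m)"
    and "prob_space.indep_vars M (\<lambda>_. borel) (\<lambda>(i, j) \<omega>. A \<omega> $ i $ j) (UNIV :: ('m \<times> 'n) set)"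
    and "\<forall>i j. distributed M lborel (\<lambda>\<omega>. A \<omega> $ i $ j) (\<lambda>u. ennreal (std_normal_density u))"
    and "e \<in> borel_measurable M"
    and "prob_space.indep_set M (sets (vimage_algebra (space M) A borel))
                                (sets (vimage_algebra (space M) e borel))"
    and "AE \<omega> in M. norm (e \<omega>) \<le> \<epsilon>"
    and "\<eta> > 0"
    and "m0 = (gaussian_width (subspace_union S 4 \<inter> sphere 0 1) + \<eta>)\<^sup>2"
    and "m \<ge> 14.5\<^sup>2 * m0 + 1"
  shows "\<exists>E\<in>sets M. measure M E \<ge> 1 - 6 * exp (- (\<eta>\<^sup>2 / 2)) \<and>
           (\<forall>\<omega>\<in>E. \<forall>X. gcosamp_iterates (A \<omega>) (A \<omega> *v x + e \<omega>) S X \<longrightarrow>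
              (\<forall>t. ereal (norm (X t - x)) \<le>
                 (if gcosamp_rho m m0 = 1 then \<infinity>
                  else ereal (gcosamp_rho m m0 ^ t * norm (X 0 - x)
                              + gcosamp_xi m m0 / (1 - gcosamp_rho m m0) * norm (e \<omega>)))))"
proof -
  interpret prob_space M by (rule assms(1))
  note S = assms(2) and x = assms(3) and m = assms(5) and e[measurable] = assms(8)
    and ind = assms(9) and \<eta> = assms(11) and m0 = assms(12)
  define K where "K = subspace_union S 4 \<inter> sphere 0 1"
  define s where "s = gaussian_width K + \<eta>"
  have K: "K \<subseteq> sphere 0 1" by (simp add: K_def)
  have K_neg: "- z \<in> K" if "z \<in> K" for z
    using that subspace_union_scale[OF S, of z 4 "-1"] by (auto simp: K_def)
  have m0s: "m0 = s\<^sup>2" by (simp add: m0 s_def K_def)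
  have width: "gaussian_width K \<ge> 0"
    using gaussian_width_nonneg[OF K K_neg] by (cases "K = {}") (auto simp: gaussian_width_def)
  \<comment> \<open>If rho is 1 the bound is infinite and the whole space serves as the event; if
    the required probability is nonpositive, the empty event does.\<close>
  consider (trivial) "gcosamp_rho m m0 = 1 \<or> 1 - 6 * exp (- (\<eta>\<^sup>2 / 2)) \<le> 0"
    | (main) "gcosamp_rho m m0 \<noteq> 1" "1 - 6 * exp (- (\<eta>\<^sup>2 / 2)) > 0" by linarith
  then show ?thesis
  proof cases
    case trivial
    then show ?thesis
    proof
      assume "gcosamp_rho m m0 = 1"
      then show ?thesis by (intro bexI[of _ "space M"]) (auto simp: prob_space)
    next
      assume "1 - 6 * exp (- (\<eta>\<^sup>2 / 2)) \<le> 0"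
      then show ?thesis by (intro bexI[of _ "{}"]) auto
    qed
  next
    case main
    \<comment> \<open>Otherwise exp (- \<eta>^2 / 2) would be at least 1 / e >= 1 / 3, and the
      required probability would be negative. So \<eta> exceeds sqrt 2 > 7 / 5, the lower bound on s
      under which the constants compare.\<close>
    have "\<eta>\<^sup>2 / 2 > 1"
    proof (rule ccontr)
      assume "\<not> \<eta>\<^sup>2 / 2 > 1"
      then have "exp (\<eta>\<^sup>2 / 2) \<le> exp 1" by simp
      also have "\<dots> \<le> 3" by (rule exp_le)
      finally have "1 / 3 \<le> exp (- (\<eta>\<^sup>2 / 2))" by (simp add: exp_minus field_simps)
      then show False using main(2) by simp
    qed
    then have "(7 / 5)\<^sup>2 \<le> \<eta>\<^sup>2" by (simp add: power2_eq_square)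
    then have "7 / 5 \<le> \<eta>" by (rule power2_le_imp_le) (use \<eta> in simp)
    then have s: "7 / 5 \<le> s" using width by (simp add: s_def)
    define a where "a = sqrt m + s"
    define b where "b = m / sqrt (m + 2) - s"
    have rho: "gcosamp_rho m (s\<^sup>2) \<noteq> 1" using main(1) by (simp add: m0s)
    have m14: "m \<ge> 14.5\<^sup>2 * s\<^sup>2 + 1" using assms(13) by (simp add: m0s)
    note const = gcosamp_constants[OF s m14 rho, folded a_def b_def]
    \<comment> \<open>Countable for the sake of measurability, dense so that bounds on it extend to
      all unit vectors of U^4.\<close>
    obtain C where C: "countable C" "C \<subseteq> K" "K \<subseteq> closure C" by (rule separable)
    have A[measurable]: "A \<in> borel_measurable M" and law: "distr M borel A = distr (gaussian_product UNIV) borel matrix_of"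
      using gaussian_matrix_distr[OF assms(6,7)] by auto
    define r where "r = (\<integral>x. norm (\<chi> i. x i :: real ^ 'm) \<partial>gaussian_product UNIV)"
    have r: "r \<le> sqrt m" "m / sqrt (m + 2) \<le> r"
      using expectation_norm_gaussian[where ?'m = 'm] by (simp_all add: r_def m)
    \<comment> \<open>The events use the exact mean r of the Gaussian norm, for which the tail
      bounds are stated; the estimates of r then give a >= r + s and b <= r - s.\<close>
    define T1 where "T1 = {A :: real ^ 'n ^ 'm. \<exists>z\<in>C. r + s \<le> norm (A *v z)}"
    define T2 where "T2 = {A :: real ^ 'n ^ 'm. \<exists>z\<in>C. norm (A *v z) \<le> r - s}"
    have T[measurable]: "T1 \<in> sets borel" "T2 \<in> sets borel"
      unfolding T1_def T2_def by (rule sets_matrix_Collect[OF C(1)])+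
    define E1 where "E1 = A -` T1 \<inter> space M"
    define E2 where "E2 = A -` T2 \<inter> space M"
    define E3 where "E3 = {\<omega> \<in> space M. \<exists>z\<in>C. s * norm (e \<omega>) < (A \<omega> *v z) \<bullet> e \<omega>}"
    have "E3 = (\<lambda>\<omega>. (A \<omega>, e \<omega>)) -` {p. \<exists>z\<in>C. s * norm (snd p) < (fst p *v z) \<bullet> snd p} \<inter> space M"
      by (auto simp: E3_def)
    also have "\<dots> \<in> events"
      by (rule measurable_sets[OF _ sets_matrix_Collect(3)[OF C(1)]]) measurable
    finally have E3: "E3 \<in> events" .
    have E12: "E1 \<in> events" "E2 \<in> events" unfolding E1_def E2_def by measurable
    have P1: "prob E1 \<le> exp (- (\<eta>\<^sup>2 / 2))"
    proof -
      have "prob E1 = measure (distr M borel A) T1" unfolding E1_def by (simp add: measure_distr T)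
      also have "\<dots> = measure (gaussian_product UNIV) {x. matrix_of x \<in> T1}"
        unfolding law by (rule measure_gaussian_matrix[OF T(1)])
      also have "{x. matrix_of x \<in> T1} = (\<Union>z\<in>C. {x. r + gaussian_width K + \<eta> \<le> norm (matrix_of x *v z :: real ^ 'm)})"
        by (auto simp: T1_def s_def add.assoc)
      also have "measure (gaussian_product UNIV) \<dots> \<le> exp (- (\<eta>\<^sup>2 / 2))"
        unfolding r_def by (rule gaussian_max_norm_tail[OF K K_neg \<eta> C(1,2)])
      finally show ?thesis .
    qed
    have P2: "prob E2 \<le> exp (- (\<eta>\<^sup>2 / 2))"
    proof -
      have "prob E2 = measure (distr M borel A) T2" unfolding E2_def by (simp add: measure_distr T)
      also have "\<dots> = measure (gaussian_product UNIV) {x. matrix_of x \<in> T2}"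
        unfolding law by (rule measure_gaussian_matrix[OF T(2)])
      also have "{x. matrix_of x \<in> T2} = (\<Union>z\<in>C. {x. norm (matrix_of x *v z :: real ^ 'm) \<le> r - gaussian_width K - \<eta>})"
        by (auto simp: T2_def s_def diff_diff_eq)
      also have "measure (gaussian_product UNIV) \<dots> \<le> exp (- (\<eta>\<^sup>2 / 2))"
        unfolding r_def by (rule gaussian_min_norm_tail[OF K K_neg \<eta> C(1,2)])
      finally show ?thesis .
    qed
    have P3: "prob E3 \<le> exp (- (\<eta>\<^sup>2 / 2))"
      unfolding E3_def s_def by (rule gaussian_noise_tail[OF A e law ind K K_neg \<eta> C(1,2)])
    define E where "E = space M - (E1 \<union> (E2 \<union> E3))"
    have E: "E \<in> events" unfolding E_def using E12 E3 by auto
    have "prob (E1 \<union> (E2 \<union> E3)) \<le> prob E1 + (prob E2 + prob E3)"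
      using measure_Un_le[of E1 M "E2 \<union> E3"] measure_Un_le[of E2 M E3] E12 E3 by auto
    moreover have "prob E = 1 - prob (E1 \<union> (E2 \<union> E3))"
      unfolding E_def using E12 E3 by (intro prob_compl) auto
    moreover have "exp (- (\<eta>\<^sup>2 / 2)) > 0" by simp
    ultimately have PE: "prob E \<ge> 1 - 6 * exp (- (\<eta>\<^sup>2 / 2))" using P1 P2 P3 by linarith
    have "norm (X t - x) \<le> gcosamp_rho m m0 ^ t * norm (X 0 - x) + gcosamp_xi m m0 / (1 - gcosamp_rho m m0) * norm (e \<omega>)"
      if \<omega>: "\<omega> \<in> E" and X: "gcosamp_iterates (A \<omega>) (A \<omega> *v x + e \<omega>) S X" for \<omega> X t
    proof -
      have onC: "norm (A \<omega> *v z) \<le> a" "b \<le> norm (A \<omega> *v z)" "(A \<omega> *v z) \<bullet> e \<omega> \<le> s * norm (e \<omega>)" if "z \<in> C" for z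
        using \<omega> that r by (force simp: E_def E1_def E2_def E3_def T1_def T2_def a_def b_def not_le not_less)+
      have onK: "norm (A \<omega> *v z) \<le> a" "b \<le> norm (A \<omega> *v z)" "(A \<omega> *v z) \<bullet> e \<omega> \<le> s * norm (e \<omega>)" if "z \<in> K" for z
        using closed_norm_le_on_closure[OF C(3) that] onC by blast+
      \<comment> \<open>All three bounds are homogeneous in z, hence extend from unit vectors to
        U^4.\<close>
      have onU: "norm (A \<omega> *v z) \<le> a * norm z \<and> b * norm z \<le> norm (A \<omega> *v z) \<and> (A \<omega> *v z) \<bullet> e \<omega> \<le> s * norm (e \<omega>) * norm z"
        if "z \<in> subspace_union S 4" for z
      proof (cases "z = 0")
        case False
        define u where "u = z /\<^sub>R norm z"
        have u: "u \<in> K" using subspace_union_scale[OF S that] False by (simp add: u_def K_def)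
        have "z = norm z *\<^sub>R u" using False by (simp add: u_def)
        then have Az: "A \<omega> *v z = norm z *\<^sub>R (A \<omega> *v u)"
          by (metis linear_scale matrix_vector_mul_linear)
        show ?thesis
          unfolding Az using onK[OF u, THEN mult_left_mono, OF norm_ge_zero[of z]]
          by (simp add: mult.commute)
      qed simp
      show ?thesis unfolding m0s
      proof (rule gcosamp_error[OF S x const(1,2,3) _ _ _ _ X const(4,5)])
        show "0 \<le> s * norm (e \<omega>)" using s by simp
        show "9 / 2 * (s * norm (e \<omega>)) / b\<^sup>2 \<le> gcosamp_xi m (s\<^sup>2) * norm (e \<omega>)"
          using mult_right_mono[OF const(6), of "norm (e \<omega>)"] by simp
      qed (use onU in blast)+
    qed
    then show ?thesis using E PE main(1) by (intro bexI[of _ E]) auto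
  qed
qed

end
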